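(* Let $q\equiv1\pmod4$ be a prime power and let $\mathcal U_3$, $\mathcal X^+$, $\mathfrak G$, $\mathfrak H$ be as in the context. Then: (C) $\mathfrak H$ has index $2$ in $\mathfrak G$, and $\mathfrak G$ and $\mathfrak H$ have the same orbits on $\mathcal X^+(\mathbb F_{q^2})$; (D) for every $\mathfrak G$-orbit $o$ on $\mathcal X^+(\mathbb F_{q^2})$, letting $\mathcal G_o$ be the set of generators of $\mathcal U_3$ meeting $o$, the group $\mathfrak G$ acts transitively on $\mathcal G_o$ while $\mathfrak H$ has two orbits on $\mathcal G_o$.
   Context: $q$ is a power of an odd prime $p$, $q\equiv1\pmod4$. In $\mathrm{PG}(3,q^2)$ with coordinates $(X_0,X_1,X_2,X_3)$ (points as column vectors, matrices acting by $x\mapsto Ax$), $\mathcal U_3$ is the Hermitian surface $X_1^{q+1}+2X_2^{q+1}=X_3^qX_0+X_3X_0^q$; a generator is a line of $\mathrm{PG}(3,q^2)$ contained in $\mathcal U_3$. $\mathcal X^+$ is the non-singular model in $\mathrm{PG}(3,\overline{\mathbb F}_{q^2})$ of the plane curve $y^qz-yz^q=x^{(q+1)/2}$ given by $(x,y,z)\mapsto(z^2,xz,yz,y^2)$; it is an $\mathbb F_{q^2}$-maximal curve of degree $q+1$ lying on $\mathcal U_3$, and $\mathcal X^+(\mathbb F_{q^2})$ is its set of $\mathbb F_{q^2}$-rational points. $\mathfrak G\le\mathrm{PGU}(4,q)$ is generated by the collineations with matrices $\mathbf T_\alpha=\begin{pmatrix}1&0&0&0\\0&1&0&0\\ \alpha&0&1&0\\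 \alpha^2&0&2\alpha&1\end{pmatrix}$ ($\alpha\in\mathbb F_q$), $\mathbf M_\rho=\mathrm{diag}(\rho^{-1},1,1,\rho)$ ($\rho$ non-zero square in $\mathbb F_q$), $\mathbf L_\lambda=\mathrm{diag}(1,\lambda,1,1)$ ($\lambda\in\mathbb F_{q^2}$, $\lambda^{(q+1)/2}=1$), $\mathbf N_\sigma=\begin{pmatrix}0&0&0&1\\0&\sigma&0&0\\0&0&1&0\\1&0&0&0\end{pmatrix}$ ($\sigma\in\mathbb F_{q^2}$, $\sigma^{(q+1)/2}=-1$), $\mathbf R_\mu=\begin{pmatrix}0&0&0&\mu^{-1}\\0&1&0&0\\0&0&1&0\\ \mu&0&0&0\end{pmatrix}$ ($\mu$ non-square in $\mathbb F_q$); these preserve $\mathcal X^+$. $\mathfrak H$ is the subgroup of $\mathfrak G$ generated by all elements of $p$-power order together with the collineations $\mathbf L_\lambda$.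
   Formalization: The displayed plane equation y^q z − y z^q = x^{(q+1)/2} is not homogeneous; it is read as the projective curve with affine equation y^q − y = x^{(q+1)/2} (z = 1), and X^+ is the Zariski closure of its image under (z^2, xz, yz, y^2). *)

theory Defs
  imports
    "HOL-Analysis.Analysis"
    "HOL-Algebra.Algebra"
    "HOL-Algebra.Algebraic_Closure_Type"
    "HOL-Number_Theory.Cong"
begin

text \<open>
  The homogeneous coordinates $(X_0,X_1,X_2,X_3)$ of $\mathrm{PG}(3,k)$ are the components
  \<open>v $ 1\<close>, \<open>v $ 2\<close>, \<open>v $ 3\<close>, \<open>v $ 4\<close>. A point is a one-dimensional subspace of $k^4$,
  a line is the set of points contained in a two-dimensional subspace.
\<close>

definition pg_points :: "('k::field ^ 4) set set" where
  "pg_points = {P. vec.subspace P \<and> vec.dim P = 1}"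

definition pg_lines :: "('k::field ^ 4) set set set" where
  "pg_lines = {{P \<in> pg_points. P \<subseteq> W} | W. vec.subspace W \<and> vec.dim W = 2}"

definition collineation :: "'k::field ^ 4 ^ 4 \<Rightarrow> ('k ^ 4) set \<Rightarrow> ('k ^ 4) set" where
  "collineation A = (\<lambda>P\<in>pg_points. (\<lambda>v. A *v v) ` P)"

definition hermitian_surface :: "nat \<Rightarrow> ('k::field ^ 4) set set" where
  "hermitian_surface q = {P \<in> pg_points. \<forall>v\<in>P.
     (v $ 2) ^ (q + 1) + 2 * (v $ 3) ^ (q + 1) = (v $ 4) ^ q * v $ 1 + v $ 4 * (v $ 1) ^ q}"

definition generators :: "nat \<Rightarrow> ('k::field ^ 4) set set set" where
  "generators q = {l \<in> pg_lines. l \<subseteq> hermitian_surface q}"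

text \<open>
  The homogeneous polynomial function of degree \<open>d\<close> in four variables with coefficients \<open>c\<close>
  (indexed by exponent vectors), and the Zariski closure of a set of points of the projective
  space over an algebraically closed field.
\<close>

definition form_eval :: "nat \<Rightarrow> ((4 \<Rightarrow> nat) \<Rightarrow> 'k::field) \<Rightarrow> 'k ^ 4 \<Rightarrow> 'k" where
  "form_eval d c v = (\<Sum>m | (\<Sum>i\<in>UNIV. m i) = d. c m * (\<Prod>i\<in>UNIV. (v $ i) ^ m i))"

definition zariski_closure :: "('k::alg_closed_field ^ 4) set set \<Rightarrow> ('k ^ 4) set set" where
  "zariski_closure S = {P \<in> pg_points. \<forall>d c.
     (\<forall>Q\<in>S. \<forall>v\<in>Q. form_eval d c v = 0) \<longrightarrow> (\<forall>v\<in>P. form_eval d c v = 0)}"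

text \<open>
  The plane curve is the projective curve with affine equation $y^q - y = x^{(q+1)/2}$, written
  here in homogeneous coordinates $(x,y,z)$. At its point $(1,0,0)$ with $z = 0$ all four
  components $z^2, xz, yz, y^2$ vanish, so the morphism is not given by the formula there; the
  missing point of the model is supplied by the Zariski closure.
\<close>

definition plane_curve :: "nat \<Rightarrow> ('k::field \<times> 'k \<times> 'k) set" where
  "plane_curve q = {(x, y, z). (x, y, z) \<noteq> (0, 0, 0) \<and>
     y ^ q - y * z ^ (q - 1) = x ^ ((q + 1) div 2) * z ^ ((q - 1) div 2)}"

definition X_plus :: "nat \<Rightarrow> ('k::alg_closed_field ^ 4) set set" where
  "X_plus q = zariski_closure
     {vec.span {vector [z\<^sup>2, x * z, y * z, y\<^sup>2]} | x y z.
        (x, y, z) \<in> plane_curve q \<and> (vector [z\<^sup>2, x * z, y * z, y\<^sup>2] :: 'k ^ 4) \<noteq> 0}"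

text \<open>
  With \<open>'a\<close> the field of $q^2$ elements, \<open>X_plus q\<close> is taken over \<open>'a alg_closure\<close>; its rational
  points are regarded as points of $\mathrm{PG}(3,q^2)$.
\<close>

definition X_plus_rational :: "nat \<Rightarrow> ('a::field ^ 4) set set" where
  "X_plus_rational q = {vec.span {v} | v.
     v \<noteq> 0 \<and> vec.span {(\<chi> i. to_ac (v $ i))} \<in> (X_plus q :: ('a alg_closure ^ 4) set set)}"

definition mat_T :: "'a::field \<Rightarrow> 'a ^ 4 ^ 4" where
  "mat_T \<alpha> = vector [vector [1, 0, 0, 0],
                     vector [0, 1, 0, 0],
                     vector [\<alpha>, 0, 1, 0],
                     vector [\<alpha>\<^sup>2, 0, 2 * \<alpha>, 1]]"

definition mat_M :: "'a::field \<Rightarrow> 'a ^ 4 ^ 4" where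
  "mat_M \<rho> = vector [vector [inverse \<rho>, 0, 0, 0],
                     vector [0, 1, 0, 0],
                     vector [0, 0, 1, 0],
                     vector [0, 0, 0, \<rho>]]"

definition mat_L :: "'a::field \<Rightarrow> 'a ^ 4 ^ 4" where
  "mat_L l = vector [vector [1, 0, 0, 0],
                     vector [0, l, 0, 0],
                     vector [0, 0, 1, 0],
                     vector [0, 0, 0, 1]]"

definition mat_N :: "'a::field \<Rightarrow> 'a ^ 4 ^ 4" where
  "mat_N \<sigma> = vector [vector [0, 0, 0, 1],
                     vector [0, \<sigma>, 0, 0],
                     vector [0, 0, 1, 0],
                     vector [1, 0, 0, 0]]"

definition mat_R :: "'a::field \<Rightarrow> 'a ^ 4 ^ 4" where
  "mat_R \<mu> = vector [vector [0, 0, 0, inverse \<mu>],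
                     vector [0, 1, 0, 0],
                     vector [0, 0, 1, 0],
                     vector [\<mu>, 0, 0, 0]]"

text \<open>The subfield of $q$ elements of the field \<open>'a\<close> of $q^2$ elements.\<close>

definition Fq :: "nat \<Rightarrow> 'a::field set" where
  "Fq q = {a. a ^ q = a}"

definition L_collineations :: "nat \<Rightarrow> (('a::field ^ 4) set \<Rightarrow> ('a ^ 4) set) set" where
  "L_collineations q = {collineation (mat_L l) | l. l ^ ((q + 1) div 2) = 1}"

definition frak_G :: "nat \<Rightarrow> (('a::field ^ 4) set \<Rightarrow> ('a ^ 4) set) monoid" where
  "frak_G q = subgroup_generated (BijGroup pg_points)
     ({collineation (mat_T \<alpha>) | \<alpha>. \<alpha> \<in> Fq q}
      \<union> {collineation (mat_M \<rho>) | \<rho>. \<rho> \<noteq> 0 \<and> (\<exists>b\<in>Fq q. \<rho> = b\<^sup>2)}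
      \<union> L_collineations q
      \<union> {collineation (mat_N \<sigma>) | \<sigma>. \<sigma> ^ ((q + 1) div 2) = -1}
      \<union> {collineation (mat_R \<mu>) | \<mu>. \<mu> \<in> Fq q \<and> \<not> (\<exists>b\<in>Fq q. \<mu> = b\<^sup>2)})"

definition frak_H :: "nat \<Rightarrow> nat \<Rightarrow> (('a::field ^ 4) set \<Rightarrow> ('a ^ 4) set) monoid" where
  "frak_H p q = subgroup_generated (frak_G q)
     ({g \<in> carrier (frak_G q). \<exists>k. group.ord (frak_G q) g = p ^ k} \<union> L_collineations q)"

definition generators_meeting :: "nat \<Rightarrow> ('k::field ^ 4) set set \<Rightarrow> ('k ^ 4) set set set" where
  "generators_meeting q orb = {l \<in> generators q. l \<inter> orb \<noteq> {}}"

end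

theory Submission
  imports Defs
begin

text \<open>
  In homogeneous parameters the rational points of the curve are $(z^2, x, zy, y^2)$ with
  $x^{(q+1)/2} = z y^q - z^q y$, and $\mathfrak G$ consists of the collineations induced by pairs
  $(s, A)$, $A \in \mathrm{GL}(2,q)$ and $s^{(q+1)/2} = \det A$, where $A$ acts on $(z,y)$ and $s$ scales
  $x$. The quadratic character of $\det A$ is well defined on $\mathfrak G$, because it is the sign by which an
  invariant of the generators through points of the conic $x = 0$ is multiplied. It is trivial on
  elements of odd order and on the $\mathbf L_\lambda$, and conversely transvections and the
  $\mathbf L_\lambda$ generate all pairs with $\det A$ a square; so $\mathfrak H$ is its kernel.

  There are two point orbits, $x = 0$ and $x \neq 0$, on each of which pairs with square determinant
  are transitive. Each generator contains at most one rational point, and the generators meeting an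
  orbit carry an invariant with two opposite values that is multiplied by the character. As
  $\mathfrak G$ is transitive on them, the orbits of $\mathfrak H$ are the two level sets.
\<close>

text \<open>The equation x^m = z y^q - z^q y explains the pairs \<open>(s, A)\<close>: a matrix over
  GF(q) multiplies the right side by its determinant, and \<open>s ^ m\<close> must compensate.
  Since 2m = q + 1, the m-th power is a square root of the norm. Parameters of prescribed norm, such
  as \<open>w\<close> and \<open>k\<close> below, therefore have m-th powers that are fixed up to
  sign, and this sign is what H preserves and G does not. The congruence q \<equiv> 1 (mod 4) makes
  h even and m odd. So -1 is a square in GF(q), and exchanging \<open>z\<close> and
  \<open>y\<close>, of determinant -1, stays on the side of H; its realisation by transvections uses
  a square root of -1. The delicate point is that \<open>(s, A)\<close> and
  \<open>(r^2 s, r A)\<close> induce the same collineation, so the determinant is not a function of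
  the collineation. The kernel is never computed; the action on the invariant of one generator
  settles the matter. A second obstacle is the point (0,0,0,1) of the model: it is reached only
  through the Zariski closure, so every form vanishing on the affine part has to be controlled
  there.\<close>

no_notation fps_nth (infixl "$" 75)

subsection \<open>Finite fields of square order\<close>

lemma finite_field_power_card:
  fixes x :: "'a::{field,finite}"
  shows "x ^ CARD('a) = x"
proof (cases "x = 0")
  case False
  let ?U = "UNIV - {0 :: 'a}"
  have "bij_betw (\<lambda>y. x * y) ?U ?U"
    by (rule bij_betw_byWitness[where f' = "\<lambda>y. y / x"]) (use False in auto)
  then have "(\<Prod>y\<in>?U. x * y) = \<Prod>?U"
    by (rule prod.reindex_bij_betw)
  then have "x ^ card ?U * \<Prod>?U = \<Prod>?U"
    by (simp add: prod.distrib)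
  then have "x ^ card ?U = 1"
    by simp
  moreover have "CARD('a) = Suc (card ?U)"
    by (metis card.remove finite UNIV_I)
  ultimately show ?thesis
    by (simp only: power_Suc mult_1_right)
qed (simp add: finite_UNIV_card_ge_0)

text \<open>The multiplicative group of a finite field is cyclic; the library result for
  \<open>mult_of\<close> is carried over to the type class along
  \<open>ring_of_type_algebra\<close>.\<close>

lemma finite_field_primitive_element:
  "\<exists>g::'a::{field,finite}. \<forall>x. x \<noteq> 0 \<longrightarrow> (\<exists>i::nat. x = g ^ i)"
proof -
  define K where "K = (ring_of_type_algebra :: 'a ring)"
  interpret K: Ring.field K
    unfolding K_def by (rule field_from_type_algebra)
  have car: "carrier K = UNIV" and zero: "\<zero>\<^bsub>K\<^esub> = 0" and one: "\<one>\<^bsub>K\<^esub> = 1"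
    and mult: "\<And>x y. x \<otimes>\<^bsub>K\<^esub> y = x * y"
    by (simp_all add: K_def ring_of_type_algebra_def)
  have pow: "x [^]\<^bsub>K\<^esub> (i::nat) = x ^ i" for x i
    by (induction i) (simp_all add: one mult mult.commute)
  obtain g where "carrier (mult_of K) = {g [^]\<^bsub>K\<^esub> i | i::nat. i \<in> UNIV}"
    using K.finite_field_mult_group_has_gen car by auto
  then have "UNIV - {0} = {g ^ i | i. True}"
    by (simp add: pow car zero carrier_mult_of)
  then show ?thesis
    by blast
qed

text \<open>Translation by 1 permutes the field, so comparing the two sums of all elements gives
  CARD('a) = 0 in the field, and \<open>p ^ k\<close> can vanish there only if \<open>p\<close>
  does.\<close>

lemma of_nat_prime_eq_0:
  assumes "Factorial_Ring.prime p" and "CARD('a::{field,finite}) = p ^ k"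
  shows "of_nat p = (0::'a)"
proof -
  let ?f = "\<lambda>x::'a. x + 1"
  have "bij ?f"
    by (rule bij_betw_byWitness[where f' = "\<lambda>y. y - 1"]) auto
  then have "(\<Sum>x\<in>UNIV. x + 1) = \<Sum>(UNIV::'a set)"
    by (rule sum.reindex_bij_betw)
  then have "of_nat (CARD('a)) = (0::'a)"
    by (simp add: sum.distrib)
  then show ?thesis
    using assms(2) by simp
qed

text \<open>
  Here \<open>m\<close> is $(q+1)/2$, \<open>h\<close> is $(q-1)/2$, and \<open>g\<close> is a primitive element of the field of
  $q^2$ elements. On $\mathrm{GF}(q)^*$ the map $a \mapsto a^h$ is the quadratic character.
\<close>

locale hermitian_field =
  fixes p n q m h :: nat and g :: "'a::{field,finite}"
  assumes prime_p: "Factorial_Ring.prime p" and odd_p: "odd p" and q_eq: "q = p ^ n"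
    and n_pos: "n \<ge> 1"
    and q_h: "q = 2 * h + 1" and m_h: "m = h + 1" and even_h: "even h"
    and card_field: "CARD('a) = q\<^sup>2"
    and primitive: "\<And>x. x \<noteq> 0 \<Longrightarrow> \<exists>i. x = g ^ i"
begin

text \<open>The involutory automorphism over GF(q). As a constant of its own it is handled by the
  simplifier as a field homomorphism and not as a power.\<close>

definition cj :: "'a \<Rightarrow> 'a" where
  "cj x = x ^ q"

lemma of_nat_p: "of_nat p = (0::'a)"
  using of_nat_prime_eq_0[of p "n * 2"] prime_p card_field by (simp add: q_eq power_mult)

lemma CHAR_eq: "CHAR('a) = p"
proof -
  have "CHAR('a) dvd p"
    using of_nat_p by (simp add: of_nat_eq_0_iff_char_dvd)
  moreover have "CHAR('a) \<noteq> 1"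
    by (metis of_nat_1 of_nat_CHAR one_neq_zero)
  ultimately show ?thesis
    using prime_p by (metis prime_nat_iff)
qed

lemma q_pos: "0 < q"
  by (simp add: q_h)

lemma h_pos: "0 < h"
  using prime_p odd_p n_pos q_eq q_h
  by (metis One_nat_def add_0 gr0I less_not_refl mult_is_0 not_less_eq_eq one_less_power prime_gt_1_nat less_eq_Suc_le)

lemma q_m: "q + 1 = 2 * m"
  by (simp add: q_h m_h)

lemma odd_m: "odd m"
  using even_h by (simp add: m_h)

lemma odd_q: "odd q"
  by (simp add: q_h)

lemma q_gt_1: "q > 1"
  using h_pos by (simp add: q_h)

lemma two_neq_0: "(2::'a) \<noteq> 0"
proof
  assume "(2::'a) = 0"
  then have "of_nat 2 = (0::'a)" by simp
  then have "p dvd 2"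
    by (metis CHAR_eq of_nat_eq_0_iff_char_dvd)
  then show False
    using prime_p odd_p primes_dvd_imp_eq two_is_prime_nat by blast
qed

lemma neg_one_neq_one: "(-1::'a) \<noteq> 1"
proof
  assume "(-1::'a) = 1"
  then have "(2::'a) = 0" by (metis add.right_inverse one_add_one)
  then show False using two_neq_0 by simp
qed

section \<open>Conjugation, norm and quadratic character\<close>

lemma cj_add [simp]: "cj (x + y) = cj x + cj y"
  unfolding cj_def by (rule freshmans_dream'[where n = n]) (simp_all add: CHAR_eq prime_p q_eq)

lemma cj_0 [simp]: "cj 0 = 0"
  using q_pos by (simp add: cj_def)

lemma cj_1 [simp]: "cj 1 = 1"
  by (simp add: cj_def)

lemma cj_mult [simp]: "cj (x * y) = cj x * cj y"
  by (simp add: cj_def power_mult_distrib)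

lemma cj_minus [simp]: "cj (- x) = - cj x"
  using odd_q by (simp add: cj_def)

lemma cj_diff [simp]: "cj (x - y) = cj x - cj y"
  using cj_add[of x "-y"] by simp

lemma cj_divide [simp]: "cj (x / y) = cj x / cj y"
  by (simp add: cj_def power_divide)

lemma cj_power [simp]: "cj (x ^ k) = cj x ^ k"
  unfolding cj_def power_mult[symmetric] by (simp only: mult.commute)

lemma cj_2 [simp]: "cj 2 = 2"
  using cj_add[of 1 1] by simp

lemma cj_cj [simp]: "cj (cj x) = x"
  using finite_field_power_card[of x] card_field
  by (simp add: cj_def power2_eq_square flip: power_mult)

lemma cj_eq_iff [simp]: "cj x = cj y \<longleftrightarrow> x = y"
  by (metis cj_cj)

lemma cj_eq_0_iff [simp]: "cj x = 0 \<longleftrightarrow> x = 0"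
  using cj_eq_iff[of x 0] by simp

lemma Fq_iff: "a \<in> Fq q \<longleftrightarrow> cj a = a"
  by (simp add: Fq_def cj_def)

lemma norm_eq: "x ^ (q + 1) = x * cj x"
  by (simp add: cj_def)

text \<open>Since 2m = q + 1, the \<open>m\<close>-th power is a square root of the norm; all the
  signs below arise from this.\<close>

lemma norm_pow_m: "(x ^ m)\<^sup>2 = x * cj x"
  unfolding norm_eq[symmetric] q_m by (simp only: power_even_eq)

lemma pow_m_eq: "a ^ m = a * a ^ h"
  by (simp add: m_h)

text \<open>From q = 2h + 1. It reads off \<open>(x ^ h)\<^sup>2\<close> from
  \<open>cj x / x\<close>, for elements of GF(q) as well as for elements negated by
  \<open>cj\<close>.\<close>

lemma cj_pow_h: "x * (x ^ h)\<^sup>2 = cj x"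
proof -
  have "x ^ q = x * (x ^ h)\<^sup>2"
    by (simp add: power_even_eq q_h)
  then show ?thesis
    by (simp add: cj_def)
qed

lemma quad_char_square: "cj a = a \<Longrightarrow> a \<noteq> 0 \<Longrightarrow> (a ^ h)\<^sup>2 = 1"
  using cj_pow_h[of a] by auto

lemma quad_char: "cj a = a \<Longrightarrow> a \<noteq> 0 \<Longrightarrow> a ^ h = 1 \<or> a ^ h = -1"
  using quad_char_square power2_eq_1_iff by blast

section \<open>Powers of the primitive element: norms, squares, elements of norm 1\<close>

lemma g_neq_0: "g \<noteq> 0"
proof
  assume g0: "g = 0"
  have "(-1::'a) = 1"
    using primitive[of "-1"] g0 by (metis neg_equal_0_iff_equal power_0_left zero_neq_one)
  then show False using neg_one_neq_one by simp
qed

text \<open>Here \<open>4 * h * m\<close> is q^2 - 1, because q - 1 = 2h and q + 1 = 2m. If a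
  smaller positive power of \<open>g\<close> were 1, the powers of \<open>g\<close> would be too few
  to cover the non-zero elements.\<close>

lemma ord_g: "g ^ i = 1 \<longleftrightarrow> 4 * h * m dvd i"
proof -
  have card: "card (UNIV - {0::'a}) = 4 * h * m"
    using card_field by (simp add: card_Diff_singleton q_h m_h power2_eq_square algebra_simps)
  have N: "4 * h * m > 0" using h_pos by (simp add: m_h)
  have g1: "g ^ (4 * h * m) = 1"
  proof -
    have "g ^ (4 * h * m + 1) = g"
      using finite_field_power_card[of g] card_field
      by (simp add: q_h m_h power2_eq_square algebra_simps)
    then show ?thesis using g_neq_0 by simp
  qed
  have "\<not> g ^ j = 1" if "0 < j" "j < 4 * h * m" for j
  proof
    assume j: "g ^ j = 1"
    have "UNIV - {0} \<subseteq> (\<lambda>i. g ^ i) ` {..<j}"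
    proof
      fix x assume "x \<in> UNIV - {0::'a}"
      then obtain i where "x = g ^ i" using primitive by auto
      also have "\<dots> = g ^ (j * (i div j) + i mod j)" by (simp only: mult_div_mod_eq)
      also have "\<dots> = g ^ (i mod j)" by (simp only: power_add power_mult j power_one mult_1_left)
      finally show "x \<in> (\<lambda>i. g ^ i) ` {..<j}" using that by auto
    qed
    then have "card (UNIV - {0::'a}) \<le> card ((\<lambda>i. g ^ i) ` {..<j})"
      by (intro card_mono) auto
    also have "\<dots> \<le> j" using card_image_le[of "{..<j}"] by simp
    finally show False using card that by simp
  qed
  moreover have "g ^ i = g ^ (i mod (4 * h * m))"
  proof -
    have "g ^ i = g ^ (4 * h * m * (i div (4 * h * m)) + i mod (4 * h * m))"
      by (simp only: mult_div_mod_eq)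
    also have "\<dots> = (g ^ (4 * h * m)) ^ (i div (4 * h * m)) * g ^ (i mod (4 * h * m))"
      by (simp only: power_add power_mult[of g "4 * h * m"])
    finally show ?thesis by (simp only: g1 power_one mult_1_left)
  qed
  ultimately show ?thesis
    using N by (metis dvd_eq_mod_eq_0 gr0I mod_less_divisor power_0)
qed

lemma g_half: "g ^ (2 * h * m) = -1"
proof -
  have "(g ^ (2 * h * m))\<^sup>2 = 1"
    by (simp add: ord_g flip: power_mult)
  moreover have "g ^ (2 * h * m) \<noteq> 1"
    using ord_g[of "2 * h * m"] h_pos m_h by (auto dest: dvd_imp_le)
  ultimately show ?thesis
    using power2_eq_1_iff by blast
qed

text \<open>For a power of \<open>g\<close>, the equation a^(q-1) = 1 makes the exponent a multiple
  of q + 1, and (q+1)-st powers are norms.\<close>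

lemma norm_surj:
  assumes "cj a = a" "a \<noteq> 0"
  shows "\<exists>w. w * cj w = a"
proof -
  obtain i where i: "a = g ^ i" using primitive assms by blast
  have "a ^ (2 * h) = 1"
    using quad_char_square assms by (simp add: power_even_eq)
  then have "4 * h * m dvd i * (2 * h)"
    using i ord_g[of "i * (2 * h)"] by (simp add: power_mult)
  then have "2 * m * (2 * h) dvd i * (2 * h)"
    by (simp add: mult.assoc mult.left_commute)
  then have "2 * m dvd i" using h_pos by simp
  then obtain j where "i = j * (2 * m)" by (metis dvd_def mult.commute)
  then have "a = (g ^ j) ^ (q + 1)" unfolding i q_m by (simp add: power_mult)
  then show ?thesis using norm_eq by metis
qed

text \<open>The hypothesis \<open>a ^ h = 1\<close> makes the exponent of \<open>g\<close> a
  multiple of 4m = 2(q + 1), so \<open>a\<close> is the square of a norm, and norms lie in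
  GF(q).\<close>

lemma quad_char_imp_square:
  assumes "cj a = a" "a \<noteq> 0" "a ^ h = 1"
  shows "\<exists>b. cj b = b \<and> a = b\<^sup>2"
proof -
  obtain i where i: "a = g ^ i" using primitive assms by blast
  then have "4 * h * m dvd i * h"
    using assms(3) ord_g[of "i * h"] by (simp add: power_mult)
  then have "4 * m * h dvd i * h"
    by (simp add: mult.assoc mult.left_commute mult.commute)
  then have "4 * m dvd i" using h_pos by simp
  then obtain j where "i = 4 * m * j" by (auto simp: dvd_def)
  then have j: "i = j * (2 * m) * 2" by simp
  let ?b = "(g ^ j) ^ (q + 1)"
  have "a = ?b\<^sup>2" unfolding i j q_m by (simp only: power_mult)
  moreover have "cj ?b = ?b" unfolding norm_eq by simp
  ultimately show ?thesis by blast
qed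

lemma square_imp_quad_char: "cj b = b \<Longrightarrow> b \<noteq> 0 \<Longrightarrow> (b\<^sup>2) ^ h = 1"
  using quad_char_square[of b] power_even_eq[of b h] power_mult[of b 2 h] by argo

text \<open>The congruence q \<equiv> 1 (mod 4) is felt here and in the next statement: h is even
  and m is odd.\<close>

lemma quad_char_neg_one: "(-1::'a) ^ h = 1"
  using even_h by simp

lemma neg_one_pow_m: "(-1::'a) ^ m = -1"
  using odd_m by simp

text \<open>The norm of \<open>g\<close> works, its \<open>h\<close>-th power being g^(2hm) = -1.
  Rescaling \<open>(z, y)\<close> by such a \<open>c\<close> changes the quadratic character of a
  determinant without moving the point.\<close>

lemma norm_nonsquare: "\<exists>c. c \<noteq> 0 \<and> (c * cj c) ^ h = -1"
proof -
  have "(g * cj g) ^ h = g ^ (2 * m * h)"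
    unfolding power_mult[of g "2 * m"] by (simp only: q_m[symmetric] norm_eq)
  then have "(g * cj g) ^ h = -1"
    using g_half by (simp add: ac_simps)
  then show ?thesis using g_neq_0 by blast
qed

lemma nonsquare_exists: "\<exists>a. cj a = a \<and> a \<noteq> 0 \<and> a ^ h = -1"
proof -
  obtain c where "c \<noteq> 0" "(c * cj c) ^ h = -1" using norm_nonsquare by blast
  then have "cj (c * cj c) = c * cj c \<and> c * cj c \<noteq> 0 \<and> (c * cj c) ^ h = -1" by simp
  then show ?thesis by blast
qed

text \<open>Norm 1 means u^(q+1) = 1, so the exponent of \<open>g\<close> is a multiple of q - 1 =
  2h and \<open>u\<close> is a (q-1)-st power.\<close>

lemma hilbert90:
  assumes "u * cj u = 1"
  shows "\<exists>c. c \<noteq> 0 \<and> cj c = u * c"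
proof -
  have "u \<noteq> 0" using assms by auto
  then obtain i where i: "u = g ^ i" using primitive by blast
  have "u ^ (2 * m) = 1" using assms unfolding q_m[symmetric] norm_eq .
  then have "4 * h * m dvd i * (2 * m)"
    using i ord_g[of "i * (2 * m)"] by (simp add: power_mult)
  then have "2 * h * (2 * m) dvd i * (2 * m)"
    by (simp add: mult.assoc mult.left_commute)
  then have "2 * h dvd i" using odd_m odd_pos by auto
  then obtain j where "i = j * (2 * h)" by (metis dvd_def mult.commute)
  then have "u = ((g ^ j) ^ h)\<^sup>2"
    unfolding i by (simp only: power_mult[of g j] power_even_eq)
  then have "cj (g ^ j) = u * g ^ j"
    using cj_pow_h[of "g ^ j"] by (simp add: mult.commute)
  then show ?thesis using g_neq_0 power_not_zero by blast
qed

text \<open>The element \<open>g ^ m\<close> works, its (q-1)-st power being g^(2hm) = -1. It serves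
  to polarise the Hermitian form.\<close>

lemma imag_exists: "\<exists>e. e \<noteq> 0 \<and> cj e = - e"
proof -
  have "((g ^ m) ^ h)\<^sup>2 = g ^ (m * (2 * h))"
    by (simp only: power_mult[of g m] power_even_eq)
  also have "\<dots> = -1"
    using g_half by (simp add: ac_simps)
  finally have "cj (g ^ m) = - (g ^ m)"
    using cj_pow_h[of "g ^ m"] by simp
  then show ?thesis using g_neq_0 power_not_zero by blast
qed

end

subsection \<open>Points, lines and collineations\<close>

lemma vector_4 [simp]:
  "(vector [a, b, c, d] :: 'a ^ 4) $ 1 = a"
  "(vector [a, b, c, d] :: 'a ^ 4) $ 2 = b"
  "(vector [a, b, c, d] :: 'a ^ 4) $ 3 = c"
  "(vector [a, b, c, d] :: 'a ^ 4) $ 4 = d"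
  for a :: "'a::zero"
  by (simp_all add: vector_def)

lemma vec4_eq_iff: "(u :: 'a ^ 4) = v \<longleftrightarrow> u $ 1 = v $ 1 \<and> u $ 2 = v $ 2 \<and> u $ 3 = v $ 3 \<and> u $ 4 = v $ 4"
  by (simp add: vec_eq_iff forall_4)

lemma matrix_vector_mult_4:
  "(A *v v) $ i = A $ i $ 1 * v $ 1 + A $ i $ 2 * v $ 2 + A $ i $ 3 * v $ 3 + A $ i $ (4::4) * v $ 4"
  for A :: "'a::field ^ 4 ^ 4"
  by (simp add: matrix_vector_mult_def sum_4)

lemma in_span_pair: "(w :: 'k::field ^ 4) \<in> vec.span {u, v} \<longleftrightarrow> (\<exists>\<alpha> \<beta>. w = \<alpha> *s u + \<beta> *s v)"
  by (auto simp: vec.span_breakdown_eq[of w u] vec.span_singleton algebra_simps image_iff)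

lemma pg_points_iff: "P \<in> pg_points \<longleftrightarrow> (\<exists>v. v \<noteq> 0 \<and> P = vec.span {v})"
proof
  assume "P \<in> pg_points"
  then have P: "vec.subspace P" "vec.dim P = 1"
    by (auto simp: pg_points_def)
  obtain B where B: "B \<subseteq> P" "vec.independent B" "P \<subseteq> vec.span B" "card B = vec.dim P"
    using vec.basis_exists[of P] by auto
  then obtain v where v: "B = {v}"
    using P by (auto simp: card_1_singleton_iff)
  then show "\<exists>v. v \<noteq> 0 \<and> P = vec.span {v}"
    using B P by (metis vec.dependent_zero insertI1 subset_antisym vec.span_minimal)
qed (auto simp: pg_points_def)

lemma span_in_pg_points [simp]: "v \<noteq> 0 \<Longrightarrow> vec.span {v} \<in> pg_points"
  by (auto simp: pg_points_iff)

lemma span_singleton_eq_iff: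
  fixes u v :: "'k::field ^ 4"
  assumes "u \<noteq> 0"
  shows "vec.span {u} = vec.span {v} \<longleftrightarrow> (\<exists>c. c \<noteq> 0 \<and> u = c *s v)"
proof
  assume "vec.span {u} = vec.span {v}"
  then have "u \<in> vec.span {v}"
    by (metis vec.span_base insertI1)
  then show "\<exists>c. c \<noteq> 0 \<and> u = c *s v"
    using assms by (auto simp: vec.span_singleton)
next
  assume "\<exists>c. c \<noteq> 0 \<and> u = c *s v"
  then obtain c where c: "c \<noteq> 0" "u = c *s v" by blast
  show "vec.span {u} = vec.span {v}"
    unfolding vec.span_singleton c(2)
  proof (intro equalityI subsetI)
    fix x assume "x \<in> range (\<lambda>k. k *s (c *s v))"
    then show "x \<in> range (\<lambda>k. k *s v)" by auto
  next
    fix x assume "x \<in> range (\<lambda>k. k *s v)"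
    then obtain k where "x = k *s v" by auto
    then have "x = (k / c) *s (c *s v)" using c by simp
    then show "x \<in> range (\<lambda>k. k *s (c *s v))" by blast
  qed
qed

definition line_through :: "'k::field ^ 4 \<Rightarrow> 'k ^ 4 \<Rightarrow> ('k ^ 4) set set" where
  "line_through u v = {P \<in> pg_points. P \<subseteq> vec.span {u, v}}"

lemma span_in_line_through:
  "w \<noteq> 0 \<Longrightarrow> vec.span {w} \<in> line_through u v \<longleftrightarrow> (\<exists>\<alpha> \<beta>. w = \<alpha> *s u + \<beta> *s v)"
  unfolding line_through_def in_span_pair[symmetric]
  by (auto simp: vec.span_base intro: vec.span_minimal[THEN subsetD])

text \<open>The scalars are an invertible change of basis, inverted by Cramer's rule. Equalities of
  generators are mostly proved by naming these scalars.\<close>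

lemma line_through_eqI:
  assumes "u' = \<alpha> *s u + \<beta> *s v" "v' = \<gamma> *s u + \<delta> *s v" "\<alpha> * \<delta> - \<beta> * \<gamma> \<noteq> 0"
  shows "line_through u' v' = line_through u v"
proof -
  let ?D = "\<alpha> * \<delta> - \<beta> * \<gamma>"
  have "u = (\<delta> / ?D) *s u' + (- \<beta> / ?D) *s v'" "v = (- \<gamma> / ?D) *s u' + (\<alpha> / ?D) *s v'"
    using assms(3) unfolding assms(1,2) vec_eq_iff
    by (auto simp: divide_simps) (simp_all add: algebra_simps)
  then have "u \<in> vec.span {u', v'}" "v \<in> vec.span {u', v'}"
    unfolding in_span_pair by blast+
  moreover have "u' \<in> vec.span {u, v}" "v' \<in> vec.span {u, v}"
    using assms(1,2) unfolding in_span_pair by blast+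
  ultimately have "vec.span {u, v} = vec.span {u', v'}"
    by (intro subset_antisym vec.span_minimal) auto
  then show ?thesis
    by (simp add: line_through_def)
qed

lemma line_through_in_pg_lines:
  assumes "u \<noteq> 0" "\<And>c. v \<noteq> c *s u"
  shows "line_through u v \<in> pg_lines"
proof -
  have "v \<notin> vec.span {u}"
    using assms by (auto simp: vec.span_singleton)
  then have "vec.dim {u, v} = 2"
    using assms vec.dim_insert[of v "{u}"] by (simp add: insert_commute)
  then show ?thesis
    unfolding pg_lines_def line_through_def
    by (auto intro!: exI[of _ "vec.span {u, v}"])
qed

lemma pg_line_through_point:
  assumes "l \<in> pg_lines" "vec.span {u} \<in> l" "u \<noteq> 0"
  obtains v where "\<And>c. v \<noteq> c *s u" "l = line_through u v"
proof -
  obtain W where W: "vec.subspace W" "vec.dim W = 2" and l: "l = {P \<in> pg_points. P \<subseteq> W}"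
    using assms by (auto simp: pg_lines_def)
  have u: "u \<in> W"
    using assms l vec.span_base[of u "{u}"] by auto
  have "\<not> W \<subseteq> vec.span {u}"
  proof
    assume "W \<subseteq> vec.span {u}"
    then have "vec.dim W \<le> vec.dim (vec.span {u})" by (rule vec.dim_subset)
    then show False using W assms by simp
  qed
  then obtain v where v: "v \<in> W" "v \<notin> vec.span {u}" by auto
  have "vec.dim {u, v} = 2"
    using v assms vec.dim_insert[of v "{u}"] by (simp add: insert_commute)
  moreover have "vec.span {u, v} \<subseteq> W"
    using u v W by (intro vec.span_minimal) auto
  ultimately have "vec.span {u, v} = W"
    using W by (intro vec.subspace_dim_equal) auto
  then show ?thesis
    using that[of v] v l by (auto simp: line_through_def vec.span_singleton)
qed

lemma collineation_span: "v \<noteq> 0 \<Longrightarrow> collineation A (vec.span {v}) = vec.span {A *v v}"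
proof -
  assume "v \<noteq> 0"
  then have "vec.span {v} \<in> pg_points" by simp
  moreover have "(\<lambda>w. A *v w) ` vec.span {v} = vec.span {A *v v}"
    by (simp add: vec.span_singleton image_image vector_scalar_commute)
  ultimately show ?thesis by (simp add: collineation_def)
qed

lemma invertible_mult_neq_0: "invertible A \<Longrightarrow> v \<noteq> 0 \<Longrightarrow> A *v v \<noteq> 0"
  for A :: "'k::field ^ 4 ^ 4"
  by (metis invertible_def matrix_vector_mul_assoc matrix_vector_mul_lid matrix_vector_mult_0_right)

lemma collineation_closed: "invertible A \<Longrightarrow> P \<in> pg_points \<Longrightarrow> collineation A P \<in> pg_points"
  using invertible_mult_neq_0 by (fastforce simp: pg_points_iff collineation_span)

lemma collineation_comp:
  "invertible B \<Longrightarrow> P \<in> pg_points \<Longrightarrow> collineation A (collineation B P) = collineation (A ** B) P"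
  by (auto simp: pg_points_iff collineation_span invertible_mult_neq_0 matrix_vector_mul_assoc)

lemma collineation_mat_1: "collineation (mat 1) = (\<lambda>P\<in>pg_points. P)"
  unfolding collineation_def by (intro restrict_ext) simp

lemma collineation_Bij: "invertible A \<Longrightarrow> collineation A \<in> Bij pg_points"
proof -
  assume "invertible A"
  then obtain B where B: "A ** B = mat 1" "B ** A = mat 1"
    by (auto simp: invertible_def)
  then have "invertible B" by (auto simp: invertible_def)
  with \<open>invertible A\<close> B have "bij_betw (collineation A) pg_points pg_points"
    by (intro bij_betw_byWitness[where f' = "collineation B"])
      (auto simp: collineation_comp collineation_closed collineation_mat_1)
  then show ?thesis
    by (simp add: Bij_def collineation_def)
qed

lemma collineation_mult:
  assumes "invertible A" "invertible B"
  shows "collineation A \<otimes>\<^bsub>BijGroup pg_points\<^esub> collineation B = collineation (A ** B)"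
proof -
  have "compose pg_points (collineation A) (collineation B) = collineation (A ** B)"
    using assms by (intro extensionalityI[of _ pg_points])
      (simp_all add: compose_eq collineation_comp, simp add: collineation_def)
  then show ?thesis
    using assms by (simp add: BijGroup_def collineation_Bij)
qed

lemma collineation_scale:
  fixes A B :: "'k::field ^ 4 ^ 4"
  assumes "c \<noteq> 0" "\<And>v. B *v v = c *s (A *v v)" "invertible B"
  shows "collineation B = collineation A"
proof (rule extensionalityI[of _ pg_points])
  fix P :: "('k ^ 4) set" assume "P \<in> pg_points"
  then obtain v where v: "v \<noteq> 0" "P = vec.span {v}" by (auto simp: pg_points_iff)
  have "B *v v \<noteq> 0" using assms(3) v by (simp add: invertible_mult_neq_0)
  then show "collineation B P = collineation A P"
    using assms v by (auto simp: collineation_span span_singleton_eq_iff)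
qed (auto simp: collineation_def)

lemma collineation_line_through:
  assumes "invertible A"
  shows "collineation A ` line_through u v = line_through (A *v u) (A *v v)"
proof -
  \<comment> \<open>Stated for every invertible matrix, so that it also applies to the inverse and
    gives the opposite inclusion.\<close>
  have *: "collineation A ` line_through u v \<subseteq> line_through (A *v u) (A *v v)"
    if "invertible A" for A :: "'a ^ 4 ^ 4" and u v
  proof
    fix Q assume "Q \<in> collineation A ` line_through u v"
    then obtain P where P: "P \<in> line_through u v" "Q = collineation A P" by auto
    then obtain w where w: "w \<noteq> 0" "P = vec.span {w}"
      by (auto simp: line_through_def pg_points_iff)
    then obtain \<alpha> \<beta> where "w = \<alpha> *s u + \<beta> *s v"
      using P span_in_line_through by blast
    then have "A *v w = \<alpha> *s (A *v u) + \<beta> *s (A *v v)"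
      by (simp add: matrix_vector_right_distrib vector_scalar_commute)
    then have "vec.span {A *v w} \<in> line_through (A *v u) (A *v v)"
      using span_in_line_through invertible_mult_neq_0[OF that w(1)] by blast
    then show "Q \<in> line_through (A *v u) (A *v v)"
      using P w by (simp add: collineation_span)
  qed
  obtain B where B: "A ** B = mat 1" "B ** A = mat 1"
    using assms by (auto simp: invertible_def)
  then have B': "invertible B" by (auto simp: invertible_def)
  have "P \<in> collineation A ` line_through u v" if P: "P \<in> line_through (A *v u) (A *v v)" for P
  proof -
    have "collineation B P \<in> line_through u v"
      using *[OF B', of "A *v u" "A *v v"] P B by (auto simp: matrix_vector_mul_assoc)
    moreover have "collineation A (collineation B P) = P"
      using B B' P by (simp add: line_through_def collineation_comp collineation_mat_1)
    ultimately show ?thesis by (metis imageI)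
  qed
  then show ?thesis
    using *[OF assms] by blast
qed

text \<open>
  The block matrix acting on the coordinates $X_0, X_2, X_3$ as the symmetric square of the
  $2 \times 2$ matrix with rows $(a,b)$ and $(c,d)$, and as the scalar \<open>s\<close> on $X_1$.
\<close>

definition mat_block :: "'k::field \<Rightarrow> 'k \<Rightarrow> 'k \<Rightarrow> 'k \<Rightarrow> 'k \<Rightarrow> 'k ^ 4 ^ 4" where
  "mat_block s a b c d = vector [vector [a\<^sup>2, 0, 2 * a * b, b\<^sup>2],
                             vector [0, s, 0, 0],
                             vector [a * c, 0, a * d + b * c, b * d],
                             vector [c\<^sup>2, 0, 2 * c * d, d\<^sup>2]]"

lemma mat_block_mult:
  "mat_block s a b c d ** mat_block s' a' b' c' d' =
   mat_block (s * s') (a * a' + b * c') (a * b' + b * d') (c * a' + d * c') (c * b' + d * d')"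
  unfolding mat_block_def matrix_matrix_mult_def
  by (simp add: vec4_eq_iff sum_4) (simp add: algebra_simps power2_eq_square)

lemma mat_block_1: "mat_block 1 1 0 0 1 = mat 1"
  by (simp add: mat_block_def mat_def vec4_eq_iff)

lemma mat_block_inverse:
  assumes "s \<noteq> 0" "a * d - b * c \<noteq> 0"
  defines "D \<equiv> a * d - b * c"
  shows "mat_block s a b c d ** mat_block (1 / s) (d / D) (- b / D) (- c / D) (a / D) = mat 1"
    and "mat_block (1 / s) (d / D) (- b / D) (- c / D) (a / D) ** mat_block s a b c d = mat 1"
proof -
  have D: "D \<noteq> 0" "a * d = D + b * c" using assms by (simp_all add: D_def)
  show "mat_block s a b c d ** mat_block (1 / s) (d / D) (- b / D) (- c / D) (a / D) = mat 1"
    "mat_block (1 / s) (d / D) (- b / D) (- c / D) (a / D) ** mat_block s a b c d = mat 1"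
    unfolding mat_block_mult mat_block_1[symmetric] using D assms(1)
    by (simp_all add: field_simps)
qed

lemma invertible_mat_block: "s \<noteq> 0 \<Longrightarrow> a * d - b * c \<noteq> 0 \<Longrightarrow> invertible (mat_block s a b c d)"
  unfolding invertible_def using mat_block_inverse by blast

lemma mat_block_vector:
  "mat_block s a b c d *v vector [x0, x1, x2, x3] =
   vector [a\<^sup>2 * x0 + 2 * a * b * x2 + b\<^sup>2 * x3, s * x1,
     a * c * x0 + (a * d + b * c) * x2 + b * d * x3, c\<^sup>2 * x0 + 2 * c * d * x2 + d\<^sup>2 * x3]"
  by (simp add: vec4_eq_iff matrix_vector_mult_4 mat_block_def)

subsection \<open>Rational points of the model\<close>

lemma prod_4: "prod f (UNIV :: 4 set) = f 1 * f 2 * f 3 * f 4"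
  unfolding UNIV_4 by (simp add: ac_simps)

lemma finite_exponents: "finite {e :: 4 \<Rightarrow> nat. (\<Sum>i\<in>UNIV. e i) = d}"
proof (rule finite_subset)
  show "{e :: 4 \<Rightarrow> nat. (\<Sum>i\<in>UNIV. e i) = d} \<subseteq> PiE UNIV (\<lambda>_. {..d})"
    by (auto intro!: member_le_sum)
qed (auto intro: finite_PiE)

text \<open>Forms as functions, so that a concrete equation is recognised as a form by its
  monomials, without writing down coefficients.\<close>

definition is_form :: "nat \<Rightarrow> ('k::field ^ 4 \<Rightarrow> 'k) \<Rightarrow> bool" where
  "is_form d F \<longleftrightarrow> (\<exists>c. \<forall>v. form_eval d c v = F v)"

lemma is_form_monomial:
  assumes "a0 + a1 + a2 + a3 = d"
  shows "is_form d (\<lambda>v. k * (v $ 1) ^ a0 * (v $ 2) ^ a1 * (v $ 3) ^ a2 * (v $ 4) ^ a3)"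
proof -
  define e :: "4 \<Rightarrow> nat" where "e = (\<lambda>i. (vector [a0, a1, a2, a3] :: nat ^ 4) $ i)"
  have e: "(\<Sum>i\<in>UNIV. e i) = d"
    using assms by (simp add: e_def sum_4)
  have "form_eval d (\<lambda>e'. if e' = e then k else 0) v
      = k * (v $ 1) ^ a0 * (v $ 2) ^ a1 * (v $ 3) ^ a2 * (v $ 4) ^ a3" for v :: "'a ^ 4"
  proof -
    have "form_eval d (\<lambda>e'. if e' = e then k else 0) v
        = (\<Sum>e' | (\<Sum>i\<in>UNIV. e' i) = d. if e' = e then k * (\<Prod>i\<in>UNIV. (v $ i) ^ e i) else 0)"
      unfolding form_eval_def by (intro sum.cong) auto
    also have "\<dots> = k * (\<Prod>i\<in>UNIV. (v $ i) ^ e i)"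
      using e finite_exponents by (simp add: sum.delta)
    finally show ?thesis
      by (simp add: e_def prod_4 mult.assoc)
  qed
  then show ?thesis
    unfolding is_form_def by blast
qed

lemma is_form_add: "is_form d F \<Longrightarrow> is_form d F' \<Longrightarrow> is_form d (\<lambda>v. F v + F' v)"
proof -
  assume "is_form d F" "is_form d F'"
  then obtain c c' where "\<And>v. form_eval d c v = F v" "\<And>v. form_eval d c' v = F' v"
    by (auto simp: is_form_def)
  then have "form_eval d (\<lambda>e. c e + c' e) v = F v + F' v" for v
    by (simp add: form_eval_def algebra_simps sum.distrib)
  then show ?thesis
    unfolding is_form_def by blast
qed

lemma zariski_closure_form:
  assumes "P \<in> zariski_closure S" "is_form d F" "\<And>Q v. Q \<in> S \<Longrightarrow> v \<in> Q \<Longrightarrow> F v = 0" "v \<in> P"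
  shows "F v = 0"
proof -
  obtain c where c: "\<And>v. form_eval d c v = F v"
    using assms(2) unfolding is_form_def by blast
  then have "\<forall>Q\<in>S. \<forall>v\<in>Q. form_eval d c v = 0"
    using assms(3) by simp
  then have "form_eval d c v = 0"
    using assms(1,4) unfolding zariski_closure_def by blast
  then show ?thesis
    using c by simp
qed

text \<open>The polynomial \<open>P + 1\<close> takes only the value 1, so it has no root and must
  be constant.\<close>

lemma alg_closed_poly_eq_0:
  fixes P :: "'k::alg_closed_field poly"
  assumes "\<And>y. poly P y = 0"
  shows "P = 0"
proof -
  have "Polynomial.degree (P + 1) = 0"
    using alg_closed_imp_poly_has_root[of "P + 1"] assms by fastforce
  then obtain c where "P + 1 = [:c:]"
    by (rule degree_eq_zeroE)
  then have c: "P = [:c - 1:]"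
    by (simp add: one_pCons eq_diff_eq[symmetric])
  with assms[of 0] have "c - 1 = 0" by simp
  then show ?thesis using c by simp
qed

text \<open>A geometric sum of ratio \<open>\<zeta> ^ b\<close>; this orthogonality relation is what
  averaging uses to discard exponents of x.\<close>

lemma sum_powers_of_root_of_unity:
  fixes \<zeta> :: "'k::field"
  assumes "\<zeta> ^ M = 1"
  shows "(\<Sum>j<M. (\<zeta> ^ j) ^ b) = (if \<zeta> ^ b = 1 then of_nat M else 0)"
proof -
  have "(\<Sum>j<M. (\<zeta> ^ j) ^ b) = (\<Sum>j<M. (\<zeta> ^ b) ^ j)"
    by (simp add: mult.commute flip: power_mult)
  moreover have "(\<zeta> ^ b) ^ M = 1"
    using assms power_mult[of \<zeta> b M] power_mult[of \<zeta> M b] by (simp add: mult.commute)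
  ultimately show ?thesis
    by (auto simp: geometric_sum)
qed

definition affine_points :: "nat \<Rightarrow> ('k::field ^ 4) set set" where
  "affine_points q = {vec.span {vector [1, x, y, y\<^sup>2]} | x y. y ^ q - y = x ^ ((q + 1) div 2)}"

context hermitian_field
begin

lemma div_simps [simp]: "(q + 1) div 2 = m" "Suc q div 2 = m" "(q - 1) div 2 = h" "(q - Suc 0) div 2 = h"
  using q_m by (simp_all add: q_h)

lemma m_pos: "0 < m"
  by (simp add: m_h)

text \<open>At z = 0 the equation forces y = 0, and the image vector is zero; at every other point z
  can be normalised to 1.\<close>

lemma plane_curve_image:
  "{vec.span {vector [z\<^sup>2, x * z, y * z, y\<^sup>2]} | x y z.
        (x, y, z) \<in> plane_curve q \<and> (vector [z\<^sup>2, x * z, y * z, y\<^sup>2] :: 'k::field ^ 4) \<noteq> 0}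
   = (affine_points q :: ('k ^ 4) set set)" (is "?L = ?R")
proof (intro equalityI subsetI)
  fix P assume "P \<in> ?L"
  then obtain x y z :: 'k where P: "P = vec.span {vector [z\<^sup>2, x * z, y * z, y\<^sup>2]}"
    and pc: "(x, y, z) \<in> plane_curve q" and nz: "(vector [z\<^sup>2, x * z, y * z, y\<^sup>2] :: 'k ^ 4) \<noteq> 0"
    by blast
  have eq: "y ^ q - y * z ^ (q - 1) = x ^ m * z ^ h"
    using pc by (simp add: plane_curve_def)
  have z: "z \<noteq> 0"
  proof
    assume "z = 0"
    then have "y = 0" using eq h_pos q_gt_1 by (simp add: power_0_left split: if_splits)
    then show False using nz \<open>z = 0\<close> by (simp add: vec4_eq_iff)
  qed
  have "z ^ q = z * z ^ (q - 1)"
    by (simp add: q_h)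
  moreover have "z ^ q = z ^ m * z ^ h"
    by (simp add: q_h m_h mult_2 flip: power_add)
  ultimately have "(y / z) ^ q - y / z = (x / z) ^ m"
    using eq z by (simp add: power_divide field_simps)
  moreover have "vec.span {vector [z\<^sup>2, x * z, y * z, y\<^sup>2]}
      = vec.span {vector [1, x / z, y / z, (y / z)\<^sup>2] :: 'k ^ 4}"
    using z nz by (subst span_singleton_eq_iff)
      (auto intro!: exI[of _ "z\<^sup>2"] simp: vec4_eq_iff power2_eq_square)
  ultimately show "P \<in> ?R"
    unfolding P affine_points_def by auto
next
  fix P assume "P \<in> ?R"
  then obtain x y :: 'k where P: "P = vec.span {vector [1, x, y, y\<^sup>2]}" and "y ^ q - y = x ^ m"
    by (auto simp: affine_points_def)
  then have "(x, y, 1) \<in> plane_curve q"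
    by (simp add: plane_curve_def)
  then show "P \<in> ?L"
    unfolding P mem_Collect_eq
    by (intro exI[of _ x] exI[of _ y] exI[of _ 1]) (simp add: vec4_eq_iff)
qed

text \<open>Each equation is a form vanishing on the affine points and so persists on the closure.
  The first two leave X_1 free where X_0 = 0; the Hermitian equation is included because it forces
  X_1 = 0 there.\<close>

lemma X_plus_affine:
  fixes v :: "'b::alg_closed_field ^ 4"
  assumes "P \<in> zariski_closure (affine_points q)" "v \<in> P"
  shows "(v $ 3)\<^sup>2 = v $ 1 * v $ 4"
    and "(v $ 3) ^ q - v $ 3 * (v $ 1) ^ (q - 1) = (v $ 2) ^ m * (v $ 1) ^ h"
    and "(v $ 2) ^ (q + 1) + 2 * (v $ 3) ^ (q + 1) = (v $ 4) ^ q * v $ 1 + v $ 4 * (v $ 1) ^ q"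
proof -
  define F1 where "F1 = (\<lambda>v::'b^4. 1 * (v $ 1) ^ 0 * (v $ 2) ^ 0 * (v $ 3) ^ 2 * (v $ 4) ^ 0
    + (-1) * (v $ 1) ^ 1 * (v $ 2) ^ 0 * (v $ 3) ^ 0 * (v $ 4) ^ 1)"
  define F2 where "F2 = (\<lambda>v::'b^4. 1 * (v $ 1) ^ 0 * (v $ 2) ^ 0 * (v $ 3) ^ q * (v $ 4) ^ 0
    + (-1) * (v $ 1) ^ (q - 1) * (v $ 2) ^ 0 * (v $ 3) ^ 1 * (v $ 4) ^ 0
    + (-1) * (v $ 1) ^ h * (v $ 2) ^ m * (v $ 3) ^ 0 * (v $ 4) ^ 0)"
  define F3 where "F3 = (\<lambda>v::'b^4. 1 * (v $ 1) ^ 0 * (v $ 2) ^ (q + 1) * (v $ 3) ^ 0 * (v $ 4) ^ 0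
    + 2 * (v $ 1) ^ 0 * (v $ 2) ^ 0 * (v $ 3) ^ (q + 1) * (v $ 4) ^ 0
    + (-1) * (v $ 1) ^ 1 * (v $ 2) ^ 0 * (v $ 3) ^ 0 * (v $ 4) ^ q
    + (-1) * (v $ 1) ^ q * (v $ 2) ^ 0 * (v $ 3) ^ 0 * (v $ 4) ^ 1)"
  have forms: "is_form 2 F1" "is_form q F2" "is_form (q + 1) F3"
    unfolding F1_def F2_def F3_def using q_pos
    by (intro is_form_add is_form_monomial; simp add: q_h m_h)+
  have S: "\<exists>x y k. w = k *s vector [1, x, y, y\<^sup>2] \<and> y ^ q - y = x ^ m"
    if "Q \<in> affine_points q" "w \<in> Q" for Q and w :: "'b ^ 4"
    using that by (auto simp: affine_points_def vec.span_singleton)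
  have 1: "F1 w = 0" if "Q \<in> affine_points q" "w \<in> Q" for Q w
    using S[OF that] by (auto simp: F1_def power2_eq_square)
  have 2: "F2 w = 0" if Qw: "Q \<in> affine_points q" "w \<in> Q" for Q w
  proof -
    obtain x y k where w: "w = k *s vector [1, x, y, y\<^sup>2]" and e: "y ^ q - y = x ^ m"
      using S[OF Qw] by blast
    have "k ^ q = k * k ^ (q - 1)" by (simp add: q_h)
    moreover have "k ^ q = k ^ h * k ^ m" by (simp add: q_h m_h mult_2 flip: power_add)
    ultimately have "F2 w = k ^ q * (y ^ q - y - x ^ m)"
      by (simp add: F2_def w power_mult_distrib algebra_simps)
    then show ?thesis using e by simp
  qed
  have 3: "F3 w = 0" if Qw: "Q \<in> affine_points q" "w \<in> Q" for Q w
  proof -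
    obtain x y k where w: "w = k *s vector [1, x, y, y\<^sup>2]" and e: "y ^ q - y = x ^ m"
      using S[OF Qw] by blast
    \<comment> \<open>As q + 1 = 2m, the Hermitian equation is the square of the curve
      equation.\<close>
    have x: "x ^ (q + 1) = (y ^ q - y)\<^sup>2"
      unfolding e q_m power_even_eq ..
    have "(y\<^sup>2) ^ q = (y ^ q)\<^sup>2"
      using power_even_eq[of y q] power_mult[of y 2 q] by argo
    then have "F3 w = k ^ (q + 1) * (x ^ (q + 1) - (y ^ q - y)\<^sup>2)"
      by (simp add: F3_def w power_mult_distrib power2_eq_square algebra_simps)
    then show ?thesis using x by simp
  qed
  show "(v $ 3)\<^sup>2 = v $ 1 * v $ 4"
    using zariski_closure_form[OF assms(1) forms(1) 1 assms(2)] by (simp add: F1_def)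
  show "(v $ 3) ^ q - v $ 3 * (v $ 1) ^ (q - 1) = (v $ 2) ^ m * (v $ 1) ^ h"
    using zariski_closure_form[OF assms(1) forms(2) 2 assms(2)] by (simp add: F2_def algebra_simps)
  show "(v $ 2) ^ (q + 1) + 2 * (v $ 3) ^ (q + 1) = (v $ 4) ^ q * v $ 1 + v $ 4 * (v $ 1) ^ q"
    using zariski_closure_form[OF assms(1) forms(3) 3 assms(2)] by (simp add: F3_def algebra_simps)
qed

text \<open>
  Averaging a form over the $m$-th roots of unity acting on $x$ leaves only powers of
  $x^m = y^q - y$, hence a polynomial in $y$ that vanishes identically. Its coefficient of
  $y^{2d}$ is the coefficient of $X_3^d$, since every other monomial contributes lower degree.
\<close>

lemma form_at_infinity:
  fixes c :: "(4 \<Rightarrow> nat) \<Rightarrow> 'a alg_closure"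
  assumes van: "\<And>x y. y ^ q - y = x ^ m \<Longrightarrow> form_eval d c (vector [1, x, y, y\<^sup>2]) = 0"
  shows "form_eval d c (vector [0, 0, 0, t]) = 0"
proof -
  let ?E = "{e :: 4 \<Rightarrow> nat. (\<Sum>i\<in>UNIV. e i) = d}"
  \<comment> \<open>The order of \<open>g\<close> is \<open>4 * h * m\<close>, so this is a
    primitive \<open>m\<close>-th root of unity.\<close>
  define \<zeta> :: "'a alg_closure" where "\<zeta> = to_ac (g ^ (4 * h))"
  have \<zeta>_pow: "\<zeta> ^ b = 1 \<longleftrightarrow> m dvd b" for b
  proof -
    have "\<zeta> ^ b = 1 \<longleftrightarrow> g ^ (4 * h * b) = 1"
      unfolding \<zeta>_def by (simp only: to_ac_power[symmetric] power_mult to_ac_eq_iff to_ac_1[symmetric])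
    then show ?thesis using h_pos by (simp add: ord_g)
  qed
  define A :: "'a alg_closure poly" where
    "A = Polynomial.monom 1 q - Polynomial.monom 1 1"
  define T where "T = (\<lambda>e::4 \<Rightarrow> nat. if m dvd e 2
    then Polynomial.smult (c e) (A ^ (e 2 div m) * Polynomial.monom 1 (e 3 + 2 * e 4)) else 0)"
  have polyA: "poly A y = y ^ q - y" for y
    by (simp add: A_def poly_monom)
  \<comment> \<open>The average divides by \<open>m\<close>: this is possible since p divides q and
    hence not q + 1 = 2m.\<close>
  have m_neq_0: "(of_nat m :: 'a alg_closure) \<noteq> 0"
  proof
    assume "(of_nat m :: 'a alg_closure) = 0"
    then have "to_ac (of_nat m :: 'a) = 0" by simp
    then have "(of_nat m :: 'a) = 0" by (simp only: to_ac_eq_0_iff)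
    then have "p dvd m" by (simp add: of_nat_eq_0_iff_char_dvd CHAR_eq)
    then have "p dvd q + 1" unfolding q_m by simp
    moreover have "p dvd q" using n_pos by (simp add: q_eq)
    ultimately have "p dvd 1" using dvd_add_right_iff by blast
    then show False using prime_p by (simp add: prime_nat_iff)
  qed
  have "poly (\<Sum>e\<in>?E. T e) y = 0" for y
  proof -
    obtain x where x: "x ^ m = y ^ q - y"
      using nth_root_exists[OF m_pos] by blast
    have mon: "(\<Prod>i\<in>UNIV. (vector [1, z, y, y\<^sup>2] :: 'a alg_closure ^ 4) $ i ^ e i)
        = z ^ e 2 * y ^ (e 3 + 2 * e 4)" for e z
      by (simp add: prod_4 power_add power_mult mult.assoc)
    have "(\<zeta> ^ j * x) ^ m = y ^ q - y" for j
      using x \<zeta>_pow by (simp add: power_mult_distrib flip: power_mult)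
    then have "form_eval d c (vector [1, \<zeta> ^ j * x, y, y\<^sup>2]) = 0" for j
      by (intro van) simp
    then have "0 = (\<Sum>j<m. form_eval d c (vector [1, \<zeta> ^ j * x, y, y\<^sup>2]))"
      by simp
    also have "\<dots> = (\<Sum>j<m. \<Sum>e\<in>?E. c e * (x ^ e 2 * y ^ (e 3 + 2 * e 4)) * (\<zeta> ^ j) ^ e 2)"
      unfolding form_eval_def mon power_mult_distrib by (simp only: ac_simps)
    also have "\<dots> = (\<Sum>e\<in>?E. c e * (x ^ e 2 * y ^ (e 3 + 2 * e 4)) * (\<Sum>j<m. (\<zeta> ^ j) ^ e 2))"
      by (subst sum.swap) (simp only: sum_distrib_left)
    also have "\<dots> = (\<Sum>e\<in>?E. of_nat m * poly (T e) y)"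
    proof (rule sum.cong)
      fix e :: "4 \<Rightarrow> nat"
      have "(\<Sum>j<m. (\<zeta> ^ j) ^ e 2) = (if m dvd e 2 then of_nat m else 0)"
        using sum_powers_of_root_of_unity[of \<zeta> m "e 2"] \<zeta>_pow by simp
      moreover have "x ^ e 2 = (y ^ q - y) ^ (e 2 div m)" if "m dvd e 2"
        using that by (simp only: x[symmetric] power_mult[symmetric] dvd_mult_div_cancel)
      ultimately show "c e * (x ^ e 2 * y ^ (e 3 + 2 * e 4)) * (\<Sum>j<m. (\<zeta> ^ j) ^ e 2)
          = of_nat m * poly (T e) y"
        by (auto simp: T_def polyA poly_monom ac_simps)
    qed simp
    finally show ?thesis
      using m_neq_0 by (simp add: poly_sum flip: sum_distrib_left)
  qed
  then have P0: "(\<Sum>e\<in>?E. T e) = 0"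
    by (rule alg_closed_poly_eq_0)
  define e0 :: "4 \<Rightarrow> nat" where "e0 = (\<lambda>i. (vector [0, 0, 0, d] :: nat ^ 4) $ i)"
  have e0: "e0 \<in> ?E" "e0 1 = 0" "e0 2 = 0" "e0 3 = 0" "e0 4 = d"
    by (simp_all add: e0_def sum_4)
  have e0I: "e = e0" if "e \<in> ?E" "e 1 = 0" "e 2 = 0" "e 3 = 0" for e
    using that e0 by (simp add: fun_eq_iff forall_4 sum_4)
  have "Polynomial.coeff (T e) (2 * d) = (if e = e0 then c e0 else 0)" if e: "e \<in> ?E" for e
  proof (cases "e = e0")
    case True
    then show ?thesis by (simp add: T_def e0)
  next
    case False
    show ?thesis
    proof (cases "m dvd e 2")
      case True
      then obtain k where k: "e 2 = m * k" by (auto simp: dvd_def)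
      then have ek: "e 2 div m = k" using m_pos by simp
      have "Polynomial.degree A \<le> q"
        unfolding A_def using q_pos
        by (intro degree_diff_le) (auto intro: order_trans[OF degree_monom_le])
      then have dA: "Polynomial.degree (A ^ k) \<le> q * k"
        by (meson degree_power_le le_trans mult_le_mono1)
      have "Polynomial.degree (T e) \<le> q * k + (e 3 + 2 * e 4)"
        using True ek dA
        by (auto simp: T_def intro!: order_trans[OF degree_smult_le]
            order_trans[OF degree_mult_le] add_mono degree_monom_le)
      \<comment> \<open>The difference of the two sides is 2 e_1 + k + e_3, which vanishes only for
        the exponent vector \<open>e0\<close>.\<close>
      moreover have "q * k + (e 3 + 2 * e 4) < 2 * d"
      proof -
        have "2 * d = 2 * e 1 + (q + 1) * k + 2 * e 3 + 2 * e 4"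
          using e k unfolding q_m by (simp add: sum_4 algebra_simps)
        moreover have "0 < e 1 + k + e 3"
          using e0I[OF e] False k by (cases "k = 0") auto
        ultimately show ?thesis by (auto simp: algebra_simps)
      qed
      ultimately show ?thesis
        using False by (simp add: Polynomial.coeff_eq_0)
    qed (use False in \<open>simp add: T_def\<close>)
  qed
  then have "Polynomial.coeff (\<Sum>e\<in>?E. T e) (2 * d) = (\<Sum>e\<in>?E. if e = e0 then c e0 else 0)"
    unfolding Polynomial.coeff_sum by (intro sum.cong) auto
  then have c0: "c e0 = 0"
    using P0 e0 finite_exponents[of d] by (simp add: sum.delta)
  show ?thesis
    unfolding form_eval_def
  proof (rule sum.neutral, safe)
    fix e :: "4 \<Rightarrow> nat" assume e: "d = (\<Sum>i\<in>UNIV. e i)"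
    show "c e * (\<Prod>i\<in>UNIV. (vector [0, 0, 0, t] :: 'a alg_closure ^ 4) $ i ^ e i) = 0"
    proof (cases "e = e0")
      case False
      then have "e 1 \<noteq> 0 \<or> e 2 \<noteq> 0 \<or> e 3 \<noteq> 0" using e0I e by blast
      then show ?thesis by (auto simp: prod_4)
    qed (simp add: c0)
  qed
qed

lemma X_plus_eq: "X_plus q = (zariski_closure (affine_points q) :: ('a alg_closure ^ 4) set set)"
  unfolding X_plus_def plane_curve_image ..

text \<open>
  In homogeneous parameters the affine equation becomes $x^m = z y^q - z^q y$, which also
  covers the point at infinity (\<open>z = 0\<close>).
\<close>

definition curve_vec :: "'a \<Rightarrow> 'a \<Rightarrow> 'a \<Rightarrow> 'a ^ 4" where
  "curve_vec z y x = vector [z\<^sup>2, x, z * y, y\<^sup>2]"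

text \<open>The determinant of \<open>(z, y)\<close> and its conjugate pair; for a non-zero pair it
  vanishes exactly when the ratio z : y is defined over GF(q).\<close>

definition alt_form :: "'a \<Rightarrow> 'a \<Rightarrow> 'a" where
  "alt_form z y = z * cj y - cj z * y"

text \<open>Where X_0 = 0 the closure equations leave only (0,0,0,1), which belongs to the closure
  by the argument on forms at infinity; elsewhere one may normalise X_0 = 1.\<close>

lemma X_plus_rational_eq:
  "X_plus_rational q = {vec.span {curve_vec z y x} | z y x. (z \<noteq> 0 \<or> y \<noteq> 0) \<and> x ^ m = alt_form z y}"
  (is "?L = ?R")
proof (intro equalityI subsetI)
  fix P assume "P \<in> ?L"
  then obtain v :: "'a ^ 4" where v: "v \<noteq> 0" "P = vec.span {v}"
    and X: "vec.span {(\<chi> i. to_ac (v $ i))} \<in> zariski_closure (affine_points q)"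
    by (auto simp: X_plus_rational_def X_plus_eq)
  have "(\<chi> i. to_ac (v $ i)) \<in> vec.span {(\<chi> i. to_ac (v $ i))}"
    by (simp add: vec.span_base)
  note eqs = X_plus_affine[OF X this]
  have "to_ac ((v $ 3)\<^sup>2) = to_ac (v $ 1 * v $ 4)"
    using eqs(1) by simp
  then have 1: "(v $ 3)\<^sup>2 = v $ 1 * v $ 4"
    by (simp only: to_ac_eq_iff)
  have "to_ac ((v $ 3) ^ q - v $ 3 * (v $ 1) ^ (q - 1)) = to_ac ((v $ 2) ^ m * (v $ 1) ^ h)"
    using eqs(2) by simp
  then have 2: "(v $ 3) ^ q - v $ 3 * (v $ 1) ^ (q - 1) = (v $ 2) ^ m * (v $ 1) ^ h"
    by (simp only: to_ac_eq_iff)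
  have "to_ac ((v $ 2) ^ (q + 1) + 2 * (v $ 3) ^ (q + 1))
      = to_ac ((v $ 4) ^ q * v $ 1 + v $ 4 * (v $ 1) ^ q)"
    using eqs(3) by simp
  then have 3: "(v $ 2) ^ (q + 1) + 2 * (v $ 3) ^ (q + 1) = (v $ 4) ^ q * v $ 1 + v $ 4 * (v $ 1) ^ q"
    by (simp only: to_ac_eq_iff)
  show "P \<in> ?R"
  proof (cases "v $ 1 = 0")
    case True
    then have "v $ 3 = 0" using 1 by simp
    moreover from this have "v $ 2 = 0" using 3 True q_pos by (simp add: power_0_left)
    ultimately have "v = v $ 4 *s curve_vec 0 1 0" "v $ 4 \<noteq> 0"
      using True v(1) by (auto simp: vec4_eq_iff curve_vec_def)
    then have "P = vec.span {curve_vec 0 1 0}"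
      using v span_singleton_eq_iff by metis
    moreover have "(0::'a) ^ m = alt_form 0 1"
      using m_pos by (simp add: alt_form_def)
    ultimately show ?thesis by force
  next
    case False
    let ?z = "v $ 1" and ?x = "v $ 2 / v $ 1" and ?y = "v $ 3 / v $ 1"
    have "?z ^ q = ?z * ?z ^ (q - 1)"
      by (simp add: q_h)
    moreover have "?z ^ q = ?z ^ m * ?z ^ h"
      by (simp add: q_h m_h mult_2 flip: power_add)
    ultimately have "?x ^ m = ?y ^ q - ?y"
      using 2 False by (simp add: power_divide field_simps)
    then have "?x ^ m = alt_form 1 ?y"
      by (simp add: alt_form_def flip: cj_def)
    moreover have "v = v $ 1 *s curve_vec 1 ?y ?x"
      using 1 False by (simp add: vec4_eq_iff curve_vec_def field_simps power2_eq_square)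
    then have "P = vec.span {curve_vec 1 ?y ?x}"
      using v False span_singleton_eq_iff by metis
    ultimately show ?thesis by force
  qed
next
  fix P assume "P \<in> ?R"
  then obtain z y x where zy: "z \<noteq> 0 \<or> y \<noteq> 0" and x: "x ^ m = alt_form z y"
    and P: "P = vec.span {curve_vec z y x}"
    by blast
  let ?v = "curve_vec z y x"
  let ?w = "(\<chi> i. to_ac (?v $ i)) :: 'a alg_closure ^ 4"
  have v: "?v \<noteq> 0" using zy by (auto simp: curve_vec_def vec4_eq_iff)
  then have w: "?w \<noteq> 0" by (simp add: vec4_eq_iff)
  have "vec.span {?w} \<in> zariski_closure (affine_points q)"
  proof (cases "z = 0")
    case False
    have "(y / z) ^ q - y / z = (x / z\<^sup>2) ^ m"
    proof -
      have "(z\<^sup>2) ^ m = z * cj z"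
        using norm_pow_m[of z] power_even_eq[of z m] power_mult[of z 2 m] by argo
      then have "(x / z\<^sup>2) ^ m = alt_form z y / (z * cj z)"
        by (simp add: power_divide x)
      also have "\<dots> = cj (y / z) - y / z"
        using False by (simp add: alt_form_def field_simps)
      finally show ?thesis by (simp add: cj_def)
    qed
    then have "to_ac ((y / z) ^ q - y / z) = to_ac ((x / z\<^sup>2) ^ m)"
      by simp
    then have "to_ac (y / z) ^ q - to_ac (y / z) = to_ac (x / z\<^sup>2) ^ m"
      by simp
    moreover have "?w = to_ac (z\<^sup>2) *s vector [1, to_ac (x / z\<^sup>2), to_ac (y / z), (to_ac (y / z))\<^sup>2]"
      using False by (simp add: vec4_eq_iff curve_vec_def field_simps power2_eq_square)
    then have "vec.span {?w} = vec.span {vector [1, to_ac (x / z\<^sup>2), to_ac (y / z), (to_ac (y / z))\<^sup>2]}"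
      using w False span_singleton_eq_iff[OF w] by (metis power_not_zero to_ac_eq_0_iff)
    ultimately have "vec.span {?w} \<in> affine_points q"
      unfolding affine_points_def div_simps by blast
    then show ?thesis
      using w by (auto simp: zariski_closure_def)
  next
    case True
    then have "x = 0" using x m_pos by (simp add: alt_form_def)
    show ?thesis
      unfolding zariski_closure_def
    proof (intro CollectI conjI allI impI ballI)
      fix d c u
      assume van: "\<forall>Q\<in>affine_points q. \<forall>v\<in>Q. form_eval d c v = (0 :: 'a alg_closure)"
        and u: "u \<in> vec.span {?w}"
      then obtain k where "u = k *s ?w" by (auto simp: vec.span_singleton)
      then have u: "u = vector [0, 0, 0, u $ 4]"
        using True \<open>x = 0\<close> by (simp add: vec4_eq_iff curve_vec_def)
      have "form_eval d c (vector [1, x, y, y\<^sup>2]) = 0" if "y ^ q - y = x ^ m" for x y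
        using that van vec.span_base[of "vector [1, x, y, y\<^sup>2]"]
        by (fastforce simp: affine_points_def)
      then have "form_eval d c (vector [0, 0, 0, u $ 4]) = 0"
        by (rule form_at_infinity)
      then show "form_eval d c u = 0" using u by simp
    qed (use w in simp)
  qed
  then show "P \<in> ?L"
    using v by (auto simp: X_plus_rational_def X_plus_eq P)
qed


subsection \<open>Generators through a rational point\<close>

text \<open>The sesquilinear form polarising the equation of the surface; generators are its totally
  isotropic lines.\<close>

definition herm_form :: "'a ^ 4 \<Rightarrow> 'a ^ 4 \<Rightarrow> 'a" where
  "herm_form u v = u $ 2 * cj (v $ 2) + 2 * u $ 3 * cj (v $ 3) - u $ 1 * cj (v $ 4) - u $ 4 * cj (v $ 1)"

lemma herm_form_lincomb_left: "herm_form (\<alpha> *s u + \<beta> *s v) w = \<alpha> * herm_form u w + \<beta> * herm_form v w"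
  by (simp add: herm_form_def algebra_simps)

lemma herm_form_lincomb_right: "herm_form w (\<alpha> *s u + \<beta> *s v) = cj \<alpha> * herm_form w u + cj \<beta> * herm_form w v"
  by (simp add: herm_form_def algebra_simps)

lemma herm_form_swap: "herm_form v u = cj (herm_form u v)"
  by (simp add: herm_form_def algebra_simps)

lemma hermitian_surface_iff:
  assumes "v \<noteq> 0"
  shows "vec.span {v} \<in> hermitian_surface q \<longleftrightarrow> herm_form v v = 0"
proof -
  have *: "(v $ 2) ^ (q + 1) + 2 * (v $ 3) ^ (q + 1) = (v $ 4) ^ q * v $ 1 + v $ 4 * (v $ 1) ^ q
      \<longleftrightarrow> herm_form v v = 0" for v :: "'a ^ 4"
    by (auto simp: herm_form_def cj_def algebra_simps)
  have "herm_form (k *s v) (k *s v) = k * cj k * herm_form v v" for k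
    by (simp add: herm_form_def algebra_simps)
  then have "(\<forall>w\<in>vec.span {v}. herm_form w w = 0) \<longleftrightarrow> herm_form v v = 0"
    using vec.span_base[of v "{v}"] by (auto simp: vec.span_singleton)
  then show ?thesis
    using assms by (simp only: hermitian_surface_def * mem_Collect_eq span_in_pg_points simp_thms)
qed

lemma isotropic_line:
  assumes "herm_form u u = 0" "herm_form v v = 0" "herm_form u v = 0"
  shows "line_through u v \<subseteq> hermitian_surface q"
proof
  fix P assume P: "P \<in> line_through u v"
  then obtain w where w: "w \<noteq> 0" "P = vec.span {w}"
    by (auto simp: line_through_def pg_points_iff)
  then obtain \<alpha> \<beta> where "w = \<alpha> *s u + \<beta> *s v"
    using P span_in_line_through by blast
  moreover have "herm_form v u = 0"
    using assms herm_form_swap[of v u] by simp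
  ultimately have "herm_form w w = 0"
    using assms by (simp add: herm_form_lincomb_left herm_form_lincomb_right)
  then show "P \<in> hermitian_surface q"
    using w hermitian_surface_iff by simp
qed

text \<open>Polarisation: isotropy of u + v gives the vanishing of the sum of the two mixed values,
  isotropy of u + e v with \<open>cj e = - e\<close> that of their difference, and 2 is
  invertible.\<close>

lemma line_isotropic:
  assumes "line_through u v \<subseteq> hermitian_surface q" "u \<noteq> 0" "\<And>c. v \<noteq> c *s u"
  shows "herm_form u u = 0" "herm_form v v = 0" "herm_form u v = 0" "herm_form v u = 0"
proof -
  have iso: "herm_form (\<alpha> *s u + \<beta> *s v) (\<alpha> *s u + \<beta> *s v) = 0" for \<alpha> \<beta>
  proof (cases "\<alpha> *s u + \<beta> *s v = 0")
    case True
    then show ?thesis by (simp only: True) (simp add: herm_form_def)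
  next
    case False
    then have "vec.span {\<alpha> *s u + \<beta> *s v} \<in> hermitian_surface q"
      using assms(1) span_in_line_through[OF False] by blast
    then show ?thesis
      using hermitian_surface_iff[OF False] by simp
  qed
  show uu: "herm_form u u = 0" using iso[of 1 0] by simp
  show vv: "herm_form v v = 0" using iso[of 0 1] by simp
  obtain e where e: "e \<noteq> 0" "cj e = - e" using imag_exists by blast
  have "herm_form u v + herm_form v u = 0"
    using iso[of 1 1] uu vv unfolding herm_form_lincomb_left herm_form_lincomb_right by (simp add: add.commute)
  moreover have "e * (herm_form v u - herm_form u v) = 0"
    using iso[of 1 e] uu vv e unfolding herm_form_lincomb_left herm_form_lincomb_right by (simp add: algebra_simps)
  then have "herm_form v u = herm_form u v" using e by simp
  ultimately have "2 * herm_form u v = 0" by simp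
  then show "herm_form u v = 0" using two_neq_0 by simp
  with \<open>herm_form v u = herm_form u v\<close> show "herm_form v u = 0" by simp
qed

text \<open>The last condition is the one under which the pair preserves
  \<open>x ^ m = alt_form z y\<close>, since matrices over GF(q) multiply \<open>alt_form\<close> by
  their determinant.\<close>

definition admissible :: "'a \<Rightarrow> 'a \<Rightarrow> 'a \<Rightarrow> 'a \<Rightarrow> 'a \<Rightarrow> bool" where
  "admissible s a b c d \<longleftrightarrow> cj a = a \<and> cj b = b \<and> cj c = c \<and> cj d = d
     \<and> a * d - b * c \<noteq> 0 \<and> s ^ m = a * d - b * c"

lemma admissible_neq_0: "admissible s a b c d \<Longrightarrow> s \<noteq> 0"
  using m_pos by (auto simp: admissible_def power_0_left)

lemma admissible_invertible: "admissible s a b c d \<Longrightarrow> invertible (mat_block s a b c d)"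
  using invertible_mat_block[of s a d b c] admissible_neq_0[of s a b c d] by (auto simp: admissible_def)

lemma admissible_cj: "admissible s a b c d \<Longrightarrow> cj (a * d - b * c) = a * d - b * c"
  by (simp add: admissible_def)

lemma admissible_norm: "admissible s a b c d \<Longrightarrow> s * cj s = (a * d - b * c)\<^sup>2"
  using norm_pow_m[of s] by (simp add: admissible_def)

lemma admissible_mult:
  "admissible s a b c d \<Longrightarrow> admissible s' a' b' c' d' \<Longrightarrow>
   admissible (s * s') (a * a' + b * c') (a * b' + b * d') (c * a' + d * c') (c * b' + d * d')"
proof -
  assume 1: "admissible s a b c d" and 2: "admissible s' a' b' c' d'"
  have D: "(a * a' + b * c') * (c * b' + d * d') - (a * b' + b * d') * (c * a' + d * c')
      = (a * d - b * c) * (a' * d' - b' * c')"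
    by (simp add: algebra_simps)
  show ?thesis
    unfolding admissible_def D using 1 2 by (simp add: admissible_def power_mult_distrib)
qed

lemma admissible_inverse:
  assumes "admissible s a b c d"
  defines "D \<equiv> a * d - b * c"
  shows "admissible (1 / s) (d / D) (- b / D) (- c / D) (a / D)"
proof -
  have D0: "D \<noteq> 0" and cD: "cj D = D" and s: "s ^ m = D"
    using assms by (simp_all add: admissible_def)
  have "d / D * (a / D) - - b / D * (- c / D) = (a * d - b * c) / (D * D)"
    by (simp add: diff_divide_distrib mult.commute)
  then have D: "d / D * (a / D) - - b / D * (- c / D) = 1 / D"
    using D0 by (simp add: D_def)
  show ?thesis
    unfolding admissible_def D using assms(1) D0 cD s by (simp add: admissible_def power_one_over)
qed

lemma alt_form_mat_block:
  assumes "admissible s a b c d"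
  shows "alt_form (a * z + b * y) (c * z + d * y) = (a * d - b * c) * alt_form z y"
  using assms by (simp add: admissible_def alt_form_def algebra_simps)

lemma mat_block_curve_vec:
  "mat_block s a b c d *v curve_vec z y x = curve_vec (a * z + b * y) (c * z + d * y) (s * x)"
  unfolding curve_vec_def mat_block_vector by (simp add: vec4_eq_iff power2_eq_square algebra_simps)

lemma curve_vec_neq_0: "z \<noteq> 0 \<or> y \<noteq> 0 \<Longrightarrow> curve_vec z y x \<noteq> 0"
  by (auto simp: curve_vec_def vec4_eq_iff)

lemma curve_vec_scale: "curve_vec (r * z) (r * y) (r\<^sup>2 * x) = r\<^sup>2 *s curve_vec z y x"
  by (simp add: curve_vec_def vec4_eq_iff power2_eq_square algebra_simps)

lemma alt_form_scale: "alt_form (r * z) (r * y) = r * cj r * alt_form z y"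
  by (simp add: alt_form_def algebra_simps)

lemma cj_alt_form: "cj (alt_form z y) = - alt_form z y"
  by (simp add: alt_form_def algebra_simps)

lemma square_pow_m: "(x\<^sup>2) ^ m = x * cj x"
  using norm_pow_m[of x] power_even_eq[of x m] power_mult[of x 2 m] by argo

lemma herm_form_curve_vec: "herm_form (curve_vec z y x) (curve_vec z0 y0 x0) = x * cj x0 - (z * cj y0 - y * cj z0)\<^sup>2"
  by (simp add: herm_form_def curve_vec_def power2_eq_square algebra_simps)

text \<open>
  Distinct rational points of the curve are never conjugate: raising $x x_0^q = S^2$ to the power
  $m$ eliminates $x$ and $x_0$ and leaves the norm of $z y_0 - z_0 y$.
\<close>

lemma curve_points_conjugate:
  assumes "z \<noteq> 0 \<or> y \<noteq> 0" "z0 \<noteq> 0 \<or> y0 \<noteq> 0" "x ^ m = alt_form z y" "x0 ^ m = alt_form z0 y0"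
    and "herm_form (curve_vec z y x) (curve_vec z0 y0 x0) = 0"
  obtains r where "r \<noteq> 0" "z0 = r * z" "y0 = r * y" "x0 = r\<^sup>2 * x"
proof -
  define S where "S = z * cj y0 - y * cj z0"
  have xS: "x * cj x0 = S\<^sup>2"
    using assms(5) by (simp add: herm_form_curve_vec S_def)
  then have "x ^ m * cj (x0 ^ m) = S * cj S"
    using square_pow_m[of S] by (metis cj_power power_mult_distrib)
  then have "- (alt_form z y * alt_form z0 y0) = S * cj S"
    by (simp add: assms(3,4) cj_alt_form)
  then have "(z * y0 - z0 * y) * (cj z * cj y0 - cj z0 * cj y) = 0"
    unfolding S_def alt_form_def by (simp only: cj_diff cj_mult cj_cj) (simp add: algebra_simps)
  then have "(z * y0 - z0 * y) * cj (z * y0 - z0 * y) = 0"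
    by (simp only: cj_diff cj_mult)
  then have eq: "z * y0 = z0 * y"
    by (simp only: mult_eq_0_iff cj_eq_0_iff) simp
  obtain r where r: "r \<noteq> 0" "z0 = r * z" "y0 = r * y"
  proof (cases "z = 0")
    case True
    then have "z0 = 0" "y \<noteq> 0" using eq assms by auto
    then show ?thesis using that[of "y0 / y"] True assms by auto
  next
    case False
    then have "y0 = z0 / z * y" using eq by (simp add: field_simps)
    then show ?thesis using that[of "z0 / z"] False assms by auto
  qed
  \<comment> \<open>The curve equation determines \<open>x0\<close> only up to an
    \<open>m\<close>-th root of unity; the conjugacy relation \<open>xS\<close> itself removes this
    ambiguity.\<close>
  have "x0 = r\<^sup>2 * x"
  proof (cases "x = 0")
    case True
    then have "alt_form z y = 0" using assms(3) m_pos by (simp add: power_0_left)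
    then have "x0 ^ m = 0" using assms(4) r by (simp add: alt_form_scale)
    then show ?thesis using True by simp
  next
    case False
    have "S = cj r * alt_form z y" by (simp add: S_def alt_form_def r algebra_simps)
    moreover have "(alt_form z y)\<^sup>2 = x * cj x"
      using norm_pow_m[of x] assms(3) by simp
    ultimately have "x * cj x0 = x * cj (r\<^sup>2 * x)"
      using xS by (simp add: power_mult_distrib)
    then have "cj x0 = cj (r\<^sup>2 * x)" using False by simp
    then show ?thesis by (simp only: cj_eq_iff)
  qed
  with r that show thesis by blast
qed

text \<open>
  A generator through a rational point is spanned by this point and a second vector. At a point of
  the conic $x = 0$, with parameter \<open>(z, y)\<close> over $\mathrm{GF}(q)$, the second vector involves a
  complementary vector \<open>(z', y')\<close> of determinant 1 and an element \<open>w\<close> of norm $-2$. At any other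
  point it is $v_2 + k v_3$, where $v_2$ and $v_3$ are the product of \<open>(z, y)\<close> with its conjugate and
  the square of its conjugate, and \<open>k\<close> has norm $1/2$.
\<close>

definition conic_gvec :: "'a \<Rightarrow> 'a \<Rightarrow> 'a \<Rightarrow> 'a \<Rightarrow> 'a \<Rightarrow> 'a ^ 4" where
  "conic_gvec z y z' y' w = vector [2 * z * z', w, z * y' + z' * y, 2 * y * y']"

definition offconic_gvec :: "'a \<Rightarrow> 'a \<Rightarrow> 'a \<Rightarrow> 'a ^ 4" where
  "offconic_gvec z y k = vector [z * cj z + k * (cj z)\<^sup>2, 0, (z * cj y + cj z * y) / 2 + k * cj z * cj y,
     y * cj y + k * (cj y)\<^sup>2]"

definition conic_gen :: "'a \<Rightarrow> 'a \<Rightarrow> 'a \<Rightarrow> 'a \<Rightarrow> 'a \<Rightarrow> ('a ^ 4) set set" where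
  "conic_gen z y z' y' w = line_through (curve_vec z y 0) (conic_gvec z y z' y' w)"

definition offconic_gen :: "'a \<Rightarrow> 'a \<Rightarrow> 'a \<Rightarrow> 'a \<Rightarrow> ('a ^ 4) set set" where
  "offconic_gen z y x k = line_through (curve_vec z y x) (offconic_gvec z y k)"

text \<open>
  The invariants $w^m$ and $k^m (z y^q - z^q y)^h$ do not depend on the chosen parameters and are
  multiplied by the quadratic character of $ad - bc$ under the collineations of the group.
\<close>

definition conic_class :: "'a \<Rightarrow> ('a ^ 4) set set set" where
  "conic_class c = {conic_gen z y z' y' w | z y z' y' w. cj z = z \<and> cj y = y \<and> cj z' = z' \<and> cj y' = y'
     \<and> z * y' - z' * y = 1 \<and> w * cj w = -2 \<and> w ^ m = c}"

definition offconic_class :: "'a \<Rightarrow> ('a ^ 4) set set set" where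
  "offconic_class c = {offconic_gen z y x k | z y x k. alt_form z y \<noteq> 0 \<and> x ^ m = alt_form z y \<and> 2 * k * cj k = 1
     \<and> k ^ m * alt_form z y ^ h = c}"

text \<open>Dividing the image of the second vector by \<open>D\<close> restores determinant 1 of
  the two pairs. This division turns \<open>w\<close> into \<open>s * w / D\<close>, whose
  \<open>m\<close>-th power differs from that of \<open>w\<close> by the factor D / D^m =
  D^(-h).\<close>

lemma collineation_conic_gen:
  assumes "admissible s a b c d"
  defines "D \<equiv> a * d - b * c"
  shows "collineation (mat_block s a b c d) ` conic_gen z y z' y' w
    = conic_gen (a * z + b * y) (c * z + d * y) ((a * z' + b * y') / D) ((c * z' + d * y') / D) (s * w / D)"
proof -
  have "D \<noteq> 0" using assms by (simp add: admissible_def)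
  then show ?thesis
    unfolding conic_gen_def conic_gvec_def collineation_line_through[OF admissible_invertible[OF assms(1)]]
      mat_block_curve_vec mat_block_vector
    by (intro line_through_eqI[of _ 1 _ 0 _ _ 0 D])
      (simp_all add: vec4_eq_iff field_simps power2_eq_square)
qed

text \<open>Entries in GF(q) commute with conjugation, so the second vector of a pair goes to that
  of the image pair with the same \<open>k\<close>; the character will come from
  \<open>alt_form\<close> alone.\<close>

lemma collineation_offconic_gen:
  assumes "admissible s a b c d"
  shows "collineation (mat_block s a b c d) ` offconic_gen z y x k
    = offconic_gen (a * z + b * y) (c * z + d * y) (s * x) k"
proof -
  have cjs: "cj a = a" "cj b = b" "cj c = c" "cj d = d"
    using assms by (auto simp: admissible_def)
  show ?thesis
    unfolding offconic_gen_def offconic_gvec_def collineation_line_through[OF admissible_invertible[OF assms(1)]]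
      mat_block_curve_vec mat_block_vector
    by (rule arg_cong2[where f = line_through])
      (simp_all add: vec4_eq_iff cjs field_simps power2_eq_square two_neq_0)
qed

text \<open>Because of this change of \<open>k\<close>, the power \<open>k ^ m\<close> alone is no
  invariant: (cj r / r)^m is the \<open>h\<close>-th power of the norm of \<open>r\<close>, and
  exactly this is absorbed by \<open>alt_form z y ^ h\<close>.\<close>

lemma offconic_gen_scale:
  assumes "r \<noteq> 0"
  shows "offconic_gen (r * z) (r * y) (r\<^sup>2 * x) k = offconic_gen z y x (k * cj r / r)"
  unfolding offconic_gen_def offconic_gvec_def curve_vec_scale
  using assms by (intro line_through_eqI[of _ "r\<^sup>2" _ 0 _ _ 0 "r * cj r"])
    (simp_all add: vec4_eq_iff field_simps power2_eq_square two_neq_0)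

lemma conic_class_collineation:
  assumes "admissible s a b c d" "l \<in> conic_class e"
  shows "collineation (mat_block s a b c d) ` l \<in> conic_class ((a * d - b * c) ^ h * e)"
proof -
  define D where "D = a * d - b * c"
  have D: "D \<noteq> 0" "cj D = D" "s ^ m = D" "s * cj s = D\<^sup>2"
    using assms(1) admissible_norm[OF assms(1)] by (simp_all add: admissible_def D_def)
  have cjs: "cj a = a" "cj b = b" "cj c = c" "cj d = d"
    using assms by (auto simp: admissible_def)
  obtain z y z' y' w where l: "l = conic_gen z y z' y' w" and
    zy: "cj z = z" "cj y = y" "cj z' = z'" "cj y' = y'" "z * y' - z' * y = 1" "w * cj w = -2" "w ^ m = e"
    using assms(2) unfolding conic_class_def by blast
  have "(a * z + b * y) * ((c * z' + d * y') / D) - (a * z' + b * y') / D * (c * z + d * y)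
      = ((a * z + b * y) * (c * z' + d * y') - (a * z' + b * y') * (c * z + d * y)) / D"
    by (simp add: diff_divide_distrib)
  also have "\<dots> = D * (z * y' - z' * y) / D"
    unfolding D_def by (simp add: algebra_simps)
  also have "\<dots> = 1" using D zy by simp
  finally have 1: "(a * z + b * y) * ((c * z' + d * y') / D) - (a * z' + b * y') / D * (c * z + d * y) = 1" .
  have "s * w / D * cj (s * w / D) = (s * cj s) * (w * cj w) / (D * cj D)"
    by (simp add: ac_simps)
  then have 2: "s * w / D * cj (s * w / D) = -2"
    using D zy by (simp only:) (simp add: power2_eq_square)
  have "(s * w / D) ^ m = s ^ m * w ^ m / D ^ m"
    by (simp add: power_divide power_mult_distrib)
  also have "\<dots> = e / D ^ h"
    using D zy by (simp add: pow_m_eq[of D])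
  also have "\<dots> = D ^ h * e"
    using quad_char[OF D(2,1)] by auto
  finally have 3: "(s * w / D) ^ m = D ^ h * e" .
  show ?thesis
    unfolding l collineation_conic_gen[OF assms(1)] conic_class_def D_def[symmetric]
    using 1 2 3 zy(1-4) cjs D(2) by fastforce
qed

lemma offconic_class_collineation:
  assumes "admissible s a b c d" "l \<in> offconic_class e"
  shows "collineation (mat_block s a b c d) ` l \<in> offconic_class ((a * d - b * c) ^ h * e)"
proof -
  obtain z y x k where l: "l = offconic_gen z y x k" and
    zy: "alt_form z y \<noteq> 0" "x ^ m = alt_form z y" "2 * k * cj k = 1" "k ^ m * alt_form z y ^ h = e"
    using assms(2) unfolding offconic_class_def by blast
  have "alt_form (a * z + b * y) (c * z + d * y) \<noteq> 0"
    "(s * x) ^ m = alt_form (a * z + b * y) (c * z + d * y)"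
    "k ^ m * alt_form (a * z + b * y) (c * z + d * y) ^ h = (a * d - b * c) ^ h * e"
    unfolding alt_form_mat_block[OF assms(1)] using assms(1) zy
    by (auto simp: admissible_def power_mult_distrib)
  then show ?thesis
    unfolding l collineation_offconic_gen[OF assms(1)] offconic_class_def using zy(3) by blast
qed

lemma conic_gen_isotropic:
  assumes "cj z = z" "cj y = y" "cj z' = z'" "cj y' = y'" "z * y' - z' * y = 1" "w * cj w = -2"
  defines "u \<equiv> curve_vec z y 0" and "v \<equiv> conic_gvec z y z' y' w"
  shows "herm_form u u = 0" "herm_form u v = 0" "herm_form v v = 0" "u \<noteq> 0" "v \<noteq> e *s u"
proof -
  show "herm_form u u = 0" "herm_form u v = 0"
    unfolding u_def v_def conic_gvec_def using assms(1-4)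
    by (simp_all add: herm_form_def curve_vec_def power2_eq_square algebra_simps)
  have "herm_form v v = w * cj w + 2 * (z * y' - z' * y)\<^sup>2"
    unfolding v_def conic_gvec_def using assms(1-4)
    by (simp add: herm_form_def power2_eq_square algebra_simps)
  then show "herm_form v v = 0" using assms(5,6) by simp
  show "u \<noteq> 0"
    unfolding u_def using assms(5) by (intro curve_vec_neq_0) auto
  show "v \<noteq> e *s u"
  proof
    assume "v = e *s u"
    then have "w = 0" by (simp add: u_def v_def conic_gvec_def vec4_eq_iff curve_vec_def)
    then show False using assms(6) two_neq_0 by simp
  qed
qed

lemma four_neq_0: "(4::'a) \<noteq> 0"
  using two_neq_0 by (metis mult_2 mult_eq_0_iff numeral_Bit0)

text \<open>
  Up to scaling, these functionals read off the coefficients of $v_2$ and $v_3$ and vanish at the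
  point of the curve.
\<close>

definition mixed_functional :: "'a \<Rightarrow> 'a \<Rightarrow> 'a ^ 4 \<Rightarrow> 'a" where
  "mixed_functional z y v = v $ 1 * y * cj y - v $ 3 * (y * cj z + z * cj y) + v $ 4 * z * cj z"

definition square_functional :: "'a \<Rightarrow> 'a \<Rightarrow> 'a ^ 4 \<Rightarrow> 'a" where
  "square_functional z y v = v $ 1 * y\<^sup>2 - 2 * v $ 3 * z * y + v $ 4 * z\<^sup>2"

lemma mixed_functional_lincomb: "mixed_functional z y (\<alpha> *s u + \<beta> *s v) = \<alpha> * mixed_functional z y u + \<beta> * mixed_functional z y v"
  by (simp add: mixed_functional_def algebra_simps)

lemma square_functional_lincomb: "square_functional z y (\<alpha> *s u + \<beta> *s v) = \<alpha> * square_functional z y u + \<beta> * square_functional z y v"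
  by (simp add: square_functional_def algebra_simps)

lemma mixed_functional_offconic_gvec: "2 * mixed_functional z y (offconic_gvec z y k) = - (alt_form z y)\<^sup>2"
  using two_neq_0 four_neq_0
  by (simp add: mixed_functional_def offconic_gvec_def alt_form_def power2_eq_square field_simps)

lemma square_functional_offconic_gvec: "square_functional z y (offconic_gvec z y k) = k * (alt_form z y)\<^sup>2"
  using two_neq_0 by (simp add: square_functional_def offconic_gvec_def alt_form_def power2_eq_square field_simps)

text \<open>The coordinate X_1 is zero on the second vectors and \<open>x\<close> on the point, so
  \<open>\<alpha>\<close> vanishes; the mixed functional then gives \<open>\<beta> = 1\<close> and
  the square functional compares the two parameters.\<close>

lemma offconic_gvec_lincomb:
  assumes "alt_form z y \<noteq> 0" "x ^ m = alt_form z y" "offconic_gvec z y k = \<alpha> *s curve_vec z y x + \<beta> *s offconic_gvec z y k'"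
  shows "k = k'"
proof -
  have "x \<noteq> 0" using assms m_pos by (auto simp: power_0_left)
  moreover have "offconic_gvec z y k $ 2 = (\<alpha> *s curve_vec z y x + \<beta> *s offconic_gvec z y k') $ 2"
    using assms(3) by simp
  ultimately have "\<alpha> = 0" by (simp add: offconic_gvec_def curve_vec_def)
  then have eq: "offconic_gvec z y k = 0 *s curve_vec z y x + \<beta> *s offconic_gvec z y k'"
    using assms(3) by simp
  have "2 * mixed_functional z y (offconic_gvec z y k) = \<beta> * (2 * mixed_functional z y (offconic_gvec z y k'))"
    by (subst eq, subst mixed_functional_lincomb) simp
  then have "\<beta> = 1" using assms(1) by (simp add: mixed_functional_offconic_gvec)
  moreover have "square_functional z y (offconic_gvec z y k) = \<beta> * square_functional z y (offconic_gvec z y k')"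
    by (subst eq, subst square_functional_lincomb) simp
  ultimately show ?thesis using assms(1) by (simp add: square_functional_offconic_gvec)
qed

lemma herm_form_offconic_gvec: "2 * herm_form (offconic_gvec z y k) (offconic_gvec z y k) = (alt_form z y)\<^sup>2 * (1 - 2 * k * cj k)"
  unfolding offconic_gvec_def alt_form_def using two_neq_0 four_neq_0
  by (simp add: herm_form_def power2_eq_square field_simps)

lemma herm_form_curve_vec_self: "x ^ m = alt_form z y \<Longrightarrow> herm_form (curve_vec z y x) (curve_vec z y x) = 0"
  unfolding herm_form_curve_vec using norm_pow_m[of x] by (simp add: alt_form_def mult.commute[of y])

lemma herm_form_curve_vec_offconic_gvec: "herm_form (curve_vec z y x) (offconic_gvec z y k) = 0"
  using two_neq_0 by (simp add: offconic_gvec_def herm_form_def curve_vec_def power2_eq_square field_simps)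

lemma offconic_gen_isotropic:
  assumes "alt_form z y \<noteq> 0" "x ^ m = alt_form z y" "2 * k * cj k = 1"
  defines "u \<equiv> curve_vec z y x" and "v \<equiv> offconic_gvec z y k"
  shows "herm_form u u = 0" "herm_form u v = 0" "herm_form v v = 0" "u \<noteq> 0" "v \<noteq> e *s u"
proof -
  show "herm_form u u = 0" "herm_form u v = 0"
    unfolding u_def v_def using assms(2) by (simp_all add: herm_form_curve_vec_self herm_form_curve_vec_offconic_gvec)
  show "herm_form v v = 0"
    unfolding v_def using herm_form_offconic_gvec[of z y k] assms(3) two_neq_0 by simp
  show "u \<noteq> 0"
    unfolding u_def using assms(1) by (intro curve_vec_neq_0) (auto simp: alt_form_def)
  show "v \<noteq> e *s u"
  proof
    assume "v = e *s u"
    \<comment> \<open>With coefficient 0 the parameter \<open>k'\<close> is arbitrary, so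
      \<open>k\<close> would equal every element of the field.\<close>
    then have "offconic_gvec z y k = e *s curve_vec z y x + 0 *s offconic_gvec z y k'" for k'
      by (simp add: u_def v_def)
    then have "k = k'" for k' using offconic_gvec_lincomb assms by blast
    then show False using zero_neq_one by metis
  qed
qed

text \<open>Points of a totally isotropic line are conjugate to each other, and conjugate rational
  points of the curve coincide; so a generator determines its point, and its parameters up to
  scaling.\<close>

lemma curve_point_unique:
  assumes "line_through u v = line_through u0 v0"
    and "herm_form u u = 0" "herm_form u v = 0" "u = curve_vec z y x" "u0 = curve_vec z0 y0 x0"
    and "z \<noteq> 0 \<or> y \<noteq> 0" "z0 \<noteq> 0 \<or> y0 \<noteq> 0" "x ^ m = alt_form z y" "x0 ^ m = alt_form z0 y0"
  obtains r where "r \<noteq> 0" "z0 = r * z" "y0 = r * y" "x0 = r\<^sup>2 * x"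
proof -
  have "u0 \<noteq> 0" using assms by (simp add: curve_vec_neq_0)
  moreover have "u0 = 1 *s u0 + 0 *s v0" by simp
  ultimately have "vec.span {u0} \<in> line_through u v"
    unfolding assms(1) using span_in_line_through by blast
  then obtain \<alpha> \<beta> where "u0 = \<alpha> *s u + \<beta> *s v"
    using span_in_line_through[OF \<open>u0 \<noteq> 0\<close>] by blast
  then have "herm_form u u0 = 0"
    using assms(2,3) by (simp add: herm_form_lincomb_right)
  then show thesis
    using curve_points_conjugate[of z y z0 y0 x x0] assms that by blast
qed

lemma second_vec_lincomb:
  assumes "line_through u v = line_through u0 v0" "v0 \<noteq> 0"
  shows "\<exists>\<alpha> \<beta>. v0 = \<alpha> *s u + \<beta> *s v"
proof -
  have "v0 = 0 *s u0 + 1 *s v0" by simp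
  then have "vec.span {v0} \<in> line_through u v"
    unfolding assms(1) using span_in_line_through[OF assms(2)] by blast
  then show ?thesis using span_in_line_through[OF assms(2)] by blast
qed

lemma conic_class_unique:
  assumes "l \<in> conic_class e" "l \<in> conic_class e'"
  shows "e = e'"
proof -
  obtain z y z' y' w where l: "l = conic_gen z y z' y' w" and
    zy: "cj z = z" "cj y = y" "cj z' = z'" "cj y' = y'" "z * y' - z' * y = 1" "w * cj w = -2" "w ^ m = e"
    using assms(1) unfolding conic_class_def by blast
  obtain z0 y0 z0' y0' w0 where l0: "l = conic_gen z0 y0 z0' y0' w0" and
    zy0: "cj z0 = z0" "cj y0 = y0" "cj z0' = z0'" "cj y0' = y0'" "z0 * y0' - z0' * y0 = 1"
      "w0 * cj w0 = -2" "w0 ^ m = e'"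
    using assms(2) unfolding conic_class_def by blast
  note iso = conic_gen_isotropic[OF zy(1-6)] and iso0 = conic_gen_isotropic[OF zy0(1-6)]
  have eq: "line_through (curve_vec z y 0) (conic_gvec z y z' y' w)
      = line_through (curve_vec z0 y0 0) (conic_gvec z0 y0 z0' y0' w0)"
    using l l0 by (simp add: conic_gen_def)
  have "z \<noteq> 0 \<or> y \<noteq> 0" "z0 \<noteq> 0 \<or> y0 \<noteq> 0" "(0::'a) ^ m = alt_form z y" "(0::'a) ^ m = alt_form z0 y0"
    using zy zy0 m_pos by (auto simp: alt_form_def power_0_left)
  then obtain r where r: "z0 = r * z" "y0 = r * y"
    using curve_point_unique[OF eq iso(1,2) refl refl] by blast
  have "conic_gvec z0 y0 z0' y0' w0 \<noteq> 0"
    using iso0(5)[of 0] by simp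
  then obtain \<alpha> \<beta> where ab: "conic_gvec z0 y0 z0' y0' w0 = \<alpha> *s curve_vec z y 0 + \<beta> *s conic_gvec z y z' y' w"
    using second_vec_lincomb[OF eq] by blast
  \<comment> \<open>This functional kills the point of the conic and is non-zero on the second
    vector, so it reads off the coefficient \<open>\<beta>\<close>.\<close>
  define \<phi> where "\<phi> = (\<lambda>v::'a^4. v $ 1 * y * y' - v $ 3 * (y * z' + z * y') + v $ 4 * z * z')"
  have "\<phi> (conic_gvec z0 y0 z0' y0' w0) = - (z0 * y0' - z0' * y0) * (z * y' - z' * y)"
    unfolding \<phi>_def conic_gvec_def r by (simp add: algebra_simps)
  moreover have "\<phi> (\<alpha> *s curve_vec z y 0 + \<beta> *s conic_gvec z y z' y' w) = - \<beta> * (z * y' - z' * y)\<^sup>2"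
    unfolding \<phi>_def conic_gvec_def curve_vec_def by (simp add: power2_eq_square algebra_simps)
  ultimately have "\<beta> = 1"
    using ab zy(5) zy0(5) by simp
  moreover have "w0 = \<beta> * w"
    using ab by (simp add: vec4_eq_iff conic_gvec_def curve_vec_def)
  ultimately show ?thesis using zy(7) zy0(7) by simp
qed

lemma offconic_class_unique:
  assumes "l \<in> offconic_class e" "l \<in> offconic_class e'"
  shows "e = e'"
proof -
  obtain z y x k where l: "l = offconic_gen z y x k" and
    zy: "alt_form z y \<noteq> 0" "x ^ m = alt_form z y" "2 * k * cj k = 1" "k ^ m * alt_form z y ^ h = e"
    using assms(1) unfolding offconic_class_def by blast
  obtain z0 y0 x0 k0 where l0: "l = offconic_gen z0 y0 x0 k0" and
    zy0: "alt_form z0 y0 \<noteq> 0" "x0 ^ m = alt_form z0 y0" "2 * k0 * cj k0 = 1" "k0 ^ m * alt_form z0 y0 ^ h = e'"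
    using assms(2) unfolding offconic_class_def by blast
  note iso = offconic_gen_isotropic[OF zy(1-3)] and iso0 = offconic_gen_isotropic[OF zy0(1-3)]
  have eq: "line_through (curve_vec z y x) (offconic_gvec z y k)
      = line_through (curve_vec z0 y0 x0) (offconic_gvec z0 y0 k0)"
    using l l0 by (simp add: offconic_gen_def)
  have "z \<noteq> 0 \<or> y \<noteq> 0" "z0 \<noteq> 0 \<or> y0 \<noteq> 0"
    using zy zy0 by (auto simp: alt_form_def)
  then obtain r where r: "r \<noteq> 0" "z0 = r * z" "y0 = r * y" "x0 = r\<^sup>2 * x"
    using curve_point_unique[OF eq iso(1,2) refl refl] zy zy0 by blast
  \<comment> \<open>The parameter of the second description after passing to the representative
    \<open>(z, y, x)\<close> of the common point.\<close>
  let ?k = "k0 * cj r / r"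
  have "offconic_gen z y x ?k = offconic_gen z y x k"
    using l l0 r offconic_gen_scale[OF r(1)] by simp
  then have eq': "line_through (curve_vec z y x) (offconic_gvec z y ?k)
      = line_through (curve_vec z y x) (offconic_gvec z y k)"
    by (simp add: offconic_gen_def)
  have "offconic_gvec z y k \<noteq> 0"
    using iso(5)[of 0] by simp
  then have "k = ?k"
    using second_vec_lincomb[OF eq'] offconic_gvec_lincomb[OF zy(1,2)] by blast
  moreover have "(cj r / r) ^ m = (r * cj r) ^ h"
  proof -
    have "cj r / r = (r ^ h)\<^sup>2" using cj_pow_h[of r] r(1) by (simp add: field_simps)
    then have "(cj r / r) ^ m = r ^ (h * 2 * m)" by (simp only: power_mult)
    moreover have "(r * cj r) ^ h = r ^ (m * 2 * h)"
      unfolding norm_pow_m[symmetric] by (simp only: power_mult)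
    ultimately show ?thesis by (simp add: ac_simps)
  qed
  ultimately have "k ^ m = k0 ^ m * (r * cj r) ^ h"
    by (metis power_mult_distrib times_divide_eq_right)
  then show ?thesis
    using zy(4) zy0(4) unfolding r(2,3) alt_form_scale by (simp add: power_mult_distrib ac_simps)
qed

text \<open>The square of \<open>w ^ m\<close> is the norm of \<open>w\<close>; in particular the
  invariant is never zero.\<close>

lemma conic_class_value: "l \<in> conic_class e \<Longrightarrow> e\<^sup>2 = -2"
  unfolding conic_class_def using norm_pow_m by force

text \<open>Conjugation negates \<open>alt_form\<close>, so its (q-1)-st power is -1, while
  \<open>k ^ m\<close> squares to the norm 1/2.\<close>

lemma offconic_class_value:
  assumes "l \<in> offconic_class e"
  shows "2 * e\<^sup>2 = -1"
proof -
  obtain z y k where zy: "alt_form z y \<noteq> 0" "2 * k * cj k = 1" "k ^ m * alt_form z y ^ h = e"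
    using assms unfolding offconic_class_def by blast
  have "(alt_form z y ^ h)\<^sup>2 = -1"
    using cj_pow_h[of "alt_form z y"] zy(1) by (simp add: cj_alt_form) (metis mult_cancel_left mult_minus1_right)
  then have "2 * e\<^sup>2 = (2 * k * cj k) * (-1)"
    unfolding zy(3)[symmetric] power_mult_distrib norm_pow_m by simp
  then show ?thesis using zy(2) by simp
qed


subsection \<open>Transitivity on points and on generators\<close>

definition conic_orbit :: "('a ^ 4) set set" where
  "conic_orbit = {vec.span {curve_vec z y 0} | z y. (z \<noteq> 0 \<or> y \<noteq> 0) \<and> alt_form z y = 0}"

definition offconic_orbit :: "('a ^ 4) set set" where
  "offconic_orbit = {vec.span {curve_vec z y x} | z y x. alt_form z y \<noteq> 0 \<and> x ^ m = alt_form z y}"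

lemma X_plus_rational_orbits: "X_plus_rational q = conic_orbit \<union> offconic_orbit"
proof (intro equalityI subsetI)
  fix P :: "('a ^ 4) set"
  assume "P \<in> X_plus_rational q"
  then obtain z y x where P: "P = vec.span {curve_vec z y x}" "z \<noteq> 0 \<or> y \<noteq> 0" "x ^ m = alt_form z y"
    unfolding X_plus_rational_eq by blast
  show "P \<in> conic_orbit \<union> offconic_orbit"
  proof (cases "alt_form z y = 0")
    case True
    then have "x = 0" using P(3) by simp
    then show ?thesis using P True unfolding conic_orbit_def by blast
  next
    case False
    then show ?thesis using P unfolding offconic_orbit_def by blast
  qed
next
  fix P :: "('a ^ 4) set"
  assume "P \<in> conic_orbit \<union> offconic_orbit"
  moreover have "P \<in> X_plus_rational q" if P: "P \<in> conic_orbit"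
  proof -
    obtain z y where "P = vec.span {curve_vec z y 0}" "z \<noteq> 0 \<or> y \<noteq> 0" "alt_form z y = 0"
      using P unfolding conic_orbit_def by blast
    moreover from this have "(0::'a) ^ m = alt_form z y" using m_pos by (simp add: power_0_left)
    ultimately show ?thesis unfolding X_plus_rational_eq by blast
  qed
  moreover have "P \<in> X_plus_rational q" if P2: "P \<in> offconic_orbit"
  proof -
    obtain z y x where P: "P = vec.span {curve_vec z y x}" "alt_form z y \<noteq> 0" "x ^ m = alt_form z y"
      using P2 unfolding offconic_orbit_def by blast
    then have "z \<noteq> 0 \<or> y \<noteq> 0" by (auto simp: alt_form_def)
    then show ?thesis using P unfolding X_plus_rational_eq by blast
  qed
  ultimately show "P \<in> X_plus_rational q" by blast
qed

text \<open>Vanishing of \<open>alt_form\<close> puts the ratio of the coordinates into GF(q); after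
  scaling, the pair is over GF(q) and extends to a basis of determinant 1.\<close>

lemma conic_orbit_normal_form:
  assumes "P \<in> conic_orbit"
  obtains z y z' y' where "P = vec.span {curve_vec z y 0}" "cj z = z" "cj y = y" "cj z' = z'" "cj y' = y'"
    "z * y' - z' * y = 1"
proof -
  obtain z y where zy: "P = vec.span {curve_vec z y 0}" "z \<noteq> 0 \<or> y \<noteq> 0" "alt_form z y = 0"
    using assms unfolding conic_orbit_def by blast
  note nz = curve_vec_neq_0[OF zy(2)]
  show thesis
  proof (cases "z = 0")
    case True
    have "curve_vec z y 0 = y\<^sup>2 *s curve_vec 0 1 0"
      using True by (simp add: curve_vec_def vec4_eq_iff)
    then have "P = vec.span {curve_vec 0 1 0}"
      unfolding zy(1) span_singleton_eq_iff[OF nz] using zy(2) True by (intro exI[of _ "y\<^sup>2"]) simp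
    then show ?thesis
      by (rule that[of 0 1 "-1" 0]) simp_all
  next
    case False
    have "curve_vec z y 0 = z\<^sup>2 *s curve_vec 1 (y / z) 0"
      using False by (simp add: curve_vec_def vec4_eq_iff field_simps power2_eq_square)
    then have "P = vec.span {curve_vec 1 (y / z) 0}"
      unfolding zy(1) span_singleton_eq_iff[OF nz] using False by (intro exI[of _ "z\<^sup>2"]) simp
    moreover have "cj (y / z) = y / z"
      using zy(3) False by (simp add: alt_form_def field_simps)
    ultimately show ?thesis
      by (intro that[of 1 "y / z" 0 1]) simp_all
  qed
qed

section \<open>Normal forms of the generators through each orbit\<close>

lemma conic_orbitI: "cj z = z \<Longrightarrow> cj y = y \<Longrightarrow> z \<noteq> 0 \<or> y \<noteq> 0 \<Longrightarrow> vec.span {curve_vec z y 0} \<in> conic_orbit"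
  unfolding conic_orbit_def by (force simp: alt_form_def)

lemma offconic_orbitI: "alt_form z y \<noteq> 0 \<Longrightarrow> x ^ m = alt_form z y \<Longrightarrow> vec.span {curve_vec z y x} \<in> offconic_orbit"
  unfolding offconic_orbit_def by blast

lemma isotropic_generator:
  assumes "herm_form u u = 0" "herm_form u v = 0" "herm_form v v = 0" "u \<noteq> 0" "\<And>e. v \<noteq> e *s u" "vec.span {u} \<in> S"
  shows "line_through u v \<in> generators_meeting q S"
proof -
  have "u = 1 *s u + 0 *s v" by simp
  then have "vec.span {u} \<in> line_through u v"
    using assms(4) span_in_line_through by blast
  then show ?thesis
    unfolding generators_meeting_def generators_def
    using line_through_in_pg_lines[OF assms(4,5)] isotropic_line[OF assms(1,3,2)] assms(6) by blast
qed

lemma generator_through_point: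
  assumes "l \<in> generators q" "vec.span {u} \<in> l" "u \<noteq> 0"
  obtains v where "l = line_through u v" "\<And>c. v \<noteq> c *s u" "herm_form v v = 0" "herm_form u v = 0" "herm_form v u = 0"
proof -
  have "l \<in> pg_lines" "l \<subseteq> hermitian_surface q"
    using assms(1) by (auto simp: generators_def)
  with assms(2,3) obtain v where v: "\<And>c. v \<noteq> c *s u" "l = line_through u v"
    using pg_line_through_point by blast
  show thesis
    using that[OF v(2,1)] line_isotropic[OF _ assms(3) v(1)] \<open>l \<subseteq> _\<close> v(2) by blast
qed

text \<open>The second vector of a generator may be altered modulo the point and rescaled without
  losing isotropy, which allows its reduction to normal form.\<close>

lemma isotropic_shift:
  assumes "herm_form u u = 0" "herm_form v v = 0" "herm_form u v = 0" "herm_form v u = 0" "v = \<alpha> *s u + \<gamma> *s v'" "\<gamma> \<noteq> 0"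
  shows "herm_form v' v' = 0"
proof -
  have "v' = (- \<alpha> / \<gamma>) *s u + (1 / \<gamma>) *s v"
    unfolding assms(5) using assms(6) by (simp add: vec_eq_iff field_simps)
  then show ?thesis
    using assms(1-4) by (simp only: herm_form_lincomb_left herm_form_lincomb_right) simp
qed

lemma herm_form_conic_gvec:
  assumes "cj z = z" "cj y = y" "cj z' = z'" "cj y' = y'"
  shows "herm_form (conic_gvec z y z' y' w) (conic_gvec z y z' y' w) = w * cj w + 2 * (z * y' - z' * y)\<^sup>2"
  using assms by (simp add: conic_gvec_def herm_form_def power2_eq_square algebra_simps)

text \<open>The coordinates X_0, X_2, X_3 of a second vector are expanded in the squares and the
  product of the pairs \<open>(z, y)\<close> and \<open>(z', y')\<close>. Conjugacy with the point
  says that the coefficient of the square of \<open>(z', y')\<close> is zero. If also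
  \<open>\<gamma> = 0\<close>, only X_1 would remain modulo the point, and isotropy would kill
  it.\<close>

lemma generators_meeting_conic_orbit: "generators_meeting q conic_orbit = (\<Union>e. conic_class e)"
proof (intro equalityI subsetI)
  fix l assume "l \<in> generators_meeting q conic_orbit"
  then obtain P where l: "l \<in> generators q" "P \<in> l" "P \<in> conic_orbit"
    by (auto simp: generators_meeting_def)
  obtain z y z' y' where P: "P = vec.span {curve_vec z y 0}" and
    cjs: "cj z = z" "cj y = y" "cj z' = z'" "cj y' = y'" and det: "z * y' - z' * y = 1"
    using conic_orbit_normal_form[OF l(3)] .
  have u: "curve_vec z y 0 \<noteq> 0"
    using det by (intro curve_vec_neq_0) auto
  obtain v where v: "l = line_through (curve_vec z y 0) v" "\<And>c. v \<noteq> c *s curve_vec z y 0"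
    "herm_form v v = 0" "herm_form (curve_vec z y 0) v = 0" "herm_form v (curve_vec z y 0) = 0"
    using generator_through_point[OF l(1) l(2)[unfolded P] u] by blast
  have uu: "herm_form (curve_vec z y 0) (curve_vec z y 0) = 0"
    using cjs by (simp add: herm_form_curve_vec)
  define X0 X1 X2 X3 where "X0 = v $ 1" and "X1 = v $ 2" and "X2 = v $ 3" and "X3 = v $ 4"
  define \<gamma> where "\<gamma> = X2 * (y * z' + z * y') - X0 * y * y' - X3 * z * z'"
  define \<alpha> where "\<alpha> = X0 * y'\<^sup>2 - 2 * X2 * z' * y' + X3 * z'\<^sup>2"
  have \<delta>: "X0 * y\<^sup>2 - 2 * X2 * z * y + X3 * z\<^sup>2 = 0"
    using v(5) cjs by (simp add: herm_form_def curve_vec_def X0_def X2_def X3_def algebra_simps)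
  define \<delta> where "\<delta> = X0 * y\<^sup>2 - 2 * X2 * z * y + X3 * z\<^sup>2"
  have "(z * y' - z' * y)\<^sup>2 * X0 = \<alpha> * z\<^sup>2 + 2 * \<gamma> * z * z' + \<delta> * z'\<^sup>2"
    "(z * y' - z' * y)\<^sup>2 * X2 = \<alpha> * z * y + \<gamma> * (z * y' + z' * y) + \<delta> * z' * y'"
    "(z * y' - z' * y)\<^sup>2 * X3 = \<alpha> * y\<^sup>2 + 2 * \<gamma> * y * y' + \<delta> * y'\<^sup>2"
    unfolding \<alpha>_def \<gamma>_def \<delta>_def by (simp_all add: power2_eq_square algebra_simps)
  then have comps: "X0 = \<alpha> * z\<^sup>2 + 2 * \<gamma> * z * z'" "X2 = \<alpha> * z * y + \<gamma> * (z * y' + z' * y)"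
    "X3 = \<alpha> * y\<^sup>2 + 2 * \<gamma> * y * y'"
    using det \<delta> by (simp_all add: \<delta>_def)
  have \<gamma>: "\<gamma> \<noteq> 0"
  proof
    assume g0: "\<gamma> = 0"
    have "v - \<alpha> *s curve_vec z y 0 = vector [0, X1, 0, 0]"
      using comps g0 by (simp add: vec4_eq_iff curve_vec_def X0_def X1_def X2_def X3_def)
    then have v_eq: "v = \<alpha> *s curve_vec z y 0 + 1 *s vector [0, X1, 0, 0]"
      by (simp add: algebra_simps)
    have "herm_form (vector [0, X1, 0, 0]) (vector [0, X1, 0, 0]) = 0"
      by (rule isotropic_shift[OF uu v(3) v(4) v(5) v_eq one_neq_zero])
    then have "X1 = 0" by (simp add: herm_form_def)
    then have "v = \<alpha> *s curve_vec z y 0"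
      using comps g0 by (simp add: vec4_eq_iff curve_vec_def X0_def X1_def X2_def X3_def)
    then show False using v(2) by blast
  qed
  have v_eq: "v = \<alpha> *s curve_vec z y 0 + \<gamma> *s conic_gvec z y z' y' (X1 / \<gamma>)"
    using comps \<gamma> by (simp add: vec4_eq_iff curve_vec_def conic_gvec_def X0_def X1_def X2_def X3_def)
  then have "herm_form (conic_gvec z y z' y' (X1 / \<gamma>)) (conic_gvec z y z' y' (X1 / \<gamma>)) = 0"
    using isotropic_shift[OF uu v(3-5)] \<gamma> by blast
  then have "X1 / \<gamma> * cj (X1 / \<gamma>) = -2"
    unfolding herm_form_conic_gvec[OF cjs] det by (simp add: eq_neg_iff_add_eq_0)
  moreover have "l = conic_gen z y z' y' (X1 / \<gamma>)"
    unfolding v(1) conic_gen_def using \<gamma> v_eq by (intro line_through_eqI[of _ 1 _ 0 _ _ \<alpha> \<gamma>]) simp_all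
  ultimately show "l \<in> (\<Union>e. conic_class e)"
    unfolding conic_class_def using cjs det by blast
next
  fix l assume "l \<in> (\<Union>e. conic_class e)"
  then obtain z y z' y' w where l: "l = conic_gen z y z' y' w" and
    zy: "cj z = z" "cj y = y" "cj z' = z'" "cj y' = y'" "z * y' - z' * y = 1" "w * cj w = -2"
    unfolding conic_class_def by blast
  have "z \<noteq> 0 \<or> y \<noteq> 0" using zy(5) by auto
  then show "l \<in> generators_meeting q conic_orbit"
    unfolding l conic_gen_def using conic_gen_isotropic[OF zy] conic_orbitI[OF zy(1,2)]
    by (intro isotropic_generator) auto
qed

text \<open>The same expansion with the conjugate of \<open>(z, y)\<close> as second pair. Conjugacy
  with the point now fixes X_1, so subtracting a multiple of the point leaves a vector with X_1 = 0.
  If \<open>\<gamma> = 0\<close>, this would be a multiple of the square of the conjugate pair,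
  which has form value -T and is not isotropic.\<close>

lemma generators_meeting_offconic_orbit: "generators_meeting q offconic_orbit = (\<Union>e. offconic_class e)"
proof (intro equalityI subsetI)
  fix l assume "l \<in> generators_meeting q offconic_orbit"
  then obtain P where l: "l \<in> generators q" "P \<in> l" "P \<in> offconic_orbit"
    by (auto simp: generators_meeting_def)
  obtain z y x where P: "P = vec.span {curve_vec z y x}" and t: "alt_form z y \<noteq> 0" "x ^ m = alt_form z y"
    using l(3) unfolding offconic_orbit_def by blast
  have u: "curve_vec z y x \<noteq> 0"
    using t by (intro curve_vec_neq_0) (auto simp: alt_form_def)
  have x: "x \<noteq> 0" using t m_pos by (auto simp: power_0_left)
  obtain v where v: "l = line_through (curve_vec z y x) v" "\<And>c. v \<noteq> c *s curve_vec z y x"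
    "herm_form v v = 0" "herm_form (curve_vec z y x) v = 0" "herm_form v (curve_vec z y x) = 0"
    using generator_through_point[OF l(1) l(2)[unfolded P] u] by blast
  have uu: "herm_form (curve_vec z y x) (curve_vec z y x) = 0"
    using t(2) by (rule herm_form_curve_vec_self)
  define X0 X1 X2 X3 where "X0 = v $ 1" and "X1 = v $ 2" and "X2 = v $ 3" and "X3 = v $ 4"
  define T where "T = (alt_form z y)\<^sup>2"
  define \<alpha> where "\<alpha> = (X0 * (cj y)\<^sup>2 - 2 * X2 * cj z * cj y + X3 * (cj z)\<^sup>2)"
  define \<gamma> where "\<gamma> = 2 * (X2 * (y * cj z + z * cj y) - X0 * y * cj y - X3 * z * cj z)"
  define \<delta> where "\<delta> = X0 * y\<^sup>2 - 2 * X2 * z * y + X3 * z\<^sup>2"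
  have T: "T \<noteq> 0" "T = x * cj x" using t x norm_pow_m[of x] by (simp_all add: T_def)
  have comps: "T * X0 = \<alpha> * z\<^sup>2 + \<gamma> * (z * cj z) + \<delta> * (cj z)\<^sup>2"
    "T * X2 = \<alpha> * (z * y) + \<gamma> * ((z * cj y + cj z * y) / 2) + \<delta> * (cj z * cj y)"
    "T * X3 = \<alpha> * y\<^sup>2 + \<gamma> * (y * cj y) + \<delta> * (cj y)\<^sup>2"
    unfolding \<alpha>_def \<gamma>_def \<delta>_def T_def alt_form_def using two_neq_0
    by (simp_all add: power2_eq_square field_simps)
  have "X1 * cj x = \<alpha>"
    using v(5) by (simp add: herm_form_def curve_vec_def \<alpha>_def X0_def X1_def X2_def X3_def algebra_simps)
  then have "T * X1 = \<alpha> * x"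
    by (auto simp: T(2))
  then have X1: "X1 = (\<alpha> / T) * x"
    using T(1) by (simp add: field_simps)
  have "w = (\<alpha> / T) * a + (\<gamma> / T) * b + (\<delta> / T) * c"
    if "T * w = \<alpha> * a + \<gamma> * b + \<delta> * c" for w a b c
    using that T(1) by (simp add: field_simps)
  note X = X1 comps[THEN this]
  have \<gamma>: "\<gamma> \<noteq> 0"
  proof
    assume g0: "\<gamma> = 0"
    let ?w = "vector [(cj z)\<^sup>2, 0, cj z * cj y, (cj y)\<^sup>2] :: 'a ^ 4"
    have v_eq: "v = (\<alpha> / T) *s curve_vec z y x + (\<delta> / T) *s ?w"
      using X g0 by (simp add: vec4_eq_iff curve_vec_def X0_def X1_def X2_def X3_def)
    have "\<delta> \<noteq> 0"
    proof
      assume "\<delta> = 0"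
      then have "v = (\<alpha> / T) *s curve_vec z y x" using v_eq by simp
      then show False using v(2) by blast
    qed
    then have "herm_form ?w ?w = 0"
      using isotropic_shift[OF uu v(3-5) v_eq] T by simp
    moreover have "herm_form ?w ?w = - T"
      unfolding T_def alt_form_def by (simp add: herm_form_def power2_eq_square algebra_simps)
    ultimately show False using T(1) by simp
  qed
  have v_eq: "v = (\<alpha> / T) *s curve_vec z y x + (\<gamma> / T) *s offconic_gvec z y (\<delta> / \<gamma>)"
    using X \<gamma> T(1) by (simp add: vec4_eq_iff curve_vec_def offconic_gvec_def X0_def X1_def X2_def X3_def algebra_simps)
  have "\<gamma> / T \<noteq> 0" using \<gamma> T by simp
  then have "herm_form (offconic_gvec z y (\<delta> / \<gamma>)) (offconic_gvec z y (\<delta> / \<gamma>)) = 0"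
    using isotropic_shift[OF uu v(3-5) v_eq] by blast
  then have "2 * (\<delta> / \<gamma>) * cj (\<delta> / \<gamma>) = 1"
    using herm_form_offconic_gvec[of z y "\<delta> / \<gamma>"] t by simp
  moreover have "l = offconic_gen z y x (\<delta> / \<gamma>)"
    unfolding v(1) offconic_gen_def using \<open>\<gamma> / T \<noteq> 0\<close> v_eq
    by (intro line_through_eqI[of _ 1 _ 0 _ _ "\<alpha> / T" "\<gamma> / T"]) simp_all
  ultimately show "l \<in> (\<Union>e. offconic_class e)"
    unfolding offconic_class_def using t by blast
next
  fix l assume "l \<in> (\<Union>e. offconic_class e)"
  then obtain z y x k where l: "l = offconic_gen z y x k" and
    zy: "alt_form z y \<noteq> 0" "x ^ m = alt_form z y" "2 * k * cj k = 1"
    unfolding offconic_class_def by blast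
  show "l \<in> generators_meeting q offconic_orbit"
    unfolding l offconic_gen_def using offconic_gen_isotropic[OF zy] offconic_orbitI[OF zy(1,2)]
    by (intro isotropic_generator) auto
qed

text \<open>The matrix is the one with columns \<open>(z0, y0)\<close> and \<open>D\<close> times
  \<open>(z0', y0')\<close>, multiplied by the inverse of the one with columns \<open>(z, y)\<close>
  and \<open>(z', y')\<close>. Putting \<open>D\<close> on the second column leaves the determinant
  free while the point is hit exactly.\<close>

lemma frame_map:
  assumes "cj z = z" "cj y = y" "cj z' = z'" "cj y' = y'" "z * y' - z' * y = 1"
    and "cj z0 = z0" "cj y0 = y0" "cj z0' = z0'" "cj y0' = y0'" "z0 * y0' - z0' * y0 = 1"
    and "cj D = D" "D \<noteq> 0" "s ^ m = D"
  obtains a b c d where "admissible s a b c d" "a * d - b * c = D"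
    "a * z + b * y = z0" "c * z + d * y = y0" "a * z' + b * y' = D * z0'" "c * z' + d * y' = D * y0'"
proof -
  define a b c d where "a = z0 * y' - D * z0' * y" and "b = D * z0' * z - z0 * z'"
    and "c = y0 * y' - D * y0' * y" and "d = D * y0' * z - y0 * z'"
  have "a * d - b * c = D * (z0 * y0' - z0' * y0) * (z * y' - z' * y)"
    unfolding a_def b_def c_def d_def by (simp add: algebra_simps)
  then have D: "a * d - b * c = D" using assms(5,10) by simp
  have "a * z + b * y = z0 * (z * y' - z' * y)" "c * z + d * y = y0 * (z * y' - z' * y)"
    "a * z' + b * y' = D * z0' * (z * y' - z' * y)" "c * z' + d * y' = D * y0' * (z * y' - z' * y)"
    unfolding a_def b_def c_def d_def by (simp_all add: algebra_simps)
  moreover have "admissible s a b c d"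
    unfolding admissible_def D using assms by (simp add: a_def b_def c_def d_def)
  ultimately show thesis using that D assms(5) by simp
qed

lemma conic_class_transitive:
  assumes "l \<in> conic_class e" "l0 \<in> conic_class e0"
  obtains s a b c d where "admissible s a b c d" "collineation (mat_block s a b c d) ` l = l0"
proof -
  obtain z y z' y' w where l: "l = conic_gen z y z' y' w" and
    zy: "cj z = z" "cj y = y" "cj z' = z'" "cj y' = y'" "z * y' - z' * y = 1" "w * cj w = -2"
    using assms(1) unfolding conic_class_def by blast
  obtain z0 y0 z0' y0' w0 where l0: "l0 = conic_gen z0 y0 z0' y0' w0" and
    zy0: "cj z0 = z0" "cj y0 = y0" "cj z0' = z0'" "cj y0' = y0'" "z0 * y0' - z0' * y0 = 1"
      "w0 * cj w0 = -2"
    using assms(2) unfolding conic_class_def by blast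
  have w: "w \<noteq> 0" using zy(6) two_neq_0 by auto
  have "((w0 / w) ^ m)\<^sup>2 = (w0 * cj w0) / (w * cj w)"
    unfolding norm_pow_m by simp
  then have "((w0 / w) ^ m)\<^sup>2 = 1"
    using zy(6) zy0(6) two_neq_0 by simp
  then have "(w0 / w) ^ m = 1 \<or> (w0 / w) ^ m = -1"
    using power2_eq_1_iff by blast
  \<comment> \<open>Reaching \<open>w0\<close> requires \<open>s * w / D = w0\<close>, that is
    \<open>s = D * (w0 / w)\<close>; the condition \<open>s ^ m = D\<close> then prescribes the
    character of \<open>D\<close> to be this sign.\<close>
  then obtain D where D: "cj D = D" "D \<noteq> 0" "D ^ h = (w0 / w) ^ m"
    using nonsquare_exists cj_1 by (metis power_one one_neq_zero)
  have "(D * (w0 / w)) ^ m = D * (D ^ h)\<^sup>2"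
    unfolding power_mult_distrib pow_m_eq[of D] D(3)[symmetric] by (simp add: power2_eq_square)
  then have "(D * (w0 / w)) ^ m = D"
    using quad_char_square[OF D(1,2)] by simp
  then obtain a b c d where B: "admissible (D * (w0 / w)) a b c d" "a * d - b * c = D"
    "a * z + b * y = z0" "c * z + d * y = y0" "a * z' + b * y' = D * z0'" "c * z' + d * y' = D * y0'"
    using frame_map[OF zy(1-5) zy0(1-5) D(1,2)] by blast
  have "collineation (mat_block (D * (w0 / w)) a b c d) ` l = l0"
    unfolding l l0 collineation_conic_gen[OF B(1)] B(2-6) using D(2) w by simp
  then show thesis using that B(1) by blast
qed

text \<open>
  Off the conic, \<open>z\<close> and \<open>y\<close> form a basis over $\mathrm{GF}(q)$, so any target pair is the image of
  \<open>(z, y)\<close> under a unique matrix over $\mathrm{GF}(q)$, given by Cramer's rule.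
\<close>

lemma curve_map:
  assumes "alt_form z y \<noteq> 0" "x ^ m = alt_form z y" "alt_form z0 y0 \<noteq> 0" "x0 ^ m = alt_form z0 y0"
  obtains s a b c d where "admissible s a b c d" "(a * d - b * c) * alt_form z y = alt_form z0 y0"
    "a * z + b * y = z0" "c * z + d * y = y0" "s * x = x0"
proof -
  let ?t = "alt_form z y"
  define a b c d where "a = (z0 * cj y - cj z0 * y) / ?t" and "b = (z * cj z0 - cj z * z0) / ?t"
    and "c = (y0 * cj y - cj y0 * y) / ?t" and "d = (z * cj y0 - cj z * y0) / ?t"
  have cjs: "cj a = a" "cj b = b" "cj c = c" "cj d = d"
    unfolding a_def b_def c_def d_def
    by (simp_all add: cj_alt_form minus_divide_right[symmetric] diff_divide_distrib mult.commute)
  have "a * z + b * y = z0 * ?t / ?t"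
    unfolding a_def b_def by (simp add: alt_form_def add_divide_distrib[symmetric] algebra_simps)
  then have 1: "a * z + b * y = z0" using assms(1) by simp
  have "c * z + d * y = y0 * ?t / ?t"
    unfolding c_def d_def by (simp add: alt_form_def add_divide_distrib[symmetric] algebra_simps)
  then have 2: "c * z + d * y = y0" using assms(1) by simp
  have D: "(a * d - b * c) * ?t = alt_form z0 y0"
    unfolding 1[symmetric] 2[symmetric] by (simp add: alt_form_def cjs algebra_simps)
  have x: "x \<noteq> 0" using assms(1,2) m_pos by (auto simp: power_0_left)
  have "(x0 / x) ^ m = a * d - b * c"
    using D assms by (simp add: power_divide field_simps)
  moreover have "a * d - b * c \<noteq> 0" using D assms(3) by auto
  ultimately have "admissible (x0 / x) a b c d"
    using cjs by (simp add: admissible_def)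
  then show thesis using that D 1 2 x by simp
qed

lemma offconic_class_transitive:
  assumes "l \<in> offconic_class e" "l0 \<in> offconic_class e0"
  obtains s a b c d where "admissible s a b c d" "collineation (mat_block s a b c d) ` l = l0"
proof -
  obtain z y x k where l: "l = offconic_gen z y x k" and
    zy: "alt_form z y \<noteq> 0" "x ^ m = alt_form z y" "2 * k * cj k = 1"
    using assms(1) unfolding offconic_class_def by blast
  obtain z0 y0 x0 k0 where l0: "l0 = offconic_gen z0 y0 x0 k0" and
    zy0: "alt_form z0 y0 \<noteq> 0" "x0 ^ m = alt_form z0 y0" "2 * k0 * cj k0 = 1"
    using assms(2) unfolding offconic_class_def by blast
  have k: "k \<noteq> 0" using zy(3) by auto
  \<comment> \<open>The collineations do not change \<open>k\<close>, but another representative of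
    the target point multiplies it by \<open>cj r / r\<close>, and Hilbert 90 yields every element
    of norm 1 in this way.\<close>
  have "k0 / k * cj (k0 / k) = (2 * k0 * cj k0) / (2 * k * cj k)"
    using two_neq_0 by simp
  then have "k0 / k * cj (k0 / k) = 1"
    unfolding zy zy0 by simp
  then obtain r where r: "r \<noteq> 0" "cj r = k0 / k * r"
    using hilbert90 by blast
  have w1: "alt_form (r * z0) (r * y0) \<noteq> 0"
    unfolding alt_form_scale using r(1) zy0(1) by simp
  have w2: "(r\<^sup>2 * x0) ^ m = alt_form (r * z0) (r * y0)"
    using zy0 by (simp add: alt_form_scale power_mult_distrib square_pow_m)
  obtain s a b c d where B: "admissible s a b c d" "(a * d - b * c) * alt_form z y = alt_form (r * z0) (r * y0)"
    "a * z + b * y = r * z0" "c * z + d * y = r * y0" "s * x = r\<^sup>2 * x0"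
    using curve_map[OF zy(1,2) w1 w2] .
  have "collineation (mat_block s a b c d) ` l = l0"
    unfolding l l0 collineation_offconic_gen[OF B(1)] B(3-5) offconic_gen_scale[OF r(1)] using r k by simp
  then show thesis using that B(1) by blast
qed

text \<open>Determinant 1 suffices, since the normal forms of both points are first members of bases
  of determinant 1.\<close>

lemma conic_orbit_transitive:
  assumes "P \<in> conic_orbit" "P0 \<in> conic_orbit"
  obtains s a b c d where "admissible s a b c d" "(a * d - b * c) ^ h = 1" "collineation (mat_block s a b c d) P = P0"
proof -
  obtain z y z' y' where P: "P = vec.span {curve_vec z y 0}" and
    zy: "cj z = z" "cj y = y" "cj z' = z'" "cj y' = y'" "z * y' - z' * y = 1"
    using conic_orbit_normal_form[OF assms(1)] .
  obtain z0 y0 z0' y0' where P0: "P0 = vec.span {curve_vec z0 y0 0}" and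
    zy0: "cj z0 = z0" "cj y0 = y0" "cj z0' = z0'" "cj y0' = y0'" "z0 * y0' - z0' * y0 = 1"
    using conic_orbit_normal_form[OF assms(2)] .
  obtain a b c d where B: "admissible 1 a b c d" "a * d - b * c = 1" "a * z + b * y = z0" "c * z + d * y = y0"
    "a * z' + b * y' = 1 * z0'" "c * z' + d * y' = 1 * y0'"
    using frame_map[OF zy zy0 cj_1 one_neq_zero power_one] .
  have "curve_vec z y 0 \<noteq> 0"
    using zy(5) by (intro curve_vec_neq_0) auto
  then have "collineation (mat_block 1 a b c d) P = P0"
    unfolding P P0 by (simp add: collineation_span mat_block_curve_vec B(3,4))
  then show thesis using that B by simp
qed

text \<open>Between chosen representatives the matrix is unique, but rescaling the target by
  \<open>r\<close> multiplies its determinant by the norm of \<open>r\<close>, and norms include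
  non-squares of GF(q).\<close>

lemma offconic_orbit_transitive:
  assumes "P \<in> offconic_orbit" "P0 \<in> offconic_orbit"
  obtains s a b c d where "admissible s a b c d" "(a * d - b * c) ^ h = 1" "collineation (mat_block s a b c d) P = P0"
proof -
  obtain z y x where P: "P = vec.span {curve_vec z y x}" and zy: "alt_form z y \<noteq> 0" "x ^ m = alt_form z y"
    using assms(1) unfolding offconic_orbit_def by blast
  obtain z0 y0 x0 where P0: "P0 = vec.span {curve_vec z0 y0 x0}" and
    zy0: "alt_form z0 y0 \<noteq> 0" "x0 ^ m = alt_form z0 y0"
    using assms(2) unfolding offconic_orbit_def by blast
  define D where "D = alt_form z0 y0 / alt_form z y"
  have D: "cj D = D" "D \<noteq> 0" using zy zy0 by (simp_all add: D_def cj_alt_form)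
  obtain r where r: "r \<noteq> 0" "(r * cj r * D) ^ h = 1"
  proof (cases "D ^ h = 1")
    case True
    then show ?thesis using that[of 1] by simp
  next
    case False
    then have "D ^ h = -1" using quad_char[OF D] by blast
    moreover obtain r where "r \<noteq> 0" "(r * cj r) ^ h = -1" using norm_nonsquare by blast
    ultimately show ?thesis using that[of r] by (simp add: power_mult_distrib)
  qed
  have w1: "alt_form (r * z0) (r * y0) \<noteq> 0"
    unfolding alt_form_scale using r(1) zy0(1) by simp
  have w2: "(r\<^sup>2 * x0) ^ m = alt_form (r * z0) (r * y0)"
    using zy0 by (simp add: alt_form_scale power_mult_distrib square_pow_m)
  obtain s a b c d where B: "admissible s a b c d" "(a * d - b * c) * alt_form z y = alt_form (r * z0) (r * y0)"
    "a * z + b * y = r * z0" "c * z + d * y = r * y0" "s * x = r\<^sup>2 * x0"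
    using curve_map[OF zy(1,2) w1 w2] .
  have "a * d - b * c = r * cj r * D"
    using B(2) zy(1) by (simp add: alt_form_scale D_def field_simps)
  then have Dh: "(a * d - b * c) ^ h = 1" using r(2) by simp
  have "z \<noteq> 0 \<or> y \<noteq> 0" "z0 \<noteq> 0 \<or> y0 \<noteq> 0" using zy zy0 by (auto simp: alt_form_def)
  note nz = this[THEN curve_vec_neq_0]
  have "collineation (mat_block s a b c d) P = vec.span {r\<^sup>2 *s curve_vec z0 y0 x0}"
    unfolding P using nz by (simp add: collineation_span mat_block_curve_vec B(3-5) curve_vec_scale)
  also have "\<dots> = P0"
    unfolding P0 using r(1) nz by (subst span_singleton_eq_iff) auto
  finally show thesis using that B(1) Dh by blast
qed

section \<open>Invariance of the two point sets\<close>

lemma conic_orbit_collineation: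
  assumes "admissible s a b c d" "P \<in> conic_orbit"
  shows "collineation (mat_block s a b c d) P \<in> conic_orbit"
proof -
  obtain z y where P: "P = vec.span {curve_vec z y 0}" "z \<noteq> 0 \<or> y \<noteq> 0" "alt_form z y = 0"
    using assms(2) unfolding conic_orbit_def by blast
  note nz = curve_vec_neq_0[OF P(2), of 0]
  have "collineation (mat_block s a b c d) P = vec.span {curve_vec (a * z + b * y) (c * z + d * y) 0}"
    unfolding P(1) using nz by (simp add: collineation_span mat_block_curve_vec)
  moreover have "alt_form (a * z + b * y) (c * z + d * y) = 0"
    unfolding alt_form_mat_block[OF assms(1)] P(3) by simp
  moreover have "curve_vec (a * z + b * y) (c * z + d * y) 0 \<noteq> 0"
    using invertible_mult_neq_0[OF admissible_invertible[OF assms(1)] nz] by (simp add: mat_block_curve_vec)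
  then have "a * z + b * y \<noteq> 0 \<or> c * z + d * y \<noteq> 0"
    by (auto simp: curve_vec_def vec4_eq_iff)
  ultimately show ?thesis unfolding conic_orbit_def by blast
qed

lemma offconic_orbit_collineation:
  assumes "admissible s a b c d" "P \<in> offconic_orbit"
  shows "collineation (mat_block s a b c d) P \<in> offconic_orbit"
proof -
  obtain z y x where P: "P = vec.span {curve_vec z y x}" "alt_form z y \<noteq> 0" "x ^ m = alt_form z y"
    using assms(2) unfolding offconic_orbit_def by blast
  then have "z \<noteq> 0 \<or> y \<noteq> 0" by (auto simp: alt_form_def)
  then have "collineation (mat_block s a b c d) P = vec.span {curve_vec (a * z + b * y) (c * z + d * y) (s * x)}"
    unfolding P(1) by (simp add: collineation_span mat_block_curve_vec curve_vec_neq_0)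
  moreover have "alt_form (a * z + b * y) (c * z + d * y) \<noteq> 0"
    "(s * x) ^ m = alt_form (a * z + b * y) (c * z + d * y)"
    unfolding alt_form_mat_block[OF assms(1)] using P assms(1) by (simp_all add: admissible_def power_mult_distrib)
  ultimately show ?thesis unfolding offconic_orbit_def by blast
qed

lemma conic_class_nonempty: "\<exists>e. conic_class e \<noteq> {}"
proof -
  obtain w where "w * cj w = -2"
    using norm_surj[of "-2"] two_neq_0 by auto
  then have "conic_gen 1 0 0 1 w \<in> conic_class (w ^ m)"
    unfolding conic_class_def by (intro CollectI exI[of _ 1] exI[of _ 0] exI[of _ w]) simp
  then show ?thesis by blast
qed


subsection \<open>The two groups\<close>

abbreviation Bij_points :: "(('a ^ 4) set \<Rightarrow> ('a ^ 4) set) monoid" where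
  "Bij_points \<equiv> BijGroup pg_points"

definition block_coll :: "'a \<Rightarrow> 'a \<Rightarrow> 'a \<Rightarrow> 'a \<Rightarrow> 'a \<Rightarrow> ('a ^ 4) set \<Rightarrow> ('a ^ 4) set" where
  "block_coll s a b c d = collineation (mat_block s a b c d)"

definition block_colls :: "(('a ^ 4) set \<Rightarrow> ('a ^ 4) set) set" where
  "block_colls = {block_coll s a b c d | s a b c d. admissible s a b c d}"

definition square_block_colls :: "(('a ^ 4) set \<Rightarrow> ('a ^ 4) set) set" where
  "square_block_colls = {block_coll s a b c d | s a b c d. admissible s a b c d \<and> (a * d - b * c) ^ h = 1}"

lemma group_Bij_points: "group Bij_points"
  by (rule group_BijGroup)

lemma block_coll_closed: "admissible s a b c d \<Longrightarrow> block_coll s a b c d \<in> carrier Bij_points"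
  using collineation_Bij[OF admissible_invertible] by (simp add: block_coll_def BijGroup_def)

lemma block_coll_mult:
  "admissible s a b c d \<Longrightarrow> admissible s' a' b' c' d' \<Longrightarrow> block_coll s a b c d \<otimes>\<^bsub>Bij_points\<^esub> block_coll s' a' b' c' d' =
   block_coll (s * s') (a * a' + b * c') (a * b' + b * d') (c * a' + d * c') (c * b' + d * d')"
  unfolding block_coll_def by (simp add: collineation_mult admissible_invertible mat_block_mult)

lemma block_coll_one: "block_coll 1 1 0 0 1 = \<one>\<^bsub>Bij_points\<^esub>"
  unfolding block_coll_def by (simp add: mat_block_1 collineation_mat_1 BijGroup_def)

lemma det_mult:
  "(a * a' + b * c') * (c * b' + d * d') - (a * b' + b * d') * (c * a' + d * c')
     = (a * d - b * c) * (a' * d' - b' * c')" for a b c d :: 'a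
  by (simp add: algebra_simps)

lemma block_coll_inverse:
  assumes "admissible s a b c d"
  defines "D \<equiv> a * d - b * c"
  shows "inv\<^bsub>Bij_points\<^esub> (block_coll s a b c d) = block_coll (1 / s) (d / D) (- b / D) (- c / D) (a / D)"
proof -
  have "block_coll (1 / s) (d / D) (- b / D) (- c / D) (a / D) \<otimes>\<^bsub>Bij_points\<^esub> block_coll s a b c d = \<one>\<^bsub>Bij_points\<^esub>"
  proof -
    have "a * d - b * c \<noteq> 0" using assms(1) by (simp add: admissible_def)
    then show ?thesis
      unfolding block_coll_def D_def
        collineation_mult[OF admissible_invertible[OF admissible_inverse[OF assms(1)]] admissible_invertible[OF assms(1)]]
        mat_block_inverse(2)[OF admissible_neq_0[OF assms(1)] \<open>a * d - b * c \<noteq> 0\<close>]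
      by (simp add: collineation_mat_1 BijGroup_def)
  qed
  then show ?thesis
    using assms(1) admissible_inverse[OF assms(1)] unfolding D_def
    by (intro group.inv_equality[OF group_Bij_points]) (simp_all add: block_coll_closed)
qed

text \<open>The symmetric square of \<open>r A\<close> is \<open>r\<^sup>2\<close> times that of
  \<open>A\<close>. Scaling serves both to match the given matrices and to normalise
  products.\<close>

lemma block_coll_scale:
  assumes "admissible s a b c d" "r \<noteq> 0"
  shows "block_coll (r\<^sup>2 * s) (r * a) (r * b) (r * c) (r * d) = block_coll s a b c d"
  unfolding block_coll_def
proof (rule collineation_scale[of "r\<^sup>2"])
  show "mat_block (r\<^sup>2 * s) (r * a) (r * b) (r * c) (r * d) *v v = r\<^sup>2 *s (mat_block s a b c d *v v)" for v
    by (simp add: vec4_eq_iff matrix_vector_mult_4 mat_block_def power2_eq_square algebra_simps)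
  have "r * a * (r * d) - r * b * (r * c) = r\<^sup>2 * (a * d - b * c)"
    by (simp add: power2_eq_square algebra_simps)
  then show "invertible (mat_block (r\<^sup>2 * s) (r * a) (r * b) (r * c) (r * d))"
    using assms admissible_neq_0[OF assms(1)] by (intro invertible_mat_block) (simp_all add: admissible_def)
qed (use assms in simp)

lemma subgroup_block_colls: "subgroup block_colls Bij_points"
proof (rule group.subgroupI[OF group_Bij_points])
  show "block_colls \<subseteq> carrier Bij_points"
    unfolding block_colls_def using block_coll_closed by blast
  have "admissible 1 1 0 0 1" by (simp add: admissible_def)
  then show "block_colls \<noteq> {}" unfolding block_colls_def by blast
next
  fix f assume "f \<in> block_colls"
  then obtain s a b c d where "f = block_coll s a b c d" "admissible s a b c d" unfolding block_colls_def by blast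
  then show "inv\<^bsub>Bij_points\<^esub> f \<in> block_colls"
    unfolding block_colls_def using block_coll_inverse admissible_inverse by blast
next
  fix f f' assume "f \<in> block_colls" "f' \<in> block_colls"
  then obtain s a b c d s' a' b' c' d' where f: "f = block_coll s a b c d" "admissible s a b c d"
    "f' = block_coll s' a' b' c' d'" "admissible s' a' b' c' d'" unfolding block_colls_def by blast
  show "f \<otimes>\<^bsub>Bij_points\<^esub> f' \<in> block_colls"
    unfolding block_colls_def f(1,3) block_coll_mult[OF f(2,4)] using admissible_mult[OF f(2,4)] by blast
qed

lemma admissible_quad_char:
  assumes "admissible s a b c d"
  shows "(a * d - b * c) ^ h = 1 \<or> (a * d - b * c) ^ h = -1"
  using assms admissible_cj quad_char by (simp add: admissible_def)

lemma subgroup_square_block_colls: "subgroup square_block_colls Bij_points"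
proof (rule group.subgroupI[OF group_Bij_points])
  show "square_block_colls \<subseteq> carrier Bij_points"
    unfolding square_block_colls_def using block_coll_closed by blast
  have "block_coll 1 1 0 0 1 \<in> square_block_colls"
    unfolding square_block_colls_def by (intro CollectI exI[of _ 1] exI[of _ 0]) (simp add: admissible_def)
  then show "square_block_colls \<noteq> {}" by blast
next
  fix f assume "f \<in> square_block_colls"
  then obtain s a b c d where f: "f = block_coll s a b c d" "admissible s a b c d" "(a * d - b * c) ^ h = 1"
    unfolding square_block_colls_def by blast
  define D where "D = a * d - b * c"
  have "d / D * (a / D) - - b / D * (- c / D) = (a * d - b * c) / (D * D)"
    by (simp add: diff_divide_distrib mult.commute)
  moreover have "D ^ h = 1" using f(3) by (simp add: D_def)
  ultimately have "(d / D * (a / D) - - b / D * (- c / D)) ^ h = 1"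
    by (simp only: D_def[symmetric] power_divide power_mult_distrib) simp
  then show "inv\<^bsub>Bij_points\<^esub> f \<in> square_block_colls"
    unfolding square_block_colls_def f(1) block_coll_inverse[OF f(2)] D_def using admissible_inverse[OF f(2)] by blast
next
  fix f f' assume "f \<in> square_block_colls" "f' \<in> square_block_colls"
  then obtain s a b c d s' a' b' c' d' where f: "f = block_coll s a b c d" "admissible s a b c d" "(a * d - b * c) ^ h = 1"
    "f' = block_coll s' a' b' c' d'" "admissible s' a' b' c' d'" "(a' * d' - b' * c') ^ h = 1"
    unfolding square_block_colls_def by blast
  have "((a * a' + b * c') * (c * b' + d * d') - (a * b' + b * d') * (c * a' + d * c')) ^ h = 1"
    unfolding det_mult by (simp add: power_mult_distrib f)
  then show "f \<otimes>\<^bsub>Bij_points\<^esub> f' \<in> square_block_colls"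
    unfolding square_block_colls_def f(1,4) block_coll_mult[OF f(2,5)] using admissible_mult[OF f(2,5)] by blast
qed

lemma block_coll_sign:
  assumes "admissible s a b c d" "admissible s' a' b' c' d'" "block_coll s a b c d = block_coll s' a' b' c' d'"
  shows "(a * d - b * c) ^ h = (a' * d' - b' * c') ^ h"
proof -
  obtain e l where l: "l \<in> conic_class e" using conic_class_nonempty by blast
  have "e \<noteq> 0" using conic_class_value[OF l] two_neq_0 by auto
  moreover have "(a * d - b * c) ^ h * e = (a' * d' - b' * c') ^ h * e"
    using conic_class_collineation[OF assms(1) l] conic_class_collineation[OF assms(2) l] assms(3) conic_class_unique
    unfolding block_coll_def by metis
  ultimately show ?thesis by simp
qed

section \<open>The given matrices as admissible pairs\<close>

lemma admissible_T: "cj \<alpha> = \<alpha> \<Longrightarrow> admissible 1 1 0 \<alpha> 1"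
  by (simp add: admissible_def)

text \<open>Upper transvections are not among the given generators; they enter H as elements of
  order dividing p.\<close>

lemma admissible_U: "cj \<alpha> = \<alpha> \<Longrightarrow> admissible 1 1 \<alpha> 0 1"
  by (simp add: admissible_def)

lemma admissible_M: "cj \<rho> = \<rho> \<Longrightarrow> \<rho> \<noteq> 0 \<Longrightarrow> \<rho> ^ h = 1 \<Longrightarrow> admissible \<rho> 1 0 0 \<rho>"
  by (simp add: admissible_def pow_m_eq)

lemma admissible_L: "l ^ m = 1 \<Longrightarrow> admissible l 1 0 0 1"
  by (simp add: admissible_def)

lemma admissible_N: "l ^ m = -1 \<Longrightarrow> admissible l 0 1 1 0"
  by (simp add: admissible_def)

lemma admissible_R: "cj \<mu> = \<mu> \<Longrightarrow> \<mu> \<noteq> 0 \<Longrightarrow> \<mu> ^ h = -1 \<Longrightarrow> admissible \<mu> 0 1 \<mu> 0"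
  by (simp add: admissible_def pow_m_eq)

lemma coll_T: "collineation (mat_T \<alpha>) = block_coll 1 1 0 \<alpha> 1"
  unfolding block_coll_def by (rule arg_cong[of _ _ collineation]) (simp add: mat_T_def mat_block_def)

lemma coll_L: "collineation (mat_L l) = block_coll l 1 0 0 1"
  unfolding block_coll_def by (rule arg_cong[of _ _ collineation]) (simp add: mat_L_def mat_block_def)

lemma coll_N: "collineation (mat_N l) = block_coll l 0 1 1 0"
  unfolding block_coll_def by (rule arg_cong[of _ _ collineation]) (simp add: mat_N_def mat_block_def)

text \<open>Multiplying by \<open>\<rho>\<close> gives diag(1, \<rho>, \<rho>, \<rho>^2), the
  symmetric square of diag(1, \<rho>) together with \<open>s = \<rho>\<close>.\<close>

lemma coll_M: "\<rho> \<noteq> 0 \<Longrightarrow> collineation (mat_M \<rho>) = block_coll \<rho> 1 0 0 \<rho>"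
proof -
  assume \<rho>: "\<rho> \<noteq> 0"
  then have "invertible (mat_block \<rho> 1 0 0 \<rho>)" by (intro invertible_mat_block) simp_all
  moreover have "mat_block \<rho> 1 0 0 \<rho> *v v = \<rho> *s (mat_M \<rho> *v v)" for v
    using \<rho> by (simp add: vec4_eq_iff matrix_vector_mult_4 mat_block_def mat_M_def power2_eq_square)
  ultimately show ?thesis
    unfolding block_coll_def using collineation_scale[OF \<rho>] by metis
qed

lemma coll_R: "\<mu> \<noteq> 0 \<Longrightarrow> collineation (mat_R \<mu>) = block_coll \<mu> 0 1 \<mu> 0"
proof -
  assume \<mu>: "\<mu> \<noteq> 0"
  then have "invertible (mat_block \<mu> 0 1 \<mu> 0)" by (intro invertible_mat_block) simp_all
  moreover have "mat_block \<mu> 0 1 \<mu> 0 *v v = \<mu> *s (mat_R \<mu> *v v)" for v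
    using \<mu> by (simp add: vec4_eq_iff matrix_vector_mult_4 mat_block_def mat_R_def power2_eq_square)
  ultimately show ?thesis
    unfolding block_coll_def using collineation_scale[OF \<mu>] by metis
qed

definition gens_G :: "(('a ^ 4) set \<Rightarrow> ('a ^ 4) set) set" where
  "gens_G = {block_coll 1 1 0 \<alpha> 1 | \<alpha>. cj \<alpha> = \<alpha>} \<union> {block_coll \<rho> 1 0 0 \<rho> | \<rho>. cj \<rho> = \<rho> \<and> \<rho> \<noteq> 0 \<and> \<rho> ^ h = 1}
     \<union> {block_coll l 1 0 0 1 | l. l ^ m = 1} \<union> {block_coll l 0 1 1 0 | l. l ^ m = -1}
     \<union> {block_coll \<mu> 0 1 \<mu> 0 | \<mu>. cj \<mu> = \<mu> \<and> \<mu> \<noteq> 0 \<and> \<mu> ^ h = -1}"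

lemma square_in_Fq_iff: "\<rho> \<noteq> 0 \<and> (\<exists>b\<in>Fq q. \<rho> = b\<^sup>2) \<longleftrightarrow> cj \<rho> = \<rho> \<and> \<rho> \<noteq> 0 \<and> \<rho> ^ h = 1"
proof
  assume "\<rho> \<noteq> 0 \<and> (\<exists>b\<in>Fq q. \<rho> = b\<^sup>2)"
  then obtain b where "\<rho> \<noteq> 0" "cj b = b" "\<rho> = b\<^sup>2" by (auto simp: Fq_iff)
  then show "cj \<rho> = \<rho> \<and> \<rho> \<noteq> 0 \<and> \<rho> ^ h = 1"
    using square_imp_quad_char[of b] by auto
next
  assume "cj \<rho> = \<rho> \<and> \<rho> \<noteq> 0 \<and> \<rho> ^ h = 1"
  then show "\<rho> \<noteq> 0 \<and> (\<exists>b\<in>Fq q. \<rho> = b\<^sup>2)"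
    using quad_char_imp_square[of \<rho>] by (auto simp: Fq_iff)
qed

lemma nonsquare_in_Fq_iff:
  "\<mu> \<in> Fq q \<and> \<not> (\<exists>b\<in>Fq q. \<mu> = b\<^sup>2) \<longleftrightarrow> cj \<mu> = \<mu> \<and> \<mu> \<noteq> 0 \<and> \<mu> ^ h = -1"
proof (cases "\<mu> = 0")
  case True
  have "(0::'a) = 0\<^sup>2" "(0::'a) \<in> Fq q" by (simp_all add: Fq_iff)
  then show ?thesis using True by blast
next
  case False
  then show ?thesis
    using square_in_Fq_iff[of \<mu>] quad_char[of \<mu>] neg_one_neq_one by (auto simp: Fq_iff)
qed

lemma frak_G_eq: "frak_G q = subgroup_generated Bij_points gens_G"
proof -
  have "{collineation (mat_T \<alpha>) | \<alpha>. \<alpha> \<in> Fq q} = {block_coll 1 1 0 \<alpha> 1 | \<alpha>. cj \<alpha> = \<alpha>}"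
    by (simp add: coll_T Fq_iff)
  moreover have "{collineation (mat_M \<rho>) | \<rho>. \<rho> \<noteq> 0 \<and> (\<exists>b\<in>Fq q. \<rho> = b\<^sup>2)}
      = {block_coll \<rho> 1 0 0 \<rho> | \<rho>. cj \<rho> = \<rho> \<and> \<rho> \<noteq> 0 \<and> \<rho> ^ h = 1}"
    unfolding square_in_Fq_iff using coll_M by metis
  moreover have "L_collineations q = {block_coll l 1 0 0 1 | l. l ^ m = 1}"
    by (simp add: L_collineations_def coll_L)
  moreover have "{collineation (mat_N \<sigma>) | \<sigma>. \<sigma> ^ ((q + 1) div 2) = -1} = {block_coll l 0 1 1 0 | l. l ^ m = -1}"
    by (simp add: coll_N)
  moreover have "{collineation (mat_R \<mu>) | \<mu>. \<mu> \<in> Fq q \<and> \<not> (\<exists>b\<in>Fq q. \<mu> = b\<^sup>2)}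
      = {block_coll \<mu> 0 1 \<mu> 0 | \<mu>. cj \<mu> = \<mu> \<and> \<mu> \<noteq> 0 \<and> \<mu> ^ h = -1}"
    unfolding nonsquare_in_Fq_iff using coll_R by metis
  ultimately show ?thesis
    unfolding frak_G_def gens_G_def by simp
qed

lemma gens_G_subset: "gens_G \<subseteq> block_colls"
proof -
  have *: "admissible s a b c d \<Longrightarrow> block_coll s a b c d \<in> block_colls" for s a b c d
    unfolding block_colls_def by blast
  show ?thesis
    unfolding gens_G_def by (auto intro!: * admissible_T admissible_M admissible_L admissible_N admissible_R)
qed

text \<open>
  For $b \neq 0$ the matrix with rows $(a,b)$, $(c,d)$ is the product of a lower unitriangular, an
  antidiagonal and a lower unitriangular matrix, with entries $d/b$ and $a/b$ below the diagonal;
  the antidiagonal factor is $M N$ or $R L$ according to the quadratic character.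
\<close>

lemma block_coll_generated:
  assumes K: "subgroup K Bij_points"
    and KT: "\<And>\<alpha>. cj \<alpha> = \<alpha> \<Longrightarrow> block_coll 1 1 0 \<alpha> 1 \<in> K"
    and KM: "\<And>\<rho>. cj \<rho> = \<rho> \<Longrightarrow> \<rho> \<noteq> 0 \<Longrightarrow> \<rho> ^ h = 1 \<Longrightarrow> block_coll \<rho> 1 0 0 \<rho> \<in> K"
    and KL: "\<And>l. l ^ m = 1 \<Longrightarrow> block_coll l 1 0 0 1 \<in> K"
    and KN: "\<And>l. l ^ m = -1 \<Longrightarrow> block_coll l 0 1 1 0 \<in> K"
    and admissible: "admissible s a b c d"
    and KR: "(a * d - b * c) ^ h = 1 \<or> (\<forall>\<mu>. cj \<mu> = \<mu> \<longrightarrow> \<mu> \<noteq> 0 \<longrightarrow> \<mu> ^ h = -1 \<longrightarrow> block_coll \<mu> 0 1 \<mu> 0 \<in> K)"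
  shows "block_coll s a b c d \<in> K"
proof -
  have mult: "f \<otimes>\<^bsub>Bij_points\<^esub> f' \<in> K" if "f \<in> K" "f' \<in> K" for f f'
    using subgroup.m_closed[OF K that] .
  have main: "block_coll s a b c d \<in> K" if admissible: "admissible s a b c d" and b: "b \<noteq> 0"
    and KR: "(a * d - b * c) ^ h = 1 \<or> (\<forall>\<mu>. cj \<mu> = \<mu> \<longrightarrow> \<mu> \<noteq> 0 \<longrightarrow> \<mu> ^ h = -1 \<longrightarrow> block_coll \<mu> 0 1 \<mu> 0 \<in> K)"
    for s a b c d
  proof -
    define D where "D = a * d - b * c"
    \<comment> \<open>Scaled by \<open>b\<close>, the pair with \<open>s\<close>-part
      \<open>\<mu> * l\<close> and rows (0, 1), (\<mu>, 0) becomes the antidiagonal factor with rows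
      (0, b), (-D/b, 0) and \<open>s\<close>-part \<open>s\<close>. The value of
      \<open>l ^ m\<close> then tells \<open>N\<close> from \<open>L\<close>.\<close>
    define \<mu> where "\<mu> = - D / b\<^sup>2"
    define l where "l = - s / D"
    have D: "D \<noteq> 0" "cj D = D" "s ^ m = D" and cjs: "cj a = a" "cj b = b" "cj c = c" "cj d = d"
      using admissible by (simp_all add: admissible_def D_def)
    have \<mu>: "cj \<mu> = \<mu>" "\<mu> \<noteq> 0" using D b cjs by (simp_all add: \<mu>_def)
    have "\<mu> ^ h = (-1) ^ h * D ^ h / (b\<^sup>2) ^ h"
      unfolding \<mu>_def power_divide power_minus[of D] ..
    then have \<mu>h: "\<mu> ^ h = D ^ h"
      using square_imp_quad_char[OF cjs(2) b] quad_char_neg_one by simp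
    have "l ^ m = (-1) ^ m * s ^ m / D ^ m"
      unfolding l_def power_divide power_minus[of s] ..
    then have lm: "l ^ m = - (1 / D ^ h)"
      using D neg_one_pow_m by (simp add: pow_m_eq[of D])
    have "block_coll (\<mu> * l) 0 1 \<mu> 0 \<in> K \<and> admissible (\<mu> * l) 0 1 \<mu> 0"
    proof (cases "D ^ h = 1")
      case True
      then have "\<mu> ^ h = 1" "l ^ m = -1" using \<mu>h lm by simp_all
      then show ?thesis
        using mult[OF KM[OF \<mu>] KN[of l]] block_coll_mult[OF admissible_M[OF \<mu>] admissible_N[of l]]
          admissible_mult[OF admissible_M[OF \<mu>] admissible_N[of l]] by simp
    next
      case False
      then have "D ^ h = -1" using quad_char[OF D(2,1)] by blast
      then have "\<mu> ^ h = -1" "l ^ m = 1" "block_coll \<mu> 0 1 \<mu> 0 \<in> K"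
        using \<mu>h lm KR False \<mu> by (auto simp: D_def)
      then show ?thesis
        using mult[of "block_coll \<mu> 0 1 \<mu> 0", OF _ KL[of l]] block_coll_mult[OF admissible_R[OF \<mu>] admissible_L[of l]]
          admissible_mult[OF admissible_R[OF \<mu>] admissible_L[of l]] by simp
    qed
    then have E: "block_coll (\<mu> * l) 0 1 \<mu> 0 \<in> K" "admissible (\<mu> * l) 0 1 \<mu> 0" by simp_all
    have "b\<^sup>2 * (\<mu> * l) = s" using D b by (simp add: \<mu>_def l_def)
    moreover have "b * \<mu> = - D / b" using b by (simp add: \<mu>_def power2_eq_square)
    ultimately have E': "block_coll s 0 b (- D / b) 0 \<in> K"
      using block_coll_scale[OF E(2) b] E(1) by simp
    have admE: "admissible s 0 b (- D / b) 0"
      using D b cjs by (simp add: admissible_def)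
    have adm1: "admissible 1 1 0 (d / b) 1" and adm2: "admissible 1 1 0 (a / b) 1"
      using cjs by (simp_all add: admissible_def)
    have "block_coll 1 1 0 (d / b) 1 \<otimes>\<^bsub>Bij_points\<^esub> (block_coll s 0 b (- D / b) 0 \<otimes>\<^bsub>Bij_points\<^esub> block_coll 1 1 0 (a / b) 1) = block_coll s a b c d"
      unfolding block_coll_mult[OF admE adm2]
      using block_coll_mult[OF adm1 admissible_mult[OF admE adm2]] b
      by (simp add: D_def field_simps)
    moreover have "block_coll 1 1 0 (d / b) 1 \<in> K" "block_coll 1 1 0 (a / b) 1 \<in> K"
      using KT cjs by simp_all
    ultimately show ?thesis using mult E' by metis
  qed
  show ?thesis
  proof (cases "b = 0")
    case False
    then show ?thesis using main[OF admissible _ KR] by blast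
  next
    case True
    \<comment> \<open>Exchanging the columns moves \<open>a\<close>, which is non-zero, to the
      position of \<open>b\<close>; the determinant changes by -1, a square in GF(q).\<close>
    have N: "admissible (-1) 0 1 1 0" using neg_one_pow_m by (rule admissible_N)
    have a: "a \<noteq> 0" using admissible True by (auto simp: admissible_def)
    have adm': "admissible (- s) 0 a d c"
      using admissible_mult[OF admissible N] True by simp
    have "(0 * c - a * d) ^ h = (a * d - b * c) ^ h"
      using True even_h by simp
    then have "block_coll (- s) 0 a d c \<in> K"
      using main[OF adm' a] KR by simp
    moreover have "block_coll (- s) 0 a d c \<otimes>\<^bsub>Bij_points\<^esub> block_coll (-1) 0 1 1 0 = block_coll s a b c d"
      using block_coll_mult[OF adm' N] True by simp
    ultimately show ?thesis
      using mult KN[OF neg_one_pow_m] by metis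
  qed
qed

lemma carrier_frak_G: "carrier (frak_G q) = block_colls"
proof (rule equalityI)
  have gens: "carrier Bij_points \<inter> gens_G = gens_G"
    using gens_G_subset subgroup.subset[OF subgroup_block_colls] by blast
  show "carrier (frak_G q) \<subseteq> block_colls"
    unfolding frak_G_eq carrier_subgroup_generated gens
    by (rule group.generate_subgroup_incl[OF group_Bij_points gens_G_subset subgroup_block_colls])
  have sub: "subgroup (generate Bij_points gens_G) Bij_points"
    using group.generate_is_subgroup[OF group_Bij_points] gens by blast
  have "block_coll s a b c d \<in> generate Bij_points gens_G" if "admissible s a b c d" for s a b c d
    by (rule block_coll_generated[OF sub _ _ _ _ that])
      (auto simp: gens_G_def intro!: generate.incl)
  then show "block_colls \<subseteq> carrier (frak_G q)"
    unfolding frak_G_eq carrier_subgroup_generated gens block_colls_def by blast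
qed

lemma group_frak_G: "group (frak_G q :: (('a ^ 4) set \<Rightarrow> ('a ^ 4) set) monoid)"
  unfolding frak_G_eq by (rule group.group_subgroup_generated[OF group_Bij_points])

lemma mult_frak_G: "mult (frak_G q) = mult Bij_points"
  unfolding frak_G_eq by simp

lemma one_frak_G: "\<one>\<^bsub>frak_G q\<^esub> = \<one>\<^bsub>Bij_points\<^esub>"
  unfolding frak_G_eq by simp

lemma block_coll_in_G: "admissible s a b c d \<Longrightarrow> block_coll s a b c d \<in> carrier (frak_G q)"
  unfolding carrier_frak_G block_colls_def by blast

text \<open>At j = p the entry vanishes in characteristic p, so the order of a transvection divides
  p.\<close>

lemma pow_T: "cj \<alpha> = \<alpha> \<Longrightarrow> block_coll 1 1 0 \<alpha> 1 [^]\<^bsub>frak_G q\<^esub> (j::nat) = block_coll 1 1 0 (of_nat j * \<alpha>) 1 \<and> cj (of_nat j * \<alpha>) = of_nat j * \<alpha>"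
proof (induction j)
  case 0
  then show ?case by (simp add: one_frak_G block_coll_one)
next
  case (Suc j)
  then show ?case
    using block_coll_mult[OF admissible_T admissible_T, of "of_nat j * \<alpha>" \<alpha>]
    by (simp add: mult_frak_G algebra_simps)
qed

lemma pow_U: "cj \<alpha> = \<alpha> \<Longrightarrow> block_coll 1 1 \<alpha> 0 1 [^]\<^bsub>frak_G q\<^esub> (j::nat) = block_coll 1 1 (of_nat j * \<alpha>) 0 1 \<and> cj (of_nat j * \<alpha>) = of_nat j * \<alpha>"
proof (induction j)
  case 0
  then show ?case by (simp add: one_frak_G block_coll_one)
next
  case (Suc j)
  then show ?case
    using block_coll_mult[OF admissible_U admissible_U, of "of_nat j * \<alpha>" \<alpha>]
    by (simp add: mult_frak_G algebra_simps)
qed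

lemma p_power_ordI:
  assumes "f \<in> carrier (frak_G q)" "f [^]\<^bsub>frak_G q\<^esub> p = \<one>\<^bsub>Bij_points\<^esub>"
  shows "\<exists>k. group.ord (frak_G q) f = p ^ k"
proof -
  have "group.ord (frak_G q) f dvd p"
    using group.pow_eq_id[OF group_frak_G assms(1)] assms(2) one_frak_G by metis
  then have "group.ord (frak_G q) f = 1 \<or> group.ord (frak_G q) f = p"
    using prime_p prime_nat_iff by blast
  then show ?thesis
    by (metis power_0 power_one_right)
qed

text \<open>Keeping track of a pair along with the power makes the character of the determinant
  available on elements of known order.\<close>

lemma block_coll_pow:
  assumes "admissible s a b c d"
  shows "\<exists>s' a' b' c' d'. admissible s' a' b' c' d' \<and> block_coll s a b c d [^]\<^bsub>frak_G q\<^esub> (j::nat) = block_coll s' a' b' c' d'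
    \<and> a' * d' - b' * c' = (a * d - b * c) ^ j"
proof (induction j)
  case 0
  have "admissible 1 1 0 0 1" by (simp add: admissible_def)
  then show ?case
    by (intro exI[of _ 1] exI[of _ 0]) (simp add: one_frak_G block_coll_one)
next
  case (Suc j)
  then obtain s' a' b' c' d' where IH: "admissible s' a' b' c' d'"
    "block_coll s a b c d [^]\<^bsub>frak_G q\<^esub> j = block_coll s' a' b' c' d'" "a' * d' - b' * c' = (a * d - b * c) ^ j"
    by blast
  have "block_coll s a b c d [^]\<^bsub>frak_G q\<^esub> Suc j = block_coll s' a' b' c' d' \<otimes>\<^bsub>Bij_points\<^esub> block_coll s a b c d"
    by (simp add: IH(2) mult_frak_G)
  then show ?case
    using admissible_mult[OF IH(1) assms] det_mult[of a' a b' c c' b d' d] IH(3)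
    unfolding block_coll_mult[OF IH(1) assms] by (metis mult.commute power_Suc)
qed

section \<open>The subgroup H as the kernel of the character\<close>

definition gens_H :: "(('a ^ 4) set \<Rightarrow> ('a ^ 4) set) set" where
  "gens_H = {f \<in> carrier (frak_G q). \<exists>k. group.ord (frak_G q) f = p ^ k} \<union> L_collineations q"

text \<open>
  The character of the determinant is a homomorphism to a group of order 2, hence trivial on
  elements of odd order.
\<close>

lemma gens_H_subset: "gens_H \<subseteq> square_block_colls"
proof
  fix f assume "f \<in> gens_H"
  then consider (L) "f \<in> L_collineations q"
    | (ord) k where "f \<in> carrier (frak_G q)" "group.ord (frak_G q) f = p ^ k"
    unfolding gens_H_def by blast
  then show "f \<in> square_block_colls"
  proof cases
    case L
    then obtain l where l: "f = block_coll l 1 0 0 1" "l ^ m = 1"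
      by (auto simp: L_collineations_def coll_L)
    have "((1::'a) * 1 - 0 * 0) ^ h = 1" by simp
    then show ?thesis
      unfolding square_block_colls_def l(1) using admissible_L[OF l(2)] by blast
  next
    case ord
    then obtain s a b c d where f: "f = block_coll s a b c d" "admissible s a b c d"
      unfolding carrier_frak_G block_colls_def by blast
    have one: "f [^]\<^bsub>frak_G q\<^esub> (p ^ k) = \<one>\<^bsub>Bij_points\<^esub>"
      using group.pow_eq_id[OF group_frak_G ord(1)] ord(2) one_frak_G by (metis dvd_refl)
    obtain s' a' b' c' d' where pw: "admissible s' a' b' c' d'"
      "f [^]\<^bsub>frak_G q\<^esub> (p ^ k) = block_coll s' a' b' c' d'" "a' * d' - b' * c' = (a * d - b * c) ^ (p ^ k)"
      using block_coll_pow[OF f(2)] f(1) by blast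
    have "admissible 1 1 0 0 1" by (simp add: admissible_def)
    then have "(a' * d' - b' * c') ^ h = (1 * 1 - 0 * 0) ^ h"
      using block_coll_sign[OF pw(1)] pw(2) one block_coll_one by metis
    then have "((a * d - b * c) ^ (p ^ k)) ^ h = 1"
      unfolding pw(3) by simp
    then have "((a * d - b * c) ^ h) ^ (p ^ k) = 1"
      by (simp only: power_mult[symmetric] mult.commute)
    moreover have "odd (p ^ k)" using odd_p by simp
    ultimately have "(a * d - b * c) ^ h = 1"
      using admissible_quad_char[OF f(2)] by (auto simp: neg_one_neq_one)
    then show ?thesis
      unfolding square_block_colls_def using f by blast
  qed
qed

lemma square_block_colls_subset_G: "square_block_colls \<subseteq> carrier (frak_G q)"
  unfolding square_block_colls_def carrier_frak_G block_colls_def by blast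

text \<open>All transvections lie in H. They produce the antidiagonal elements \<open>W\<close> of
  determinant 1, and from these together with the \<open>L\<close> one obtains \<open>N\<close> and
  \<open>M\<close>, which is enough for pairs of square determinant.\<close>

lemma carrier_frak_H: "carrier (frak_H p q) = square_block_colls"
proof -
  have car: "carrier (frak_H p q) = generate (frak_G q) gens_H"
  proof -
    have "carrier (frak_G q) \<inter> gens_H = gens_H"
      using gens_H_subset square_block_colls_subset_G by blast
    then show ?thesis
      unfolding frak_H_def carrier_subgroup_generated gens_H_def[symmetric] by simp
  qed
  have gen: "generate (frak_G q) gens_H = generate Bij_points gens_H"
  proof -
    have "frak_G q = Bij_points\<lparr>carrier := block_colls\<rparr>"
      unfolding carrier_frak_G[symmetric] unfolding frak_G_eq subgroup_generated_def by simp
    then show ?thesis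
      using group.generate_consistent[OF group_Bij_points _ subgroup_block_colls, of gens_H] gens_H_subset
        square_block_colls_subset_G carrier_frak_G by simp
  qed
  let ?K = "generate Bij_points gens_H"
  have sub: "subgroup ?K Bij_points"
    using group.generate_is_subgroup[OF group_Bij_points] gens_H_subset subgroup.subset[OF subgroup_square_block_colls]
    by blast
  have mult: "f \<otimes>\<^bsub>Bij_points\<^esub> f' \<in> ?K" if "f \<in> ?K" "f' \<in> ?K" for f f'
    using subgroup.m_closed[OF sub that] .
  have T: "block_coll 1 1 0 \<alpha> 1 \<in> ?K" if "cj \<alpha> = \<alpha>" for \<alpha>
  proof -
    have "block_coll 1 1 0 \<alpha> 1 [^]\<^bsub>frak_G q\<^esub> p = \<one>\<^bsub>Bij_points\<^esub>"
      using pow_T[OF that, of p] by (simp add: of_nat_p block_coll_one)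
    then have "block_coll 1 1 0 \<alpha> 1 \<in> gens_H"
      unfolding gens_H_def using p_power_ordI block_coll_in_G[OF admissible_T[OF that]] by blast
    then show ?thesis by (rule generate.incl)
  qed
  have U: "block_coll 1 1 \<alpha> 0 1 \<in> ?K" if "cj \<alpha> = \<alpha>" for \<alpha>
  proof -
    have "block_coll 1 1 \<alpha> 0 1 [^]\<^bsub>frak_G q\<^esub> p = \<one>\<^bsub>Bij_points\<^esub>"
      using pow_U[OF that, of p] by (simp add: of_nat_p block_coll_one)
    then have "block_coll 1 1 \<alpha> 0 1 \<in> gens_H"
      unfolding gens_H_def using p_power_ordI block_coll_in_G[OF admissible_U[OF that]] by blast
    then show ?thesis by (rule generate.incl)
  qed
  have L: "block_coll l 1 0 0 1 \<in> ?K" if "l ^ m = 1" for l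
    using that by (intro generate.incl) (auto simp: gens_H_def L_collineations_def coll_L)
  have W: "block_coll 1 0 t (- 1 / t) 0 \<in> ?K" "admissible 1 0 t (- 1 / t) 0" if t: "cj t = t" "t \<noteq> 0" for t
  proof -
    have t': "cj (- 1 / t) = - 1 / t" using t by simp
    \<comment> \<open>The standard factorisation of a Weyl element of SL(2,q) into three
      transvections.\<close>
    have "block_coll 1 1 t 0 1 \<otimes>\<^bsub>Bij_points\<^esub> (block_coll 1 1 0 (- 1 / t) 1 \<otimes>\<^bsub>Bij_points\<^esub> block_coll 1 1 t 0 1) = block_coll 1 0 t (- 1 / t) 0"
      unfolding block_coll_mult[OF admissible_T[OF t'] admissible_U[OF t(1)]]
      using block_coll_mult[OF admissible_U[OF t(1)] admissible_mult[OF admissible_T[OF t'] admissible_U[OF t(1)]]] t(2) by simp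
    then show "block_coll 1 0 t (- 1 / t) 0 \<in> ?K"
      using mult T[OF t'] U[OF t(1)] by metis
    show "admissible 1 0 t (- 1 / t) 0" using t by (simp add: admissible_def)
  qed
  have N: "block_coll l 0 1 1 0 \<in> ?K" if l: "l ^ m = -1" for l
  proof -
    \<comment> \<open>Scaling the swap of determinant -1 by a square root \<open>i\<close> of -1
      gives determinant 1; since -1 / i = i, the result is the Weyl element for t = i.\<close>
    obtain i where i: "cj i = i" "i\<^sup>2 = -1"
      using quad_char_imp_square[of "-1"] quad_char_neg_one by auto
    have i0: "i \<noteq> 0" using i(2) by auto
    have "(- l) ^ m = 1" using odd_m l by simp
    note L' = L[OF this] admissible_L[OF this]
    have "- 1 / i = i" using i i0 by (simp add: field_simps power2_eq_square)
    then have "block_coll 1 0 i i 0 \<in> ?K" "admissible 1 0 i i 0"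
      using W[OF i(1) i0] by simp_all
    then have "block_coll (- l) 0 i i 0 \<in> ?K"
      using mult[OF L'(1)] block_coll_mult[OF L'(2)] by fastforce
    moreover have "block_coll (i\<^sup>2 * l) (i * 0) (i * 1) (i * 1) (i * 0) = block_coll l 0 1 1 0"
      by (rule block_coll_scale[OF admissible_N[OF l] i0])
    ultimately show ?thesis using i(2) by simp
  qed
  have M: "block_coll \<rho> 1 0 0 \<rho> \<in> ?K" if \<rho>: "cj \<rho> = \<rho>" "\<rho> \<noteq> 0" "\<rho> ^ h = 1" for \<rho>
  proof -
    obtain b where b: "cj b = b" "\<rho> = b\<^sup>2" using quad_char_imp_square[OF \<rho>] by blast
    have b0: "b \<noteq> 0" using b \<rho> by auto
    \<comment> \<open>The Weyl elements for t = 1 and t = -b multiply to diag(1/b, b), which scaled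
      by \<open>b\<close> is diag(1, b^2).\<close>
    have cb: "cj (- b) = - b" "- b \<noteq> 0" using b b0 by simp_all
    have W1: "block_coll 1 0 1 (- 1 / 1) 0 \<in> ?K" "admissible 1 0 1 (- 1 / 1) 0"
      using W[of 1] by simp_all
    have "block_coll 1 (1 / b) 0 0 b \<in> ?K"
      using mult[OF W1(1) W(1)[OF cb]] block_coll_mult[OF W1(2) W(2)[OF cb]] by simp
    moreover have "admissible 1 (1 / b) 0 0 b"
      using b b0 by (simp add: admissible_def)
    from block_coll_scale[OF this b0] have "block_coll \<rho> 1 0 0 \<rho> = block_coll 1 (1 / b) 0 0 b"
      using b b0 by (simp add: power2_eq_square)
    ultimately show ?thesis by simp
  qed
  have "square_block_colls \<subseteq> ?K"
    unfolding square_block_colls_def using block_coll_generated[OF sub T M L N] by blast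
  moreover have "?K \<subseteq> square_block_colls"
    by (rule group.generate_subgroup_incl[OF group_Bij_points gens_H_subset subgroup_square_block_colls])
  ultimately show ?thesis unfolding car gen by blast
qed


subsection \<open>Index and orbits\<close>

abbreviation G_grp :: "(('a ^ 4) set \<Rightarrow> ('a ^ 4) set) monoid" where
  "G_grp \<equiv> frak_G q"

abbreviation H_grp :: "(('a ^ 4) set \<Rightarrow> ('a ^ 4) set) monoid" where
  "H_grp \<equiv> frak_H p q"

lemma subgroup_H: "subgroup (carrier H_grp) G_grp"
proof -
  have "subgroup square_block_colls (subgroup_generated Bij_points gens_G)"
    using group.subgroup_subgroup_generated_iff[OF group_Bij_points] subgroup_square_block_colls
      square_block_colls_subset_G unfolding frak_G_eq by blast
  then show ?thesis
    unfolding carrier_frak_H frak_G_eq .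
qed

text \<open>The collineation \<open>?r\<close> is an involution of non-square determinant. For f
  outside H the product of f and \<open>?r\<close> lies in H, so f belongs to the coset of
  \<open>?r\<close>.\<close>

lemma index_H: "card (rcosets\<^bsub>G_grp\<^esub> (carrier H_grp)) = 2"
proof -
  interpret G: group G_grp by (rule group_frak_G)
  obtain \<mu> where \<mu>: "cj \<mu> = \<mu>" "\<mu> \<noteq> 0" "\<mu> ^ h = -1"
    using nonsquare_exists by blast
  note R = admissible_R[OF \<mu>]
  let ?r = "block_coll \<mu> 0 1 \<mu> 0" and ?K = "carrier H_grp"
  have r: "?r \<in> carrier G_grp" using block_coll_in_G[OF R] .
  have r_notin: "?r \<notin> ?K"
  proof
    assume "?r \<in> ?K"
    then obtain s a b c d where "?r = block_coll s a b c d" "admissible s a b c d" "(a * d - b * c) ^ h = 1"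
      unfolding carrier_frak_H square_block_colls_def by blast
    then have "(0 * 0 - 1 * \<mu>) ^ h = 1" using block_coll_sign[OF R] by metis
    then show False using \<mu>(3) even_h neg_one_neq_one by simp
  qed
  have coset: "?K #>\<^bsub>G_grp\<^esub> f = ?K \<or> ?K #>\<^bsub>G_grp\<^esub> f = ?K #>\<^bsub>G_grp\<^esub> ?r" if f: "f \<in> carrier G_grp" for f
  proof (cases "f \<in> ?K")
    case True
    then show ?thesis
      using G.coset_join2[OF f subgroup_H] by blast
  next
    case False
    obtain s a b c d where fco: "f = block_coll s a b c d" "admissible s a b c d"
      using f unfolding carrier_frak_G block_colls_def by blast
    then have D: "(a * d - b * c) ^ h = -1"
      using False admissible_quad_char[OF fco(2)] unfolding carrier_frak_H square_block_colls_def by blast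
    have det: "((a * 0 + b * \<mu>) * (c * 1 + d * 0) - (a * 1 + b * 0) * (c * 0 + d * \<mu>)) ^ h = 1"
      unfolding det_mult using D \<mu>(3) even_h by (simp add: power_mult_distrib)
    have "f \<otimes>\<^bsub>G_grp\<^esub> ?r \<in> ?K"
      unfolding mult_frak_G fco(1) block_coll_mult[OF fco(2) R] carrier_frak_H square_block_colls_def
      using admissible_mult[OF fco(2) R] det by blast
    \<comment> \<open>The square of \<open>?r\<close> belongs to the scalar matrix \<mu> and acts
      trivially.\<close>
    moreover have "?r \<otimes>\<^bsub>G_grp\<^esub> ?r = \<one>\<^bsub>G_grp\<^esub>"
    proof -
      have "admissible 1 1 0 0 1" by (simp add: admissible_def)
      from block_coll_scale[OF this \<mu>(2)] have "block_coll (\<mu>\<^sup>2) \<mu> 0 0 \<mu> = \<one>\<^bsub>Bij_points\<^esub>"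
        by (simp add: block_coll_one)
      then show ?thesis
        unfolding mult_frak_G one_frak_G block_coll_mult[OF R R] by (simp add: power2_eq_square)
    qed
    then have "f = (f \<otimes>\<^bsub>G_grp\<^esub> ?r) \<otimes>\<^bsub>G_grp\<^esub> ?r"
      using f r by (simp add: G.m_assoc)
    ultimately have "f \<in> ?K #>\<^bsub>G_grp\<^esub> ?r"
      unfolding r_coset_def by blast
    then show ?thesis
      using G.repr_independence[OF _ r subgroup_H] by blast
  qed
  have "?K \<noteq> ?K #>\<^bsub>G_grp\<^esub> ?r"
    using G.rcos_self[OF r subgroup_H] r_notin by blast
  moreover have "rcosets\<^bsub>G_grp\<^esub> ?K = {?K, ?K #>\<^bsub>G_grp\<^esub> ?r}"
  proof (intro equalityI subsetI)
    fix C assume "C \<in> rcosets\<^bsub>G_grp\<^esub> ?K"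
    then show "C \<in> {?K, ?K #>\<^bsub>G_grp\<^esub> ?r}"
      using coset unfolding RCOSETS_def by blast
  next
    fix C assume "C \<in> {?K, ?K #>\<^bsub>G_grp\<^esub> ?r}"
    moreover have "?K = ?K #>\<^bsub>G_grp\<^esub> \<one>\<^bsub>G_grp\<^esub>"
      using G.coset_join2[OF G.one_closed subgroup_H] subgroup.one_closed[OF subgroup_H] by simp
    ultimately show "C \<in> rcosets\<^bsub>G_grp\<^esub> ?K"
      using r G.one_closed unfolding RCOSETS_def by blast
  qed
  ultimately show ?thesis by simp
qed

text \<open>Invariance is assumed under all pairs and transitivity for pairs of square determinant,
  so every group between H and G has S as orbit.\<close>

lemma orbit_eq:
  assumes "\<And>s a b c d P. admissible s a b c d \<Longrightarrow> P \<in> S \<Longrightarrow> block_coll s a b c d P \<in> S"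
    and "\<And>P P0. P \<in> S \<Longrightarrow> P0 \<in> S \<Longrightarrow> \<exists>s a b c d. admissible s a b c d \<and> (a * d - b * c) ^ h = 1 \<and> block_coll s a b c d P = P0"
    and "S \<subseteq> XF" "P \<in> S"
  shows "orbit G_grp (\<lambda>g. \<lambda>P\<in>XF. g P) P = S" "orbit H_grp (\<lambda>g. \<lambda>P\<in>XF. g P) P = S"
proof -
  have P: "P \<in> XF" using assms by blast
  have G: "f P \<in> S" if "f \<in> carrier G_grp" for f
    using that assms(1,4) unfolding carrier_frak_G block_colls_def by blast
  have H: "\<exists>f\<in>carrier H_grp. f P = P0" if "P0 \<in> S" for P0
    using assms(2)[OF assms(4) that] unfolding carrier_frak_H square_block_colls_def by blast
  have HG: "carrier H_grp \<subseteq> carrier G_grp"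
    using subgroup.subset[OF subgroup_H] .
  have "orbit K (\<lambda>g. \<lambda>P\<in>XF. g P) P = S"
    if K: "carrier H_grp \<subseteq> carrier K" "carrier K \<subseteq> carrier G_grp" for K :: "(('a ^ 4) set \<Rightarrow> ('a ^ 4) set) monoid"
  proof (intro equalityI subsetI)
    fix Q assume "Q \<in> orbit K (\<lambda>g. \<lambda>P\<in>XF. g P) P"
    then obtain f where "f \<in> carrier K" "Q = f P"
      using P unfolding orbit_def by auto
    then show "Q \<in> S" using G K by blast
  next
    fix Q assume "Q \<in> S"
    then obtain f where "f \<in> carrier K" "f P = Q" using H K by blast
    then show "Q \<in> orbit K (\<lambda>g. \<lambda>P\<in>XF. g P) P"
      using P unfolding orbit_def by auto
  qed
  then show "orbit G_grp (\<lambda>g. \<lambda>P\<in>XF. g P) P = S" "orbit H_grp (\<lambda>g. \<lambda>P\<in>XF. g P) P = S"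
    using HG by blast+
qed

lemma orbit_conic_orbit:
  assumes "P \<in> conic_orbit" "conic_orbit \<subseteq> XF"
  shows "orbit G_grp (\<lambda>g. \<lambda>P\<in>XF. g P) P = conic_orbit" "orbit H_grp (\<lambda>g. \<lambda>P\<in>XF. g P) P = conic_orbit"
proof -
  have img: "block_coll s a b c d P \<in> conic_orbit" if "admissible s a b c d" "P \<in> conic_orbit" for s a b c d P
    using conic_orbit_collineation[OF that] unfolding block_coll_def .
  have trans: "\<exists>s a b c d. admissible s a b c d \<and> (a * d - b * c) ^ h = 1 \<and> block_coll s a b c d P = P0"
    if "P \<in> conic_orbit" "P0 \<in> conic_orbit" for P P0
    unfolding block_coll_def by (rule conic_orbit_transitive[OF that]) blast
  show "orbit G_grp (\<lambda>g. \<lambda>P\<in>XF. g P) P = conic_orbit" "orbit H_grp (\<lambda>g. \<lambda>P\<in>XF. g P) P = conic_orbit"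
    using orbit_eq[OF img trans assms(2,1)] by blast+
qed

lemma orbit_offconic_orbit:
  assumes "P \<in> offconic_orbit" "offconic_orbit \<subseteq> XF"
  shows "orbit G_grp (\<lambda>g. \<lambda>P\<in>XF. g P) P = offconic_orbit" "orbit H_grp (\<lambda>g. \<lambda>P\<in>XF. g P) P = offconic_orbit"
proof -
  have img: "block_coll s a b c d P \<in> offconic_orbit" if "admissible s a b c d" "P \<in> offconic_orbit" for s a b c d P
    using offconic_orbit_collineation[OF that] unfolding block_coll_def .
  have trans: "\<exists>s a b c d. admissible s a b c d \<and> (a * d - b * c) ^ h = 1 \<and> block_coll s a b c d P = P0"
    if "P \<in> offconic_orbit" "P0 \<in> offconic_orbit" for P P0
    unfolding block_coll_def by (rule offconic_orbit_transitive[OF that]) blast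
  show "orbit G_grp (\<lambda>g. \<lambda>P\<in>XF. g P) P = offconic_orbit" "orbit H_grp (\<lambda>g. \<lambda>P\<in>XF. g P) P = offconic_orbit"
    using orbit_eq[OF img trans assms(2,1)] by blast+
qed

section \<open>Orbits on generators\<close>

lemma block_coll_image_mult:
  assumes "admissible s a b c d" "admissible s' a' b' c' d'" "l \<subseteq> pg_points"
  shows "(block_coll s a b c d \<otimes>\<^bsub>Bij_points\<^esub> block_coll s' a' b' c' d') ` l = block_coll s a b c d ` (block_coll s' a' b' c' d' ` l)"
proof -
  have "(block_coll s a b c d \<otimes>\<^bsub>Bij_points\<^esub> block_coll s' a' b' c' d') P = block_coll s a b c d (block_coll s' a' b' c' d' P)" if "P \<in> l" for P
    using assms that unfolding block_coll_def
    by (subst collineation_mult) (auto simp: admissible_invertible collineation_comp)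
  then show ?thesis by (auto simp: image_image)
qed

text \<open>A common argument for both families, with \<open>cls\<close> the level sets of the
  invariant. Some element of G joins any two generators; if both have the same invariant, its
  multiplier is 1 and it lies in H. So the orbits of H are the level sets.\<close>

lemma generator_orbits:
  fixes cls :: "'a \<Rightarrow> ('a ^ 4) set set set"
  assumes img: "\<And>s a b c d l e. admissible s a b c d \<Longrightarrow> l \<in> cls e \<Longrightarrow> block_coll s a b c d ` l \<in> cls ((a * d - b * c) ^ h * e)"
    and uniq: "\<And>l e e'. l \<in> cls e \<Longrightarrow> l \<in> cls e' \<Longrightarrow> e = e'"
    and trans: "\<And>l l' e e'. l \<in> cls e \<Longrightarrow> l' \<in> cls e' \<Longrightarrow> \<exists>s a b c d. admissible s a b c d \<and> block_coll s a b c d ` l = l'"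
    and nz: "\<And>l e. l \<in> cls e \<Longrightarrow> e \<noteq> 0"
    and sub: "\<And>l e. l \<in> cls e \<Longrightarrow> l \<subseteq> pg_points"
    and ne: "l0 \<in> cls e0"
    and E: "E = (\<Union>e. cls e)"
  shows "transitive_action G_grp E (\<lambda>g. \<lambda>l\<in>E. g ` l)"
    and "card (orbits H_grp E (\<lambda>g. \<lambda>l\<in>E. g ` l)) = 2"
proof -
  interpret G: group G_grp by (rule group_frak_G)
  have GE: "f ` l \<in> E" if f: "f \<in> carrier G_grp" and l: "l \<in> E" for f l
  proof -
    obtain s a b c d where fco: "f = block_coll s a b c d" "admissible s a b c d"
      using f unfolding carrier_frak_G block_colls_def by blast
    obtain e where e: "l \<in> cls e" using l unfolding E by blast
    show ?thesis using img[OF fco(2) e] unfolding fco(1) E by (rule UN_I[OF UNIV_I])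
  qed
  have comp: "(f \<otimes>\<^bsub>G_grp\<^esub> f') ` l = f ` (f' ` l)" if f: "f \<in> carrier G_grp" "f' \<in> carrier G_grp" and l: "l \<in> E" for f f' l
  proof -
    obtain s a b c d where 1: "f = block_coll s a b c d" "admissible s a b c d"
      using f unfolding carrier_frak_G block_colls_def by blast
    obtain s' a' b' c' d' where 2: "f' = block_coll s' a' b' c' d'" "admissible s' a' b' c' d'"
      using f unfolding carrier_frak_G block_colls_def by blast
    have "l \<subseteq> pg_points" using l sub unfolding E by blast
    then show ?thesis
      unfolding mult_frak_G 1(1) 2(1) using block_coll_image_mult[OF 1(2) 2(2)] by blast
  qed
  have one: "\<one>\<^bsub>G_grp\<^esub> ` l = l" if l: "l \<in> E" for l
  proof -
    have "l \<subseteq> pg_points" using l sub unfolding E by blast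
    then show ?thesis unfolding one_frak_G by (force simp: BijGroup_def)
  qed
  let ?\<phi> = "\<lambda>g. \<lambda>l\<in>E. g ` l"
  have Bij: "?\<phi> f \<in> Bij E" if f: "f \<in> carrier G_grp" for f
  proof -
    have "bij_betw (?\<phi> f) E E"
      by (rule bij_betw_byWitness[where f' = "?\<phi> (inv\<^bsub>G_grp\<^esub> f)"])
        (use f in \<open>auto simp: GE one simp flip: comp\<close>)
    then show ?thesis by (simp add: Bij_def)
  qed
  have "group_hom G_grp (BijGroup E) ?\<phi>"
    unfolding group_hom_def group_hom_axioms_def
  proof (intro conjI homI)
    fix f f' assume f: "f \<in> carrier G_grp" "f' \<in> carrier G_grp"
    have "?\<phi> (f \<otimes>\<^bsub>G_grp\<^esub> f') = compose E (?\<phi> f) (?\<phi> f')"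
      using f by (intro extensionalityI[of _ E]) (auto simp: compose_def comp GE)
    then show "?\<phi> (f \<otimes>\<^bsub>G_grp\<^esub> f') = ?\<phi> f \<otimes>\<^bsub>BijGroup E\<^esub> ?\<phi> f'"
      using Bij f by (simp add: BijGroup_def)
  qed (use Bij group_BijGroup group_frak_G in \<open>auto simp: BijGroup_def\<close>)
  then show "transitive_action G_grp E ?\<phi>"
    unfolding transitive_action_def group_action_def transitive_action_axioms_def
  proof (intro conjI allI impI)
    fix l l' assume l: "l \<in> E" "l' \<in> E"
    then obtain e e' where ee: "l \<in> cls e" "l' \<in> cls e'" unfolding E by blast
    obtain s a b c d where fco: "admissible s a b c d" "block_coll s a b c d ` l = l'"
      using trans[OF ee] by blast
    show "\<exists>f\<in>carrier G_grp. ?\<phi> f l = l'"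
      by (rule bexI[OF _ block_coll_in_G[OF fco(1)]]) (simp add: l fco(2))
  qed
  have orb: "orbit H_grp ?\<phi> l = cls e" if l: "l \<in> cls e" for l e
  proof -
    have lE: "l \<in> E" using l unfolding E by blast
    have up: "f ` l \<in> cls e" if f: "f \<in> carrier H_grp" for f
    proof -
      obtain s a b c d where fco: "f = block_coll s a b c d" "admissible s a b c d" "(a * d - b * c) ^ h = 1"
        using f unfolding carrier_frak_H square_block_colls_def by blast
      show ?thesis using img[OF fco(2) l] unfolding fco(1,3) by simp
    qed
    have down: "\<exists>f\<in>carrier H_grp. f ` l = l'" if l': "l' \<in> cls e" for l'
    proof -
      obtain s a b c d where fco: "admissible s a b c d" "block_coll s a b c d ` l = l'"
        using trans[OF l l'] by blast
      then have "(a * d - b * c) ^ h * e = e"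
        using img[OF fco(1) l] uniq l' by metis
      then have "(a * d - b * c) ^ h = 1" using nz[OF l] by simp
      then have "block_coll s a b c d \<in> carrier H_grp"
        using fco(1) unfolding carrier_frak_H square_block_colls_def by blast
      then show ?thesis by (intro bexI[of _ "block_coll s a b c d"] fco(2))
    qed
    have eq: "orbit H_grp ?\<phi> l = (\<lambda>f. f ` l) ` carrier H_grp"
      unfolding orbit_def using lE by (simp add: Setcompr_eq_image)
    show ?thesis
      unfolding eq
    proof (intro equalityI subsetI)
      fix l' assume "l' \<in> cls e"
      then obtain f where f: "f \<in> carrier H_grp" "f ` l = l'" by (rule bexE[OF down])
      show "l' \<in> (\<lambda>f. f ` l) ` carrier H_grp"
        unfolding f(2)[symmetric] by (rule imageI[OF f(1)])
    qed (use up in auto)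
  qed
  \<comment> \<open>A pair of non-square determinant carries \<open>l0\<close> to the opposite
    value, so both level sets are inhabited.\<close>
  obtain \<mu> where \<mu>: "cj \<mu> = \<mu>" "\<mu> \<noteq> 0" "\<mu> ^ h = -1"
    using nonsquare_exists by blast
  have "(0 * 0 - 1 * \<mu>) ^ h = -1" using \<mu>(3) even_h by simp
  then have l1: "block_coll \<mu> 0 1 \<mu> 0 ` l0 \<in> cls (- e0)"
    using img[OF admissible_R[OF \<mu>] ne] by simp
  have vals: "e = e0 \<or> e = - e0" if l: "l \<in> cls e" for l e
  proof -
    obtain s a b c d where fco: "admissible s a b c d" "block_coll s a b c d ` l0 = l"
      using trans[OF ne l] by blast
    then have "(a * d - b * c) ^ h * e0 = e"
      using img[OF fco(1) ne] uniq l by metis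
    then show ?thesis using admissible_quad_char[OF fco(1)] by auto
  qed
  have "orbits H_grp E ?\<phi> = {cls e0, cls (- e0)}"
  proof (intro equalityI subsetI)
    fix C assume "C \<in> orbits H_grp E ?\<phi>"
    then obtain l where l: "l \<in> E" "C = orbit H_grp ?\<phi> l" unfolding orbits_def by blast
    then obtain e where e: "l \<in> cls e" unfolding E by blast
    then show "C \<in> {cls e0, cls (- e0)}" using orb[OF e] vals[OF e] l(2) by auto
  next
    fix C assume C: "C \<in> {cls e0, cls (- e0)}"
    have "l0 \<in> E" "block_coll \<mu> 0 1 \<mu> 0 ` l0 \<in> E" using ne l1 unfolding E by blast+
    then have "orbit H_grp ?\<phi> l0 \<in> orbits H_grp E ?\<phi>" "orbit H_grp ?\<phi> (block_coll \<mu> 0 1 \<mu> 0 ` l0) \<in> orbits H_grp E ?\<phi>"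
      unfolding orbits_def by blast+
    then show "C \<in> orbits H_grp E ?\<phi>"
      using C unfolding orb[OF ne] orb[OF l1] by blast
  qed
  moreover have "cls e0 \<noteq> cls (- e0)"
  proof
    assume "cls e0 = cls (- e0)"
    then have "e0 = - e0" using uniq ne by blast
    then have "2 * e0 = 0" by (metis add.right_inverse mult_2)
    then show False using nz[OF ne] two_neq_0 by simp
  qed
  ultimately show "card (orbits H_grp E ?\<phi>) = 2" by simp
qed

lemma gen_subset_points: "line_through u v \<subseteq> pg_points"
  by (auto simp: line_through_def)

lemma generators_conic_orbit:
  defines "E \<equiv> generators_meeting q conic_orbit"
  shows "transitive_action G_grp E (\<lambda>g. \<lambda>l\<in>E. g ` l)" "card (orbits H_grp E (\<lambda>g. \<lambda>l\<in>E. g ` l)) = 2"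
proof -
  obtain l0 e0 where ne: "l0 \<in> conic_class e0" using conic_class_nonempty by blast
  have nz: "e \<noteq> 0" if "l \<in> conic_class e" for l e
    using conic_class_value[OF that] two_neq_0 by auto
  have sub: "l \<subseteq> pg_points" if "l \<in> conic_class e" for l e
    using that gen_subset_points unfolding conic_class_def conic_gen_def by blast
  have img: "block_coll s a b c d ` l \<in> conic_class ((a * d - b * c) ^ h * e)" if "admissible s a b c d" "l \<in> conic_class e"
    for s a b c d l e
    using conic_class_collineation[OF that] unfolding block_coll_def .
  have trans: "\<exists>s a b c d. admissible s a b c d \<and> block_coll s a b c d ` l = l'" if "l \<in> conic_class e" "l' \<in> conic_class e'" for l l' e e'
    unfolding block_coll_def by (rule conic_class_transitive[OF that]) blast
  show "transitive_action G_grp E (\<lambda>g. \<lambda>l\<in>E. g ` l)" "card (orbits H_grp E (\<lambda>g. \<lambda>l\<in>E. g ` l)) = 2"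
    by (rule generator_orbits[OF img conic_class_unique trans nz sub ne generators_meeting_conic_orbit[folded E_def]];
        assumption)+
qed

text \<open>The point P supplies the parameters of a first generator; on the conic these can be
  written down explicitly.\<close>

lemma generators_offconic_orbit:
  assumes "P \<in> offconic_orbit"
  defines "E \<equiv> generators_meeting q offconic_orbit"
  shows "transitive_action G_grp E (\<lambda>g. \<lambda>l\<in>E. g ` l)" "card (orbits H_grp E (\<lambda>g. \<lambda>l\<in>E. g ` l)) = 2"
proof -
  obtain z y x where zy: "alt_form z y \<noteq> 0" "x ^ m = alt_form z y" using assms(1) unfolding offconic_orbit_def by blast
  obtain k where "k * cj k = 1 / 2"
    using norm_surj[of "1 / 2"] two_neq_0 by auto
  then have "2 * k * cj k = 1" using two_neq_0 by (simp add: field_simps)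
  then have ne: "offconic_gen z y x k \<in> offconic_class (k ^ m * alt_form z y ^ h)"
    unfolding offconic_class_def using zy by blast
  have nz: "e \<noteq> 0" if "l \<in> offconic_class e" for l e
    using offconic_class_value[OF that] by auto
  have sub: "l \<subseteq> pg_points" if "l \<in> offconic_class e" for l e
    using that gen_subset_points unfolding offconic_class_def offconic_gen_def by blast
  have img: "block_coll s a b c d ` l \<in> offconic_class ((a * d - b * c) ^ h * e)" if "admissible s a b c d" "l \<in> offconic_class e"
    for s a b c d l e
    using offconic_class_collineation[OF that] unfolding block_coll_def .
  have trans: "\<exists>s a b c d. admissible s a b c d \<and> block_coll s a b c d ` l = l'" if "l \<in> offconic_class e" "l' \<in> offconic_class e'" for l l' e e'
    unfolding block_coll_def by (rule offconic_class_transitive[OF that]) blast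
  show "transitive_action G_grp E (\<lambda>g. \<lambda>l\<in>E. g ` l)" "card (orbits H_grp E (\<lambda>g. \<lambda>l\<in>E. g ` l)) = 2"
    by (rule generator_orbits[OF img offconic_class_unique trans nz sub ne generators_meeting_offconic_orbit[folded E_def]];
        assumption)+
qed

lemma orbits_and_generators:
  fixes XF :: "('a ^ 4) set set"
  assumes "XF = X_plus_rational q"
  shows "orbits G_grp XF (\<lambda>g. \<lambda>P\<in>XF. g P) = orbits H_grp XF (\<lambda>g. \<lambda>P\<in>XF. g P)"
    and "\<forall>orb \<in> orbits G_grp XF (\<lambda>g. \<lambda>P\<in>XF. g P).
            transitive_action G_grp (generators_meeting q orb)
              (\<lambda>g. \<lambda>l\<in>generators_meeting q orb. g ` l)
            \<and> card (orbits H_grp (generators_meeting q orb)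
                     (\<lambda>g. \<lambda>l\<in>generators_meeting q orb. g ` l)) = 2"
proof -
  have XF: "XF = conic_orbit \<union> offconic_orbit" using assms X_plus_rational_orbits by simp
  then have sub: "conic_orbit \<subseteq> XF" "offconic_orbit \<subseteq> XF" by blast+
  have "orbit G_grp (\<lambda>g. \<lambda>P\<in>XF. g P) P = orbit H_grp (\<lambda>g. \<lambda>P\<in>XF. g P) P" if "P \<in> XF" for P
    using that orbit_conic_orbit[OF _ sub(1)] orbit_offconic_orbit[OF _ sub(2)] XF by blast
  then show "orbits G_grp XF (\<lambda>g. \<lambda>P\<in>XF. g P) = orbits H_grp XF (\<lambda>g. \<lambda>P\<in>XF. g P)"
    unfolding orbits_def Setcompr_eq_image by (rule image_cong[OF refl])
  show "\<forall>orb \<in> orbits G_grp XF (\<lambda>g. \<lambda>P\<in>XF. g P).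
            transitive_action G_grp (generators_meeting q orb)
              (\<lambda>g. \<lambda>l\<in>generators_meeting q orb. g ` l)
            \<and> card (orbits H_grp (generators_meeting q orb)
                     (\<lambda>g. \<lambda>l\<in>generators_meeting q orb. g ` l)) = 2"
  proof
    fix orb assume "orb \<in> orbits G_grp XF (\<lambda>g. \<lambda>P\<in>XF. g P)"
    then obtain P where P: "P \<in> XF" "orb = orbit G_grp (\<lambda>g. \<lambda>P\<in>XF. g P) P"
      unfolding orbits_def by blast
    then consider "orb = conic_orbit" | "orb = offconic_orbit" "P \<in> offconic_orbit"
      using orbit_conic_orbit(1)[OF _ sub(1)] orbit_offconic_orbit(1)[OF _ sub(2)] unfolding XF by auto
    then show "transitive_action G_grp (generators_meeting q orb)
              (\<lambda>g. \<lambda>l\<in>generators_meeting q orb. g ` l)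
            \<and> card (orbits H_grp (generators_meeting q orb)
                     (\<lambda>g. \<lambda>l\<in>generators_meeting q orb. g ` l)) = 2"
    proof cases
      case 1
      show ?thesis unfolding 1 by (intro conjI generators_conic_orbit)
    next
      case 2
      show ?thesis unfolding 2(1) by (intro conjI generators_offconic_orbit[OF 2(2)])
    qed
  qed
qed

end

theorem theorem5p13:
  fixes p n q :: nat
    and G H :: "(('a::{field, finite} ^ 4) set \<Rightarrow> ('a ^ 4) set) monoid"
    and XF :: "('a ^ 4) set set"
  assumes "Factorial_Ring.prime p" and "odd p" and "n \<ge> 1" and "q = p ^ n" and "[q = 1] (mod 4)"
    and "CARD('a) = q\<^sup>2"
    and "G = frak_G q" and "H = frak_H p q" and "XF = X_plus_rational q"
  shows "(subgroup (carrier H) G \<and> card (rcosets\<^bsub>G\<^esub> (carrier H)) = 2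
           \<and> orbits G XF (\<lambda>g. \<lambda>P\<in>XF. g P) = orbits H XF (\<lambda>g. \<lambda>P\<in>XF. g P))
       \<and> (\<forall>orb \<in> orbits G XF (\<lambda>g. \<lambda>P\<in>XF. g P).
            transitive_action G (generators_meeting q orb)
              (\<lambda>g. \<lambda>l\<in>generators_meeting q orb. g ` l)
            \<and> card (orbits H (generators_meeting q orb)
                     (\<lambda>g. \<lambda>l\<in>generators_meeting q orb. g ` l)) = 2)"
proof -
  obtain g :: 'a where g: "\<And>x. x \<noteq> 0 \<Longrightarrow> \<exists>i. x = g ^ i"
    using finite_field_primitive_element by blast
  have mod4: "q mod 4 = 1"
    using assms(5) by (simp add: cong_def)
  interpret hermitian_field p n q "(q - 1) div 2 + 1" "(q - 1) div 2" g
  proof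
    show "q = 2 * ((q - 1) div 2) + 1" "even ((q - 1) div 2)"
      using mod4 by presburger+
  qed (use assms g in auto)
  show ?thesis
    unfolding assms(7,8)
    by (intro conjI subgroup_H index_H orbits_and_generators[OF assms(9)])
qed

end
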